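(* Let $\alpha\in(0,1)$ and let $f=f_{M_1}$ (with $c_1$ chosen sufficiently large, so that $e^{-c_1}\ll1$). Let $Y=[1/2,1]$. Then there exist a countable partition $\mathcal Q$ (mod $\mu$) of $Y$ into subintervals $\{Y_i\}$ and a return time function $\varphi:\mathcal Q\to\mathbb N$ (constant on each $Y_i$, with $f^{\varphi(Y_i)}(Y_i)=Y$ bijectively) such that $F:=f^{\varphi}:Y\to Y$ is a Gibbs–Markov map with respect to $\mathcal Q$, preserving a probability measure $\mu$ absolutely continuous w.r.t. Lebesgue, and for some $C>0$ and all $n\ge1$, $$\mu(\varphi>n)\le C\,n^{-1/\alpha}.$$
   Context: $f_{M_1}(x)=x(1+M_1(x)x^\alpha)$ for $x\in[0,1/2]$ and $f_{M_1}(x)=2x-1$ for $x\in(1/2,1]$, where $M_1(x)=C_0\,2^{-\{c_1^{-1}\log x\}}$, $\{\cdot\}$ the fractional part (with $\{x\}=\{-x\}$ for $x<0$), $c_1>0$, and $C_0$ chosen so that $f_{M_1}((1/2)^-)=1$. The map has discontinuities at $s_\ell=e^{-\ell c_1}$, $\ell\ge1$. Gibbs–Markov: $F:Y\to Y$ preserves the probability $\mu_Y$ and has a countable partition $\mathcal Q$ such that $F$ maps each element bijectively onto $Y$ (mod $\mu_Y$) (in particular big images: $\inf_{a\in\mathcal Q}\mu_Y(Fa)>0$), and, letting $\mathcal Q_n$ be the $n$-th refined partition, $p_n=\log\frac{d\mu_Y}{d\mu_Y\circ F^n}$, and $s(y,y')=\min\{m\ge0: F^my,F^my'$ lie in different elements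 of $\mathcal Q\}$, there are $\theta\in(0,1)$ and $C_1>0$ with $e^{p_n(y)}\le C_1\mu_Y(a)$ and $|e^{p_n(y)}-e^{p_n(y')}|\le C_1\mu_Y(a)\theta^{s(F^ny,F^ny')}$ for all $n\ge1$, $a\in\mathcal Q_n$, $y,y'\in a$. *)

theory Defs
  imports "HOL-Probability.Probability"
begin

definition frac_sym :: "real \<Rightarrow> real" where
  "frac_sym x = frac \<bar>x\<bar>"

text \<open>The constant C0, determined by requiring that the left limit of f at 1/2 is 1.
  Since frac is right continuous and |ln x|/c1 decreases to ln 2/c1 as x tends to 1/2
  from the left, this condition reads (1/2)(1 + C0 2^(-frac(ln 2/c1)) 2^(-alpha)) = 1.\<close>
definition C0 :: "real \<Rightarrow> real \<Rightarrow> real" where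
  "C0 \<alpha> c1 = 2 powr \<alpha> * 2 powr (frac_sym (ln (1/2) / c1))"

definition M1 :: "real \<Rightarrow> real \<Rightarrow> real \<Rightarrow> real" where
  "M1 \<alpha> c1 x = C0 \<alpha> c1 * 2 powr (- frac_sym (ln x / c1))"

definition fM1 :: "real \<Rightarrow> real \<Rightarrow> real \<Rightarrow> real" where
  "fM1 \<alpha> c1 x = (if x \<le> 1/2 then x * (1 + M1 \<alpha> c1 x * x powr \<alpha>) else 2 * x - 1)"

definition refined_partition :: "'a set set \<Rightarrow> ('a \<Rightarrow> 'a) \<Rightarrow> nat \<Rightarrow> 'a set set" where
  "refined_partition Q F n =
     {(\<Inter>i\<in>{..<n}. (F ^^ i) -` (as i)) | as. \<forall>i<n. as i \<in> Q}"

definition same_elem :: "'a set set \<Rightarrow> 'a \<Rightarrow> 'a \<Rightarrow> bool" where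
  "same_elem Q y y' \<longleftrightarrow> (\<exists>c\<in>Q. y \<in> c \<and> y' \<in> c)"

text \<open>theta ^ s(y,y'), where s is the separation time; theta^infinity = 0.\<close>
definition theta_sep :: "real \<Rightarrow> 'a set set \<Rightarrow> ('a \<Rightarrow> 'a) \<Rightarrow> 'a \<Rightarrow> 'a \<Rightarrow> real" where
  "theta_sep \<theta> Q F y y' =
     (if \<exists>m. \<not> same_elem Q ((F ^^ m) y) ((F ^^ m) y')
      then \<theta> ^ (LEAST m. \<not> same_elem Q ((F ^^ m) y) ((F ^^ m) y'))
      else 0)"

text \<open>Gibbs--Markov map F on Y = space mu w.r.t. the partition Q.
  p n is p_n = log (d mu / d (mu o F^n)); on a \<in> Q_n this means
  mu(B) = \<integral>_B e^{p_n} d(mu o F^n) = \<integral>_{F^n B} e^{p_n}((F^n|a)^{-1} z) d mu(z).\<close>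
definition gibbs_markov :: "'a measure \<Rightarrow> 'a set set \<Rightarrow> ('a \<Rightarrow> 'a) \<Rightarrow> bool" where
  "gibbs_markov mu Q F \<longleftrightarrow>
     prob_space mu \<and>
     F \<in> measurable mu mu \<and> distr mu mu F = mu \<and>
     countable Q \<and> Q \<subseteq> sets mu \<and> disjoint Q \<and> space mu - \<Union>Q \<in> null_sets mu \<and>
     (\<forall>a\<in>Q. inj_on F a \<and> F ` a \<subseteq> space mu \<and> space mu - F ` a \<in> null_sets mu) \<and>
     (\<exists>\<theta> C1 (p :: nat \<Rightarrow> 'a \<Rightarrow> real). 0 < \<theta> \<and> \<theta> < 1 \<and> 0 < C1 \<and>
        (\<forall>n\<ge>1. \<forall>a\<in>refined_partition Q F n.
           (\<forall>B\<in>sets mu. B \<subseteq> a \<longrightarrow>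
              emeasure mu B =
                (\<integral>\<^sup>+ z. indicator ((F ^^ n) ` B) z *
                         ennreal (exp (p n (inv_into a (F ^^ n) z))) \<partial>mu)) \<and>
           (\<forall>y\<in>a. exp (p n y) \<le> C1 * measure mu a) \<and>
           (\<forall>y\<in>a. \<forall>y'\<in>a. \<bar>exp (p n y) - exp (p n y')\<bar>
                 \<le> C1 * measure mu a * theta_sep \<theta> Q F ((F ^^ n) y) ((F ^^ n) y'))))"

end

theory Submission
  imports Defs "HOL-Complex_Analysis.Great_Picard"
begin

text \<open>
  Every inverse branch \<open>\<psi>\<close> of every iterate extends to \<open>(0, \<infinity>)\<close>, with \<open>\<psi>'\<close> decreasing and
  \<open>x\<^sup>2 \<psi>'(x) / \<psi>(x)\<^sup>2\<close> increasing; both properties survive composition and give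
  \<open>1 \<le> \<psi>'(x) / \<psi>'(y) \<le> (y/x)\<^sup>2\<close> for \<open>x \<le> y\<close>, which is all the distortion control that is needed.

  Since \<open>Y = (1/2, 1]\<close> is itself a domain of a branch, two intervals carried onto \<open>Y\<close> by iterates
  are nested or disjoint, so the first time at which a point lies in such an interval is a return
  time with full branches.

  For the tail, let \<open>\<tau>(n)\<close> be the supremum, over all intervals \<open>J \<subseteq> Y\<close>, of the measure of the points of \<open>J\<close>
  that are in no full return interval inside \<open>J\<close> by time \<open>n\<close>. After one passage through
  \<open>(0, 1/2]\<close> only pieces with incomplete image remain. The two cut at the ends of \<open>J\<close> have inverse slopes
  adding up to at most \<open>9/10\<close>, and those created at the discontinuities contribute little
  because \<open>e\<^sup>-\<^sup>c\<close> with \<open>c = c1\<close> is small. The climb from \<open>x\<close> takes time \<open>O(x\<^sup>-\<^sup>\<alpha>)\<close>, so discarding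
  the points below \<open>const \<sqdot> n\<^sup>-\<^sup>1\<^sup>/\<^sup>\<alpha>\<close> gives
  \<open>\<tau>(n) \<le> const \<sqdot> n\<^sup>-\<^sup>1\<^sup>/\<^sup>\<alpha> + (19/20) \<tau>((1 - 2\<delta>) n)\<close>.

  The invariant density is a limit of Cesaro means of the pushforwards of Lebesgue measure, whose
  densities \<open>h\<close> all have \<open>h\<close> decreasing and \<open>x\<^sup>2 h(x)\<close> increasing.
\<close>

section \<open>The branches of the map\<close>

text \<open>The quantity \<open>x^2 psi'(x) / psi(x)^2\<close> is the derivative of
  \<open>t -> 1 / psi(1/t)\<close> at \<open>t = 1/x\<close>. The two properties thus say that psi
  is concave, both in the coordinate x and as a map of the coordinate 1/x. Increasing concave maps
  compose, which is why long words of branches cost nothing in the constants. The inverse of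
  \<open>x (1 + c x^\<gamma>)\<close> has the second property because \<gamma> \<le> 1. The obstacle
  is that a climb through level l, between \<open>s_(l+1)\<close> and \<open>s_l\<close> (with
  \<open>s_0 = 1/2\<close>), ends in \<open>(s_l, f(s_l)]\<close>, which is Y only for l = 0.
  Estimates must therefore hold for arbitrary intervals, a class stable under cutting, and are
  passed from level l to level l + 1. Each such passage gains a factor of order
  \<open>e^(-c1)\<close>, the relative size of a level inside the one above, whereas summing over
  the fundamental domains of level l costs \<open>s_l^(-\<alpha>) = e^(\<alpha> l c1)\<close>. The
  product is summable in l because \<alpha> < 1 and \<open>c1\<close> is large.\<close>

text \<open>All assumptions on \<open>c1\<close> hold once it is large. The exponent condition gives
  \<gamma> \<le> 1. Of the size conditions, the first makes consecutive discontinuities shrink at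
  least fourfold, the second keeps the correction \<open>u\<close> below 1 on the lower levels, and
  the third makes the level contributions geometric with ratio at most 1/100.\<close>

locale lsv =
  fixes \<alpha> c1 :: real
  assumes \<alpha>_pos: "0 < \<alpha>" and \<alpha>_less1: "\<alpha> < 1"
    and c1_pos: "0 < c1"
    and exponent_le1: "\<alpha> + ln 2 / c1 \<le> 1"
    and c1_large: "8 * exp (- c1) \<le> 1" "2 * exp (- \<alpha> * c1) \<le> 1"
      "24 * exp (- (1 - \<alpha>) * c1) \<le> 1/100"
begin

abbreviation f :: "real \<Rightarrow> real" where "f \<equiv> fM1 \<alpha> c1"

definition \<gamma> :: real where "\<gamma> = \<alpha> + ln 2 / c1"

text \<open>The discontinuities, preceded by the break point 1/2 in place of \<open>exp 0\<close>.
  Level l is the interval from \<open>sg (Suc l)\<close> to \<open>sg l\<close>.\<close>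

definition sg :: "nat \<Rightarrow> real" where
  "sg l = (if l = 0 then 1/2 else exp (- real l * c1))"

text \<open>On level l the integer part of \<open>|ln x| / c1\<close> is l, so
  \<open>2^(-frac)\<close> equals \<open>2^l x^(ln 2 / c1)\<close> and the log-periodic correction
  \<open>M1 x * x^\<alpha>\<close> becomes this pure power, which makes sense on all of the positive
  axis.\<close>

definition u :: "nat \<Rightarrow> real \<Rightarrow> real" where
  "u l x = 2 powr \<gamma> * 2 ^ l * x powr \<gamma>"

text \<open>Index 0 is the right branch; index \<open>Suc l\<close> is the branch on level l,
  extended beyond its domain.\<close>

fun g :: "nat \<Rightarrow> real \<Rightarrow> real" where
  "g 0 x = 2 * x - 1"
| "g (Suc l) x = x * (1 + u l x)"

fun dg :: "nat \<Rightarrow> real \<Rightarrow> real" where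
  "dg 0 x = 2"
| "dg (Suc l) x = 1 + (1 + \<gamma>) * u l x"

fun D :: "nat \<Rightarrow> real set" where
  "D 0 = {1/2<..1}"
| "D (Suc l) = {sg (Suc l)<..sg l}"

lemma frac_le_frac: "0 < b \<Longrightarrow> 0 < d \<Longrightarrow> a * d \<le> c * b \<Longrightarrow> a / b \<le> c / (d::real)"
  by (simp add: field_simps)

lemma \<gamma>_bounds: "\<alpha> < \<gamma>" "0 < \<gamma>" "\<gamma> \<le> 1"
proof -
  have "0 < ln 2 / c1" using c1_pos by simp
  then show "\<alpha> < \<gamma>" "0 < \<gamma>" "\<gamma> \<le> 1" using \<alpha>_pos exponent_le1 unfolding \<gamma>_def by linarith+
qed

lemma ln2_less_c1: "3 * ln 2 \<le> c1"
proof -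
  have "ln (8 * exp (- c1)) \<le> ln 1" using c1_large(1) by (subst ln_le_cancel_iff) auto
  then have "ln 8 \<le> c1" by (simp add: ln_mult)
  moreover have "ln (8::real) = 3 * ln 2" using ln_realpow[of 2 3] by simp
  ultimately show ?thesis by simp
qed

lemma sg_pos: "0 < sg l" by (simp add: sg_def)

lemma sg_ratio: "sg (Suc l) \<le> 2 * exp (- c1) * sg l"
proof (cases l)
  case (Suc m)
  have "exp (- real (Suc (Suc m)) * c1) = exp (- c1) * exp (- real (Suc m) * c1)"
    by (simp add: algebra_simps flip: exp_add)
  then show ?thesis using Suc by (simp add: sg_def)
qed (simp add: sg_def)

lemma sg_Suc_le: "sg (Suc l) \<le> sg l / 4"
proof -
  have "2 * exp (- c1) * sg l \<le> 1/4 * sg l"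
    using c1_large(1) sg_pos[of l] by (intro mult_right_mono) auto
  then show ?thesis using sg_ratio[of l] by simp
qed

lemma sg_Suc_less: "sg (Suc l) < sg l"
  using sg_Suc_le[of l] sg_pos[of l] by simp

lemma sg_antimono: "l \<le> m \<Longrightarrow> sg m \<le> sg l"
  by (rule lift_Suc_antimono_le[of sg, OF less_imp_le[OF sg_Suc_less]])

lemma sg_le_half: "sg l \<le> 1/2"
  using sg_antimono[of 0 l] by (simp add: sg_def)

lemma u_pos: "0 < x \<Longrightarrow> 0 < u l x" by (simp add: u_def)

lemma u_mono: "0 \<le> x \<Longrightarrow> x \<le> y \<Longrightarrow> u l x \<le> u l y"
  using \<gamma>_bounds by (auto simp: u_def intro!: mult_left_mono powr_mono2)

lemma exp_powr_b: "exp (- real l * c1) powr \<gamma> = exp (- real l * c1) powr \<alpha> / 2 ^ l"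
proof -
  have "exp (- real l * c1) powr \<gamma> = exp (- real l * c1 * \<alpha> - real l * ln 2)"
    using c1_pos by (simp add: powr_def \<gamma>_def field_simps)
  also have "\<dots> = exp (- real l * c1) powr \<alpha> / 2 ^ l"
    by (simp add: powr_def exp_diff exp_of_nat_mult ac_simps)
  finally show ?thesis .
qed

text \<open>The jump at a discontinuity is exactly a doubling of the correction;
  \<open>g_overlap\<close> rests on this.\<close>

lemma u_sg: "u (Suc l) (sg (Suc l)) = 2 * u l (sg (Suc l))"
  by (simp add: u_def)

lemma u_sg_eq: "u (Suc l) (sg (Suc l)) = 2 powr \<gamma> * sg (Suc l) powr \<alpha>"
  using exp_powr_b[of "Suc l"] by (simp add: u_def sg_def)

lemma u_half: "u 0 (1/2) = 1"
  by (simp add: u_def powr_mult powr_minus powr_divide)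

text \<open>The maximum is at \<open>sg l\<close>. It is 1 for l = 0; for larger l the power of 2
  cancels and leaves \<open>2^\<gamma> (sg l)^\<alpha>\<close>, at most
  \<open>2 exp (- \<alpha> c1)\<close>.\<close>

lemma u_le1: assumes "0 \<le> x" "x \<le> sg l" shows "u l x \<le> 1"
proof (cases l)
  case 0
  then show ?thesis using u_mono[OF assms, of 0] u_half by (simp add: sg_def)
next
  case (Suc k)
  have "2 powr \<gamma> \<le> (2::real)" using \<gamma>_bounds powr_mono[of \<gamma> 1 2] by simp
  moreover have "sg l powr \<alpha> \<le> exp (- \<alpha> * c1)"
    using Suc \<alpha>_pos c1_pos by (simp add: sg_def powr_def algebra_simps)
  ultimately have "u l (sg l) \<le> 2 * exp (- \<alpha> * c1)"
    unfolding Suc u_sg_eq by (intro mult_mono) auto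
  then show ?thesis using u_mono[OF assms, of l] c1_large by linarith
qed

text \<open>Above \<open>sg (Suc l)\<close> the periodic factor \<open>2^l x^(ln 2 / c1)\<close> is
  at least 1/2. This sets the minimal speed of the climb.\<close>

lemma u_lower: assumes "sg (Suc l) \<le> x" shows "x powr \<alpha> / 2 \<le> u l x"
proof -
  have x0: "0 < x" using assms sg_pos[of "Suc l"] by linarith
  define b where "b = ln 2 / c1"
  have b: "0 \<le> b" using c1_pos by (simp add: b_def)
  have "sg (Suc l) powr b = 1 / 2 ^ Suc l"
  proof -
    have "sg (Suc l) powr b = exp (- (real (Suc l) * ln 2))"
      using c1_pos by (simp add: sg_def powr_def b_def algebra_simps)
    then show ?thesis by (simp only: exp_minus exp_of_nat_mult) (simp add: field_simps)
  qed
  moreover have "sg (Suc l) powr b \<le> x powr b"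
    using assms sg_pos[of "Suc l"] b by (intro powr_mono2) auto
  ultimately have "1 / 2 ^ Suc l \<le> x powr b" by simp
  then have "2 ^ l * (1 / 2 ^ Suc l) \<le> 2 ^ l * x powr b" by (intro mult_left_mono) auto
  then have "1/2 \<le> 2 ^ l * x powr b" by simp
  moreover have "1 \<le> 2 powr \<gamma>" using \<gamma>_bounds by (simp add: ge_one_powr_ge_zero)
  ultimately have "1 * (1/2) \<le> 2 powr \<gamma> * (2 ^ l * x powr b)" by (intro mult_mono) auto
  then have "1 * (1/2) * x powr \<alpha> \<le> 2 powr \<gamma> * (2 ^ l * x powr b) * x powr \<alpha>"
    by (intro mult_right_mono) auto
  then show ?thesis using x0 by (simp add: u_def \<gamma>_def b_def powr_add ac_simps)
qed

lemma g_gt: "0 < x \<Longrightarrow> x < g (Suc l) x"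
  using u_pos[of x l] by simp

lemma g_le2: "0 < x \<Longrightarrow> x \<le> sg l \<Longrightarrow> g (Suc l) x \<le> 2 * x"
  using u_le1[of x l] by (simp add: algebra_simps)

lemma g_half: "g (Suc 0) (1/2) = 1" by (simp add: u_half)

lemma dg_pos: "0 < x \<Longrightarrow> 1 \<le> dg k x"
  using u_pos \<gamma>_bounds by (cases k) (auto intro!: mult_nonneg_nonneg less_imp_le)

lemma g_deriv: assumes "0 < x" shows "(g k has_real_derivative dg k x) (at x)"
proof (cases k)
  case 0
  have "((\<lambda>x. 2 * x - 1) has_real_derivative 2) (at x)" by (auto intro!: derivative_eq_intros)
  moreover have "g 0 = (\<lambda>x. 2 * x - 1)" by auto
  ultimately show ?thesis using 0 by simp
next
  case (Suc l)
  have "((\<lambda>x. x * (1 + u l x)) has_real_derivative dg k x) (at x)"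
    unfolding u_def Suc
    using assms by (auto intro!: derivative_eq_intros simp: u_def powr_diff algebra_simps)
  moreover have "g k = (\<lambda>x. x * (1 + u l x))" using Suc by auto
  ultimately show ?thesis by simp
qed

lemma g_strict_mono: "0 < x \<Longrightarrow> x < y \<Longrightarrow> g k x < g k y"
proof (cases k)
  case (Suc l)
  assume xy: "0 < x" "x < y"
  then have "x * (1 + u l x) < y * (1 + u l y)"
    using u_mono[of x y l] u_pos[of x l] by (intro mult_less_le_imp_less) auto
  then show ?thesis using Suc by simp
qed simp

section \<open>The extended inverse branches and their derivatives\<close>

definition chi :: "nat \<Rightarrow> real \<Rightarrow> real" where
  "chi k y = (THE x. 0 < x \<and> g k x = y)"

lemma g_surj: assumes "0 < y" shows "\<exists>x>0. g k x = y"
proof (cases k)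
  case 0 then show ?thesis using assms by (intro exI[of _ "(y+1)/2"]) (auto simp: field_simps)
next
  case (Suc l)
  define e where "e = min (y/2) (sg l)"
  have e: "0 < e" "e \<le> y/2" "e \<le> sg l" using assms sg_pos by (auto simp: e_def)
  have "g k e \<le> 2 * e" using g_le2[OF e(1,3)] Suc by simp
  then have "g k e \<le> y" using e by linarith
  moreover have "y \<le> g k y" using g_gt[OF assms, of l] Suc by simp
  moreover have "continuous_on {e..y} (g k)"
    using e by (intro continuous_at_imp_continuous_on ballI DERIV_isCont[OF g_deriv]) auto
  ultimately obtain x where "e \<le> x" "x \<le> y" "g k x = y"
    using IVT'[of "g k" e y y] e assms by auto
  then show ?thesis using e by (intro exI[of _ x]) auto
qed

lemma chi_unique: "0 < x \<Longrightarrow> chi k (g k x) = x"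
  unfolding chi_def
proof (rule the_equality)
  fix y assume "0 < x" "0 < y \<and> g k y = g k x"
  then show "y = x"
    using g_strict_mono[of x y k] g_strict_mono[of y x k] by (cases x y rule: linorder_cases) auto
qed auto

lemma chi: assumes "0 < y" shows "0 < chi k y" "g k (chi k y) = y"
  using g_surj[OF assms, of k] chi_unique by auto

lemma chi_strict_mono: assumes "0 < x" "x < y" shows "chi k x < chi k y"
proof (rule ccontr)
  assume "\<not> chi k x < chi k y"
  then have "chi k y \<le> chi k x" by simp
  then have "g k (chi k y) \<le> g k (chi k x)"
    using chi[of y k] assms g_strict_mono[of "chi k y" "chi k x" k] by (cases "chi k y = chi k x") auto
  then show False using chi assms by auto
qed

lemma chi_0: "0 < x \<Longrightarrow> chi 0 x = (x + 1) / 2"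
  using chi[of x 0] by simp

lemma chi_Suc_less: "0 < x \<Longrightarrow> chi (Suc l) x < x"
  using g_gt[of "chi (Suc l) x" l] chi[of x "Suc l"] by (simp del: g.simps)

lemma chi_isCont: assumes "0 < y" shows "isCont (chi k) y"
proof -
  define x where "x = chi k y"
  have x: "0 < x" "g k x = y" using chi[OF assms, of k] by (auto simp: x_def)
  have near: "0 < z" if "\<bar>z - x\<bar> \<le> x/2" for z using x that by linarith
  have "isCont (chi k) (g k x)"
    by (rule isCont_inverse_function[where d = "x/2"])
      (use x(1) near in \<open>blast intro: chi_unique DERIV_isCont[OF g_deriv] half_gt_zero\<close>)+
  then show ?thesis using x by simp
qed

definition dchi :: "nat \<Rightarrow> real \<Rightarrow> real" where "dchi k x = 1 / dg k (chi k x)"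

lemma chi_deriv: assumes "0 < x" shows "(chi k has_real_derivative dchi k x) (at x)"
proof -
  have "(chi k has_real_derivative inverse (dg k (chi k x))) (at x)"
    using assms chi chi_isCont dg_pos[of "chi k x" k]
    by (intro DERIV_inverse_function[where f = "g k" and a = 0 and b = "x + 1"] g_deriv) (auto)
  then show ?thesis by (simp add: dchi_def inverse_eq_divide)
qed

lemma dchi_pos: "0 < x \<Longrightarrow> 0 < dchi k x" "0 < x \<Longrightarrow> dchi k x \<le> 1"
  using dg_pos[of "chi k x" k] chi[of x k] by (auto simp: dchi_def)

lemma dg_mono: "0 < x \<Longrightarrow> x \<le> y \<Longrightarrow> dg k x \<le> dg k y"
  using \<gamma>_bounds by (cases k) (auto intro!: mult_left_mono u_mono)

lemma chi_mono: "0 < x \<Longrightarrow> x \<le> y \<Longrightarrow> chi k x \<le> chi k y"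
  using chi_strict_mono[of x y k] by (cases "x = y") auto

lemma dchi_antimono: "0 < x \<Longrightarrow> x \<le> y \<Longrightarrow> dchi k y \<le> dchi k x"
  unfolding dchi_def
  using dg_mono[of "chi k x" "chi k y" k] chi_mono[of x y k] chi(1)[of x k] dg_pos[of "chi k x" k]
  by (intro divide_left_mono mult_pos_pos) auto

text \<open>With \<open>x = g z\<close> the quotient is \<open>g(z)\<^sup>2 / (z\<^sup>2 g'(z))\<close>, which for \<open>g z = z (1 + u)\<close> equals
  \<open>(1 + u)\<^sup>2 / (1 + (1 + \<gamma>) u)\<close>; this increases with \<open>u\<close> because \<open>\<gamma> \<le> 1\<close>.\<close>
lemma dchi_quot_mono:
  assumes "0 < x" "x \<le> y"
  shows "x\<^sup>2 * dchi k x / (chi k x)\<^sup>2 \<le> y\<^sup>2 * dchi k y / (chi k y)\<^sup>2"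
proof -
  define z w where "z = chi k x" and "w = chi k y"
  have z: "0 < z" "g k z = x" and w: "g k w = y" "z \<le> w"
    using chi[of x k] chi[of y k] chi_mono[OF assms] assms by (auto simp: z_def w_def)
  have "(g k z)\<^sup>2 / (z\<^sup>2 * dg k z) \<le> (g k w)\<^sup>2 / (w\<^sup>2 * dg k w)"
  proof (cases k)
    case 0
    have "1 / w \<le> 1 / z" using z(1) w(2) by (intro divide_left_mono) auto
    then have "g k z / z \<le> g k w / w" using z(1) w(2) 0 by (simp add: diff_divide_distrib)
    moreover have "0 \<le> g k z / z" using z assms by simp
    ultimately have "(g k z / z)\<^sup>2 \<le> (g k w / w)\<^sup>2" by (rule power_mono)
    then show ?thesis using 0 by (simp add: power_divide)
  next
    case (Suc l)
    define a b where "a = u l z" and "b = u l w"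
    have ab: "0 < a" "a \<le> b" using u_pos[of z l] u_mono[of z w l] z w by (auto simp: a_def b_def)
    have "(1 + a)\<^sup>2 * (1 + (1 + \<gamma>) * b) \<le> (1 + b)\<^sup>2 * (1 + (1 + \<gamma>) * a)"
    proof -
      have "(1 + b)\<^sup>2 * (1 + (1 + \<gamma>) * a) - (1 + a)\<^sup>2 * (1 + (1 + \<gamma>) * b)
          = (b - a) * ((1 - \<gamma>) + b + a + (1 + \<gamma>) * (a * b))"
        by (simp add: power2_eq_square algebra_simps)
      moreover have "0 \<le> (b - a) * ((1 - \<gamma>) + b + a + (1 + \<gamma>) * (a * b))"
        using ab \<gamma>_bounds by (intro mult_nonneg_nonneg add_nonneg_nonneg) auto
      ultimately show ?thesis by linarith
    qed
    then have "(1 + a)\<^sup>2 / (1 + (1 + \<gamma>) * a) \<le> (1 + b)\<^sup>2 / (1 + (1 + \<gamma>) * b)"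
      using ab \<gamma>_bounds(2) by (intro frac_le_frac) (auto intro: add_pos_pos)
    moreover have "(g k z)\<^sup>2 / (z\<^sup>2 * dg k z) = (1 + a)\<^sup>2 / (1 + (1 + \<gamma>) * a)"
      "(g k w)\<^sup>2 / (w\<^sup>2 * dg k w) = (1 + b)\<^sup>2 / (1 + (1 + \<gamma>) * b)"
      using z(1) w(2) by (simp_all add: Suc a_def b_def power_mult_distrib)
    ultimately show ?thesis by simp
  qed
  then show ?thesis using z w by (simp add: dchi_def flip: z_def w_def) (simp add: ac_simps)
qed

section \<open>Identification of the map with its branches\<close>

lemma f_Y: "1/2 < x \<Longrightarrow> f x = 2 * x - 1" by (simp add: fM1_def)

lemma f_level: assumes "x \<in> D (Suc l)" shows "f x = g (Suc l) x"
proof -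
  have x: "sg (Suc l) < x" "x \<le> sg l" "0 < x" "x \<le> 1/2"
    using assms sg_pos[of "Suc l"] sg_le_half[of l] by auto
  \<comment> \<open>Since \<open>c1\<close> exceeds ln 2, the number \<open>ln 2 / c1\<close> is its
    own fractional part, so the constant \<open>C0\<close> equals \<open>2^\<gamma>\<close>.\<close>
  have "0 < ln (2::real)" by simp
  then have "ln 2 < c1" using ln2_less_c1 by linarith
  then have l2: "ln 2 / c1 < 1" using c1_pos by (simp add: field_simps)
  have fr: "frac (ln 2 / c1) = ln 2 / c1" using l2 c1_pos by (subst frac_eq) auto
  have lnx: "ln x < 0" using x by simp
  define t where "t = - ln x / c1"
  have t1: "t < real (Suc l)"
  proof -
    have "ln (sg (Suc l)) < ln x" using x sg_pos by (subst ln_less_cancel_iff) auto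
    then show ?thesis using c1_pos by (simp add: t_def sg_def field_simps)
  qed
  have t2: "real l \<le> t"
  proof (cases "l = 0")
    case True then show ?thesis using lnx c1_pos by (simp add: t_def field_simps)
  next
    case False
    have "ln x \<le> ln (sg l)" using x sg_pos by (subst ln_le_cancel_iff) auto
    then show ?thesis using c1_pos False by (simp add: t_def sg_def field_simps)
  qed
  have abs: "\<bar>ln x / c1\<bar> = t" using lnx c1_pos by (simp add: t_def abs_if field_simps)
  have "\<lfloor>t\<rfloor> = int l" using t1 t2 by (intro floor_unique) auto
  then have "frac_sym (ln x / c1) = t - real l" unfolding frac_sym_def abs frac_def by simp
  moreover have "frac_sym (ln (1/2) / c1) = ln 2 / c1"
    using c1_pos fr by (simp add: frac_sym_def ln_div abs_if)
  ultimately have "M1 \<alpha> c1 x = 2 powr \<gamma> * (2 powr (real l) * 2 powr (- t))"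
    by (simp only: M1_def C0_def \<gamma>_def powr_add[symmetric]) (simp add: algebra_simps)
  also have "2 powr (- t) = x powr (ln 2 / c1)"
    using x by (simp add: powr_def t_def)
  finally have "M1 \<alpha> c1 x * x powr \<alpha> = u l x"
    using x by (simp add: u_def \<gamma>_def powr_add powr_realpow ac_simps)
  then show ?thesis using x by (simp add: fM1_def)
qed

lemma f_branch: "x \<in> D k \<Longrightarrow> f x = g k x"
  using f_level f_Y by (cases k) auto

lemma D_disjoint: assumes "x \<in> D k" "x \<in> D j" shows "k = j"
proof -
  have 1: False if "x \<in> D (Suc a)" "x \<in> D (Suc b)" "a < b" for a b
  proof -
    have "x \<le> sg b" "sg (Suc a) < x" using that by simp_all
    then show False using sg_antimono[of "Suc a" b] that(3) by linarith
  qed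
  have 2: False if "x \<in> D (Suc a)" "x \<in> D 0" for a
  proof -
    have "x \<le> sg a" "1/2 < x" using that by simp_all
    then show False using sg_le_half[of a] by linarith
  qed
  show ?thesis
  proof (cases k; cases j)
    fix a b assume k: "k = Suc a" "j = Suc b"
    have x: "x \<in> D (Suc a)" "x \<in> D (Suc b)" using assms k by simp_all
    have "\<not> a < b" using 1[OF x] by blast
    moreover have "\<not> b < a" using 1[OF x(2,1)] by blast
    ultimately have "a = b" by simp
    then show ?thesis using k by simp
  next
    fix a assume k: "k = 0" "j = Suc a"
    then have "x \<in> D (Suc a)" "x \<in> D 0" using assms by simp_all
    from 2[OF this] show ?thesis ..
  next
    fix a assume k: "k = Suc a" "j = 0"
    then have "x \<in> D (Suc a)" "x \<in> D 0" using assms by simp_all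
    from 2[OF this] show ?thesis ..
  qed simp
qed

section \<open>Compositions of inverse branches\<close>

text \<open>A word lists branches in the order in which the map applies them: its head is used
  first, hence is the outermost inverse.\<close>

primrec psi :: "nat list \<Rightarrow> real \<Rightarrow> real" where
  "psi [] x = x"
| "psi (k # w) x = chi k (psi w x)"

primrec dpsi :: "nat list \<Rightarrow> real \<Rightarrow> real" where
  "dpsi [] x = 1"
| "dpsi (k # w) x = dchi k (psi w x) * dpsi w x"

lemma psi_pos: "0 < x \<Longrightarrow> 0 < psi w x"
  by (induction w) (auto intro: chi)

lemma psi_append: "psi (v @ w) x = psi v (psi w x)"
  by (induction v) auto

lemma dpsi_append: "dpsi (v @ w) x = dpsi v (psi w x) * dpsi w x"
  by (induction v) (auto simp: psi_append)

lemma psi_deriv: "0 < x \<Longrightarrow> (psi w has_real_derivative dpsi w x) (at x)"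
proof (induction w)
  case (Cons k w)
  have "(chi k \<circ> psi w has_real_derivative dchi k (psi w x) * dpsi w x) (at x)"
    using Cons by (intro DERIV_chain chi_deriv psi_pos) auto
  then show ?case by (simp add: o_def)
next
  case Nil
  have "psi [] = (\<lambda>x. x)" by auto
  then show ?case by simp
qed

lemma dpsi_pos: "0 < x \<Longrightarrow> 0 < dpsi w x"
  by (induction w) (auto intro!: mult_pos_pos dchi_pos psi_pos)

lemma dpsi_le1: "0 < x \<Longrightarrow> dpsi w x \<le> 1"
proof (induction w)
  case (Cons k w)
  then have "dchi k (psi w x) * dpsi w x \<le> 1 * 1"
    using dpsi_pos[of x w] by (intro mult_mono dchi_pos psi_pos) auto
  then show ?case by simp
qed simp

lemma psi_strict_mono: "0 < x \<Longrightarrow> x < y \<Longrightarrow> psi w x < psi w y"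
  by (induction w) (auto intro!: chi_strict_mono psi_pos)

lemma psi_mono: "0 < x \<Longrightarrow> x \<le> y \<Longrightarrow> psi w x \<le> psi w y"
  using psi_strict_mono[of x y w] by (cases "x = y") auto

lemma psi_inj: "0 < x \<Longrightarrow> 0 < y \<Longrightarrow> psi w x = psi w y \<Longrightarrow> x = y"
  using psi_strict_mono[of x y w] psi_strict_mono[of y x w] by (cases x y rule: linorder_cases) auto

lemma dpsi_antimono: assumes "0 < x" "x \<le> y" shows "dpsi w y \<le> dpsi w x"
proof (induction w)
  case (Cons k w)
  then have "dchi k (psi w y) * dpsi w y \<le> dchi k (psi w x) * dpsi w x"
    using assms by (intro mult_mono dchi_antimono psi_mono psi_pos less_imp_le[OF dchi_pos(1)] less_imp_le[OF dpsi_pos]) auto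
  then show ?case by simp
qed simp

text \<open>The quotient is multiplicative along compositions, since the square of the inner value
  cancels; so it is a product of nonnegative increasing factors.\<close>

lemma dpsi_quot_mono:
  assumes "0 < x" "x \<le> y"
  shows "x\<^sup>2 * dpsi w x / (psi w x)\<^sup>2 \<le> y\<^sup>2 * dpsi w y / (psi w y)\<^sup>2"
proof (induction w)
  case Nil
  then show ?case using assms by simp
next
  case (Cons k w)
  have pos: "0 < psi w x" "0 < psi w y" "psi w x \<le> psi w y"
    using assms psi_pos psi_mono by auto
  have "(psi w x)\<^sup>2 * dchi k (psi w x) / (chi k (psi w x))\<^sup>2 * (x\<^sup>2 * dpsi w x / (psi w x)\<^sup>2)
     \<le> (psi w y)\<^sup>2 * dchi k (psi w y) / (chi k (psi w y))\<^sup>2 * (y\<^sup>2 * dpsi w y / (psi w y)\<^sup>2)"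
    using assms pos dpsi_pos[of x w] dchi_pos(1)[of "psi w y" k]
    by (intro mult_mono Cons dchi_quot_mono) (auto intro!: divide_nonneg_nonneg mult_nonneg_nonneg)
  then show ?case using pos by simp (simp add: ac_simps)
qed

lemma isCont_dg: "0 < x \<Longrightarrow> isCont (dg k) x"
proof (cases k)
  case (Suc l)
  assume "0 < x"
  moreover have "dg (Suc l) = (\<lambda>x. 1 + (1 + \<gamma>) * (2 powr \<gamma> * 2 ^ l * x powr \<gamma>))"
    by (auto simp: u_def)
  ultimately show ?thesis unfolding Suc by (auto intro!: continuous_intros)
next
  case 0
  have "dg 0 = (\<lambda>_. 2)" by auto
  then show ?thesis using 0 by simp
qed

lemma isCont_dpsi: "0 < x \<Longrightarrow> isCont (dpsi w) x"
proof (induction w)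
  case Nil
  have "dpsi [] = (\<lambda>_. 1)" by auto
  then show ?case by simp
next
  case (Cons k w)
  note pos = psi_pos[OF Cons.prems, of w]
  have eq: "dpsi (k # w) = (\<lambda>x. 1 / dg k (chi k (psi w x)) * dpsi w x)"
    by (auto simp: dchi_def)
  have "isCont (\<lambda>x. chi k (psi w x)) x"
    using Cons.prems by (intro isCont_o2[OF DERIV_isCont[OF psi_deriv]] chi_isCont pos) auto
  then have "isCont (\<lambda>x. dg k (chi k (psi w x))) x"
    by (rule isCont_o2) (intro isCont_dg chi pos)
  then show ?case unfolding eq
    using Cons dg_pos[OF chi(1)[OF pos], of k k] by (intro continuous_intros) auto
qed

text \<open>\<open>psi\<close> is built from extended branches. This predicate says that every
  intermediate point lies in the true domain of its branch, which is what makes \<open>psi w\<close>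
  an inverse of an iterate of \<open>f\<close>.\<close>

primrec fol :: "nat list \<Rightarrow> real \<Rightarrow> bool" where
  "fol [] x = True"
| "fol (k # w) x = (fol w x \<and> chi k (psi w x) \<in> D k)"

lemma fol_append: "fol (v @ w) x \<longleftrightarrow> fol w x \<and> fol v (psi w x)"
  by (induction v) (auto simp: psi_append)

lemma f_chi: assumes "0 < x" "chi k x \<in> D k" shows "f (chi k x) = x"
  using f_branch[OF assms(2)] chi[OF assms(1)] by simp

lemma f_psi_Cons: "0 < x \<Longrightarrow> fol (k # w) x \<Longrightarrow> f (psi (k # w) x) = psi w x"
  using f_chi[of "psi w x" k] psi_pos by simp

lemma fol_funpow: "0 < x \<Longrightarrow> fol w x \<Longrightarrow> (f ^^ length w) (psi w x) = x"
proof (induction w)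
  case (Cons k w)
  then have "f (psi (k # w) x) = psi w x" by (intro f_psi_Cons) auto
  then show ?case using Cons by (simp add: funpow_swap1)
qed simp

text \<open>The branch domains are disjoint, so a point determines the first letter of its
  itinerary; applying the map once gives the induction.\<close>

lemma fol_unique:
  assumes "length v = length w" "0 < x" "0 < y" "fol v x" "fol w y" "psi v x = psi w y"
  shows "v = w \<and> x = y"
  using assms
proof (induction v w rule: list_induct2)
  case (Cons k v j w)
  have "k = j" using Cons.prems D_disjoint[of "psi (k # v) x" k j] by simp
  moreover have "psi v x = psi w y"
    using Cons.prems f_psi_Cons[of x k v] f_psi_Cons[of y j w] by simp
  ultimately show ?case using Cons by simp
qed simp

lemma psi_image: assumes "0 < a" "a \<le> b" shows "psi w ` {a<..b} = {psi w a<..psi w b}"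
proof (intro equalityI subsetI)
  fix y assume "y \<in> psi w ` {a<..b}"
  then show "y \<in> {psi w a<..psi w b}"
    using assms psi_strict_mono[of a _ w] psi_mono[of _ b w] by auto
next
  fix y assume y: "y \<in> {psi w a<..psi w b}"
  have "continuous_on {a..b} (psi w)"
    using assms by (intro continuous_at_imp_continuous_on ballI DERIV_isCont[OF psi_deriv]) auto
  then obtain x where x: "a \<le> x" "x \<le> b" "psi w x = y"
    using IVT'[of "psi w" a y b] y assms by auto
  then have "x \<noteq> a" using y by auto
  then show "y \<in> psi w ` {a<..b}" using x by (intro image_eqI[of _ _ x]) auto
qed

section \<open>Cylinders with full image and the uncovered part of an interval\<close>

abbreviation Y :: "real set" where "Y \<equiv> {1/2<..1}"

definition adm :: "nat list \<Rightarrow> bool" where "adm w \<longleftrightarrow> (\<forall>x\<in>Y. fol w x)"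

definition cyl :: "nat list \<Rightarrow> real set" where "cyl w = psi w ` Y"

lemma cyl_eq: "cyl w = {psi w (1/2)<..psi w 1}"
  unfolding cyl_def by (rule psi_image) simp_all

lemma cyl_Nil: "cyl [] = Y" by (simp add: cyl_def)

lemma cyl_borel [measurable]: "cyl w \<in> sets borel" by (simp add: cyl_eq)

lemma cyl_append: "cyl (v @ w) = psi v ` cyl w"
  by (auto simp: cyl_def psi_append image_image)

text \<open>The lower bound i on the word length has two uses: i = 0 admits the empty word, so that
  \<open>Y\<close> itself counts as covered, while i = 1 demands a genuine return.\<close>

definition bad :: "nat \<Rightarrow> real \<Rightarrow> real \<Rightarrow> nat \<Rightarrow> real set" where
  "bad i a b n = {a<..b} - \<Union>(cyl ` {w. i \<le> length w \<and> length w \<le> n \<and> adm w \<and> cyl w \<subseteq> {a<..b}})"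

definition T :: "nat \<Rightarrow> real \<Rightarrow> real \<Rightarrow> nat \<Rightarrow> real" where
  "T i a b n = measure lborel (bad i a b n)"

lemma bad_borel [measurable]: "bad i a b n \<in> sets borel"
  unfolding bad_def by (intro sets.Diff sets.countable_UN') (auto intro: countable_subset)

lemma bad_subset: "bad i a b n \<subseteq> {a<..b}" by (auto simp: bad_def)

lemma bad_fm: "bad i a b n \<in> fmeasurable lborel"
  by (rule fmeasurableI2[of "{a..b}"]) (use bad_subset[of i a b n] in \<open>auto simp: fmeasurable_def emeasure_lborel_Icc_eq\<close>)

lemma T_nonneg: "0 \<le> T i a b n" by (simp add: T_def)

lemma T_le: "a \<le> b \<Longrightarrow> T i a b n \<le> b - a"
  using measure_mono_fmeasurable[OF bad_subset[of i a b n], of lborel]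
  by (simp add: T_def fmeasurable_def)

lemma T_empty: "b \<le> a \<Longrightarrow> T i a b n = 0"
  by (simp add: T_def bad_def)

text \<open>A cylinder inside one of the two parts lies inside the whole; cylinders across the cut
  are given up on the right-hand side only.\<close>

lemma T_split: assumes "a \<le> b" "b \<le> c" shows "T i a c n \<le> T i a b n + T i b c n"
proof -
  have "bad i a c n \<subseteq> bad i a b n \<union> bad i b c n"
  proof
    fix x assume x: "x \<in> bad i a c n"
    have "x \<notin> cyl w" if "i \<le> length w" "length w \<le> n" "adm w" "cyl w \<subseteq> {a<..b} \<or> cyl w \<subseteq> {b<..c}" for w
    proof -
      have "{a<..b} \<subseteq> {a<..c}" "{b<..c} \<subseteq> {a<..c}" using assms by auto
      then have "cyl w \<subseteq> {a<..c}" using that(4) by blast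
      then show ?thesis using x that(1-3) by (simp add: bad_def)
    qed
    moreover have "x \<in> {a<..b} \<union> {b<..c}" using x assms by (auto simp: bad_def)
    ultimately show "x \<in> bad i a b n \<union> bad i b c n" unfolding bad_def by blast
  qed
  then have "T i a c n \<le> measure lborel (bad i a b n \<union> bad i b c n)"
    unfolding T_def by (intro measure_mono_fmeasurable fmeasurable.Un bad_fm) auto
  also have "\<dots> \<le> T i a b n + T i b c n"
    unfolding T_def by (intro measure_Un_le) auto
  finally show ?thesis .
qed

lemma T_antimono: assumes "m \<le> n" "j \<le> i" shows "T j a b n \<le> T i a b m"
proof -
  have "{w. i \<le> length w \<and> length w \<le> m \<and> adm w \<and> cyl w \<subseteq> {a<..b}}
      \<subseteq> {w. j \<le> length w \<and> length w \<le> n \<and> adm w \<and> cyl w \<subseteq> {a<..b}}"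
    using assms le_trans by fast
  then have "bad j a b n \<subseteq> bad i a b m" unfolding bad_def by blast
  then show ?thesis
    unfolding T_def by (intro measure_mono_fmeasurable bad_fm) auto
qed

lemma T_Y: "T 0 (1/2) 1 n = 0"
proof -
  have "bad 0 (1/2) 1 n = {}"
    unfolding bad_def by (auto intro!: exI[of _ "[]"] simp: cyl_Nil adm_def)
  then show ?thesis by (simp add: T_def)
qed

lemma nn_integral_psi:
  assumes "0 < a" "a \<le> b" and [measurable]: "h \<in> borel_measurable borel"
  shows "(\<integral>\<^sup>+x. h x * indicator {psi w a<..psi w b} x \<partial>lborel)
     = (\<integral>\<^sup>+x. h (psi w x) * ennreal (dpsi w x) * indicator {a<..b} x \<partial>lborel)"
proof (cases "a = b")
  case False
  have "(\<integral>\<^sup>+x. h x * indicator {psi w a<..psi w b} x \<partial>lborel)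
      = (\<integral>\<^sup>+x. h x * indicator {psi w a..psi w b} x \<partial>lborel)"
    using AE_lborel_singleton[of "psi w a"]
    by (intro nn_integral_cong_AE, eventually_elim) (auto split: split_indicator)
  also have "\<dots> = (\<integral>\<^sup>+x. h (psi w x) * ennreal (dpsi w x) * indicator {a..b} x \<partial>lborel)"
    using assms False
    by (intro nn_integral_substitution_aux psi_deriv continuous_at_imp_continuous_on ballI isCont_dpsi
        less_imp_le[OF dpsi_pos]) auto
  also have "\<dots> = (\<integral>\<^sup>+x. h (psi w x) * ennreal (dpsi w x) * indicator {a<..b} x \<partial>lborel)"
    using AE_lborel_singleton[of a]
    by (intro nn_integral_cong_AE, eventually_elim) (auto split: split_indicator)
  finally show ?thesis .
qed simp

text \<open>Prefixing \<open>v\<close> turns a cylinder inside the interval into one inside its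
  image, so uncovered points pull back to uncovered points. The density \<open>dpsi v\<close> is
  decreasing, hence bounded by its value at the left end. The index drops to 0 because
  \<open>v\<close> alone already has the required length.\<close>

lemma T_pull:
  assumes "0 < a" "a \<le> b" and fol: "\<And>x. x \<in> {a<..b} \<Longrightarrow> fol v x"
    and n: "length v + m \<le> n" and i: "i \<le> length v" and L: "dpsi v a \<le> L"
  shows "T i (psi v a) (psi v b) n \<le> L * T 0 a b m"
proof -
  let ?B = "bad i (psi v a) (psi v b) n"
  have pull: "x \<in> bad 0 a b m" if x: "x \<in> {a<..b}" "psi v x \<in> ?B" for x
  proof (rule ccontr)
    assume "x \<notin> bad 0 a b m"
    then obtain w where w: "length w \<le> m" "adm w" "x \<in> cyl w" "cyl w \<subseteq> {a<..b}"
      using x by (auto simp: bad_def)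
    have "adm (v @ w)"
      unfolding adm_def fol_append using w fol by (auto simp: adm_def cyl_def)
    moreover have "cyl (v @ w) \<subseteq> {psi v a<..psi v b}"
      unfolding cyl_append psi_image[OF assms(1,2), symmetric] using w(4) by (rule image_mono)
    moreover have "psi v x \<in> cyl (v @ w)" using w(3) by (simp add: cyl_append)
    ultimately show False using x(2) w(1) n i by (auto simp: bad_def)
  qed
  have fin: "emeasure lborel (bad 0 a b m) = ennreal (T 0 a b m)"
    unfolding T_def by (intro emeasure_eq_ennreal_measure) (use bad_fm[of 0 a b m] in \<open>auto simp: fmeasurable_def\<close>)
  have L0: "0 \<le> L" using L dpsi_pos[OF assms(1), of v] by linarith
  have "emeasure lborel ?B = (\<integral>\<^sup>+x. indicator ?B x \<partial>lborel)" by simp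
  also have "\<dots> = (\<integral>\<^sup>+x. indicator ?B x * indicator {psi v a<..psi v b} x \<partial>lborel)"
    using bad_subset[of i "psi v a" "psi v b" n]
    by (intro nn_integral_cong) (auto split: split_indicator)
  also have "\<dots> = (\<integral>\<^sup>+x. indicator ?B (psi v x) * ennreal (dpsi v x) * indicator {a<..b} x \<partial>lborel)"
    using assms by (intro nn_integral_psi) auto
  also have "\<dots> \<le> (\<integral>\<^sup>+x. ennreal L * indicator (bad 0 a b m) x \<partial>lborel)"
  proof (intro nn_integral_mono)
    fix x
    have "dpsi v x \<le> L" if "x \<in> {a<..b}"
      using that dpsi_antimono[of a x v] assms(1) L by simp
    then show "indicator ?B (psi v x) * ennreal (dpsi v x) * indicator {a<..b} x
       \<le> ennreal L * indicator (bad 0 a b m) x"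
      using pull[of x] by (auto split: split_indicator intro!: ennreal_leI)
  qed
  also have "\<dots> = ennreal (L * T 0 a b m)"
    using L0 by (simp add: nn_integral_cmult fin ennreal_mult T_nonneg)
  finally show ?thesis
    using L0 unfolding T_def measure_def[of _ ?B]
    by (intro enn2real_leI) (auto intro: mult_nonneg_nonneg)
qed

section \<open>The tail estimate\<close>

text \<open>The constant is chosen so that each step up loses at least 1: the relative loss is at
  least \<open>\<alpha> s / 4\<close> with \<open>s\<close> at least \<open>x^\<alpha> / 2\<close>,
  that is \<open>\<alpha> x^\<alpha> / 8\<close>.\<close>

definition V :: "real \<Rightarrow> real" where "V x = 8 / \<alpha> * x powr (- \<alpha>)"

lemma V_nonneg: "0 \<le> V x" using \<alpha>_pos by (simp add: V_def)

lemma V_antimono: "0 < x \<Longrightarrow> x \<le> y \<Longrightarrow> V y \<le> V x"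
  using \<alpha>_pos by (auto simp: V_def intro!: divide_right_mono powr_mono2')

text \<open>From \<open>ln (1 + s)\<close> at least \<open>s / 2\<close>, the left side is at most
  \<open>exp (- z)\<close> with \<open>z = \<alpha> s / 2\<close>, and \<open>exp (- z)\<close> is
  at most \<open>1 / (1 + z)\<close>, hence at most \<open>1 - z / 2\<close>.\<close>

lemma powr_one_plus_le:
  assumes "0 \<le> s" "s \<le> 1" shows "(1 + s) powr (- \<alpha>) \<le> 1 - \<alpha> * s / 4"
proof -
  define z where "z = \<alpha> * s / 2"
  have "\<alpha> * s \<le> 1 * 1" using \<alpha>_pos \<alpha>_less1 assms by (intro mult_mono) auto
  then have z: "0 \<le> z" "z \<le> 1" using \<alpha>_pos assms by (auto simp: z_def)
  have "ln (1 / (1 + s)) \<le> 1 / (1 + s) - 1" using assms by (intro ln_le_minus_one) auto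
  also have "\<dots> = - (s / (1 + s))" using assms by (simp add: field_simps)
  finally have "s / (1 + s) \<le> ln (1 + s)" using assms by (simp add: ln_div)
  moreover have "s / 2 \<le> s / (1 + s)" using assms by (intro divide_left_mono) auto
  ultimately have "s / 2 \<le> ln (1 + s)" by linarith
  then have "\<alpha> * (s / 2) \<le> \<alpha> * ln (1 + s)" using \<alpha>_pos by (intro mult_left_mono) auto
  then have "(1 + s) powr (- \<alpha>) \<le> exp (- z)" using assms by (simp add: powr_def z_def)
  also have "\<dots> \<le> 1 / (1 + z)"
    using exp_ge_add_one_self[of z] z by (simp add: exp_minus inverse_eq_divide frac_le)
  also have "\<dots> \<le> 1 - z / 2"
  proof -
    have "0 \<le> z * (1 - z)" using z by simp
    then show ?thesis using z by (simp add: field_simps)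
  qed
  finally show ?thesis by (simp add: z_def)
qed

lemma V_drop:
  assumes "sg (Suc l) \<le> x" "x \<le> sg l" shows "V (g (Suc l) x) \<le> V x - 1"
proof -
  have x: "0 < x" using assms(1) sg_pos[of "Suc l"] by linarith
  define s where "s = u l x"
  have s: "0 < s" "s \<le> 1" "x powr \<alpha> / 2 \<le> s"
    using u_pos[OF x] u_le1[of x l] u_lower[OF assms(1)] assms x by (auto simp: s_def)
  have "V (g (Suc l) x) = V x * (1 + s) powr (- \<alpha>)"
    using x s by (simp add: V_def s_def powr_mult)
  also have "\<dots> \<le> V x * (1 - \<alpha> * s / 4)"
    using s by (intro mult_left_mono powr_one_plus_le V_nonneg) auto
  also have "\<dots> \<le> V x - 1"
  proof -
    have "1 = V x * (\<alpha> * (x powr \<alpha> / 2) / 4)"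
      using x \<alpha>_pos by (simp add: V_def powr_minus field_simps)
    also have "\<dots> \<le> V x * (\<alpha> * s / 4)"
      using s \<alpha>_pos by (intro mult_left_mono divide_right_mono V_nonneg) auto
    finally show ?thesis by (simp add: algebra_simps)
  qed
  finally show ?thesis .
qed

section \<open>Fundamental domains of a level\<close>

abbreviation rep :: "nat \<Rightarrow> nat \<Rightarrow> nat list" where "rep l k \<equiv> replicate k (Suc l)"

text \<open>The backward orbit of the top of level l under the extended branch. Consecutive points
  bound the fundamental domains, and the orbit continues below the level.\<close>

definition v :: "nat \<Rightarrow> nat \<Rightarrow> real" where "v l k = psi (rep l k) (sg l)"

lemma v_0: "v l 0 = sg l" by (simp add: v_def)

lemma v_Suc: "v l (Suc k) = chi (Suc l) (v l k)" by (simp add: v_def)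

lemma v_pos: "0 < v l k" by (simp add: v_def psi_pos sg_pos)

lemma g_v: "g (Suc l) (v l (Suc k)) = v l k"
  unfolding v_Suc by (rule chi(2)[OF v_pos])

lemma v_Suc_less: "v l (Suc k) < v l k"
  unfolding v_Suc by (rule chi_Suc_less[OF v_pos])

lemma v_antimono: "k \<le> j \<Longrightarrow> v l j \<le> v l k"
  by (rule lift_Suc_antimono_le[of "v l", OF less_imp_le[OF v_Suc_less]])

lemma v_le_sg: "v l k \<le> sg l"
  using v_antimono[of 0 k l] by (simp add: v_0)

lemma v_le2: "v l k \<le> 2 * v l (Suc k)"
  using g_le2[OF v_pos v_le_sg, of l "Suc k"] by (simp only: g_v)

lemma v_diff: "v l k - v l (Suc k) = v l (Suc k) * u l (v l (Suc k))"
  using g_v[of l k] by (simp add: algebra_simps)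

lemma v_diff_antimono: assumes "k \<le> j" shows "v l j - v l (Suc j) \<le> v l k - v l (Suc k)"
  unfolding v_diff using assms v_pos u_pos[OF v_pos]
  by (intro mult_mono u_mono v_antimono less_imp_le[OF v_pos] less_imp_le[OF u_pos]) auto

lemma psi_rep_shift: "psi (rep l k) (chi (Suc l) x) = psi (rep l (Suc k)) x"
  using psi_append[of "rep l k" "[Suc l]" x] by (simp add: replicate_append_same)

lemma psi_rep_g: "0 < x \<Longrightarrow> psi (rep l (Suc k)) (g (Suc l) x) = psi (rep l k) x"
  unfolding psi_rep_shift[symmetric] by (simp only: chi_unique)

lemma psi_rep_antimono: "0 < x \<Longrightarrow> k \<le> j \<Longrightarrow> psi (rep l j) x \<le> psi (rep l k) x"
  by (rule lift_Suc_antimono_le[of "\<lambda>k. psi (rep l k) x"])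
    (auto intro: less_imp_le chi_Suc_less psi_pos)

lemma psi_rep_surj: "0 < x \<Longrightarrow> \<exists>y>0. psi (rep l k) y = x"
proof (induction k arbitrary: x)
  case (Suc k)
  have "0 < g (Suc l) x" using g_gt[OF Suc.prems, of l] Suc.prems by linarith
  then obtain y where y: "0 < y" "psi (rep l k) y = g (Suc l) x" using Suc.IH by blast
  then have "psi (rep l (Suc k)) y = x" using chi_unique[OF Suc.prems, of "Suc l"] by simp
  then show ?case using y by blast
qed auto

lemma psi_le_iff: "0 < x \<Longrightarrow> 0 < y \<Longrightarrow> psi w x \<le> psi w y \<longleftrightarrow> x \<le> y"
  using psi_mono[of x y w] psi_strict_mono[of y x w] by (meson not_le)

lemma fol_rep: "(\<And>j. j < k \<Longrightarrow> psi (rep l (Suc j)) x \<in> D (Suc l)) \<Longrightarrow> fol (rep l k) x"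
  by (induction k) (auto simp del: D.simps)

text \<open>The orbit increases, so it stays above \<open>sg (Suc l)\<close> as \<open>a\<close>
  does, and it stays below \<open>sg l\<close> until the last step; hence the same branch is used k
  + 1 times. Each use lowers \<open>V\<close> by at least 1, so the elapsed time is paid for by
  \<open>V\<close>.\<close>

lemma climb:
  assumes "v l (Suc k) \<le> a" "a \<le> b" "b \<le> v l k" "sg (Suc l) \<le> a"
  obtains a' b' where "psi (rep l (Suc k)) a' = a" "psi (rep l (Suc k)) b' = b"
    "sg l \<le> a'" "a' \<le> b'" "b' \<le> g (Suc l) (sg l)" "V a' + real (Suc k) \<le> V a"
    "\<And>x. x \<in> {a'<..b'} \<Longrightarrow> fol (rep l (Suc k)) x"
proof -
  have ab: "0 < a" "0 < b" using assms sg_pos[of "Suc l"] by auto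
  obtain a' b' where a': "0 < a'" "psi (rep l (Suc k)) a' = a"
    and b': "0 < b'" "psi (rep l (Suc k)) b' = b"
    using psi_rep_surj ab by meson
  have gs: "0 < g (Suc l) (sg l)" using g_gt[OF sg_pos, of l l] sg_pos[of l] by linarith
  have vk: "v l k = psi (rep l (Suc k)) (g (Suc l) (sg l))"
    unfolding v_def by (rule psi_rep_g[OF sg_pos, symmetric])
  have 1: "sg l \<le> a'" "a' \<le> b'" "b' \<le> g (Suc l) (sg l)"
    using assms a' b' psi_le_iff[OF sg_pos a'(1), of "rep l (Suc k)" l] psi_le_iff[OF a'(1) b'(1), of "rep l (Suc k)"]
      psi_le_iff[OF b'(1) gs, of "rep l (Suc k)"] vk v_def by metis+
  have lower: "sg (Suc l) \<le> psi (rep l (Suc j)) a'" if "j \<le> k" for j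
    using psi_rep_antimono[OF a'(1), of "Suc j" "Suc k" l] that a' assms(4) by linarith
  have upper: "psi (rep l (Suc j)) x \<le> sg l" if "0 < x" "x \<le> g (Suc l) (sg l)" for j x
  proof -
    have "psi (rep l (Suc j)) x \<le> psi (rep l (Suc j)) (g (Suc l) (sg l))"
      using that by (intro psi_mono) auto
    also have "\<dots> = v l j" unfolding v_def by (rule psi_rep_g[OF sg_pos])
    finally show ?thesis using v_le_sg[of l j] by linarith
  qed
  have V: "V a' + real j \<le> V (psi (rep l j) a')" if "j \<le> Suc k" for j
    using that
  proof (induction j)
    case (Suc j)
    let ?y = "psi (rep l (Suc j)) a'"
    have "V (g (Suc l) ?y) \<le> V ?y - 1"
      using Suc.prems lower[of j] upper[of a' j] a'(1) 1 by (intro V_drop) auto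
    moreover have "g (Suc l) ?y = psi (rep l j) a'"
      unfolding replicate_Suc psi.simps by (rule chi(2)[OF psi_pos[OF a'(1)]])
    ultimately show ?case using Suc by simp
  qed simp
  have "fol (rep l (Suc k)) x" if x: "x \<in> {a'<..b'}" for x
  proof (rule fol_rep)
    fix j assume "j < Suc k"
    then show "psi (rep l (Suc j)) x \<in> D (Suc l)"
      using lower[of j] upper[of x j] psi_strict_mono[OF a'(1), of x "rep l (Suc j)"] x a'(1) 1
      by (simp del: psi.simps replicate_Suc)
  qed
  then show ?thesis using that[OF a'(2) b'(2) 1] V[of "Suc k"] a'(2) by simp
qed

text \<open>\<open>dpsi\<close> is decreasing, so from \<open>sg l\<close> on it is at most its mean
  over the first domain, from \<open>v l 1\<close> to \<open>sg l\<close>. That mean is a ratio of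
  lengths whose numerator is the domain one below the domain being estimated, so the bounds
  telescope.\<close>

lemma dpsi_rep_le:
  assumes "sg l \<le> x"
  shows "dpsi (rep l (Suc k)) x \<le> (v l (Suc k) - v l (Suc (Suc k))) / (sg l - v l 1)"
proof -
  let ?w = "rep l (Suc k)"
  have less: "v l 1 < sg l" using v_Suc_less[of l 0] by (simp add: v_0)
  then obtain z where z: "v l 1 < z" "z < sg l"
    "psi ?w (sg l) - psi ?w (v l 1) = (sg l - v l 1) * dpsi ?w z"
    using MVT2[of "v l 1" "sg l" "psi ?w" "dpsi ?w"] psi_deriv v_pos[of l 1] less_le_trans by blast
  have "psi ?w (v l 1) = v l (Suc (Suc k))"
    using psi_rep_shift[where l = l and k = "Suc k" and x = "sg l"] by (simp add: v_def)
  then have "dpsi ?w z = (v l (Suc k) - v l (Suc (Suc k))) / (sg l - v l 1)"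
    using z(3) less by (simp add: v_def field_simps)
  moreover have "dpsi ?w x \<le> dpsi ?w z"
    using z assms v_pos[of l 1] by (intro dpsi_antimono) auto
  ultimately show ?thesis by simp
qed

text \<open>\<open>V\<close> gains at least 1 with every backward step on the level but is bounded
  by its value at \<open>sg (Suc l)\<close>, so the backward orbit must leave the level.\<close>

lemma bracket:
  assumes "sg (Suc l) \<le> x" "x \<le> sg l"
  obtains k where "v l (Suc k) \<le> x" "x \<le> v l k"
proof -
  have "\<exists>k. v l k < x"
  proof (rule ccontr)
    assume "\<not> ?thesis"
    then have ge: "sg (Suc l) \<le> v l k" for k using assms(1) by (meson not_less order_trans)
    have "real k \<le> V (v l k)" for k
    proof (induction k)
      case (Suc k)
      have "V (g (Suc l) (v l (Suc k))) \<le> V (v l (Suc k)) - 1" by (intro V_drop ge v_le_sg)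
      then show ?case using Suc unfolding g_v by simp
    qed (simp add: V_nonneg)
    moreover have "V (v l k) \<le> V (sg (Suc l))" for k by (intro V_antimono ge sg_pos)
    ultimately have "real k \<le> V (sg (Suc l))" for k by (meson order_trans)
    moreover obtain k :: nat where "V (sg (Suc l)) < real k" using reals_Archimedean2 by blast
    ultimately show False by (meson not_less)
  qed
  then obtain k where k: "v l k < x" "\<And>j. j < k \<Longrightarrow> x \<le> v l j"
    using exists_least_iff[of "\<lambda>k. v l k < x"] by (auto simp: not_less)
  have "k \<noteq> 0" using k(1) assms(2) by (intro notI) (simp add: v_0)
  then obtain j where "k = Suc j" by (cases k) auto
  then show ?thesis using that[of j] k by simp
qed

text \<open>The interval \<open>(s\<^sub>l, f(s\<^sub>l)]\<close> is the image of every fundamental domain of level \<open>l\<close>; the condition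
  on \<open>V\<close> leaves at least \<open>m\<close> steps after the climb to \<open>Y\<close>.\<close>
definition H :: "nat \<Rightarrow> nat \<Rightarrow> real \<Rightarrow> bool" where
  "H m l A \<longleftrightarrow> (\<forall>a b n. sg l \<le> a \<and> a \<le> b \<and> b \<le> g (Suc l) (sg l) \<and> V a + real m \<le> real n
      \<longrightarrow> T 0 a b n \<le> A)"

lemma T_piece:
  assumes "H m l A" "v l (Suc k) \<le> a" "a \<le> b" "b \<le> v l k" "sg (Suc l) \<le> a" "V a + real m \<le> real n"
  shows "T 0 a b n \<le> (v l (Suc k) - v l (Suc (Suc k))) / (sg l - v l 1) * A"
proof -
  obtain a' b' where c: "psi (rep l (Suc k)) a' = a" "psi (rep l (Suc k)) b' = b"
    "sg l \<le> a'" "a' \<le> b'" "b' \<le> g (Suc l) (sg l)" "V a' + real (Suc k) \<le> V a"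
    "\<And>x. x \<in> {a'<..b'} \<Longrightarrow> fol (rep l (Suc k)) x"
    using climb[OF assms(2-5)] by blast
  have a': "0 < a'" using c(3) sg_pos[of l] by linarith
  have kn: "real (Suc k) \<le> real n" using c(6) assms(6) V_nonneg[of a'] by linarith
  then have kn': "Suc k \<le> n" by simp
  let ?L = "(v l (Suc k) - v l (Suc (Suc k))) / (sg l - v l 1)"
  have L: "dpsi (rep l (Suc k)) a' \<le> ?L" by (rule dpsi_rep_le[OF c(3)])
  have "T 0 (psi (rep l (Suc k)) a') (psi (rep l (Suc k)) b') n \<le> ?L * T 0 a' b' (n - Suc k)"
    using kn' by (intro T_pull a' c L) auto
  moreover have "V a' + real m \<le> real (n - Suc k)"
    using c(6) assms(6) kn' by (simp add: of_nat_diff)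
  then have "T 0 a' b' (n - Suc k) \<le> A"
    using assms(1) c unfolding H_def by blast
  moreover have "0 \<le> ?L" using L dpsi_pos[OF a', of "rep l (Suc k)"] by linarith
  ultimately show ?thesis unfolding c(1,2) using mult_left_mono order_trans by blast
qed

lemma H_nonneg: assumes "H m l A" shows "0 \<le> A"
proof -
  obtain n :: nat where "V (sg l) + real m \<le> real n" using real_arch_simple by blast
  moreover have "sg l \<le> g (Suc l) (sg l)" using g_gt[OF sg_pos] by (rule less_imp_le)
  ultimately have "T 0 (sg l) (sg l) n \<le> A" using assms unfolding H_def by blast
  then show ?thesis using T_nonneg order_trans by blast
qed

lemma v_1_less: "v l 1 < sg l" using v_Suc_less[of l 0] by (simp add: v_0)

text \<open>Every domain is charged the length of the next lower one, incomplete domains at the two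
  ends in full; the sum telescopes. The induction adds domains at the bottom.\<close>

lemma T_pieces:
  assumes H: "H m l A" and "v l (k + r) \<le> a" "a \<le> b" "b \<le> v l k" "sg (Suc l) \<le> a"
    "V a + real m \<le> real n"
  shows "T 0 a b n \<le> (v l (Suc k) - v l (Suc (k + r))) / (sg l - v l 1) * A"
  using assms(2-)
proof (induction r arbitrary: a)
  case 0
  then show ?case by (simp add: T_empty)
next
  case (Suc r)
  let ?c = "v l (k + r)"
  let ?d = "sg l - v l 1"
  have d: "0 < ?d" using v_1_less by simp
  have A: "0 \<le> A" by (rule H_nonneg[OF H])
  have split: "(v l (Suc k) - v l (Suc (k + Suc r))) / ?d * A
     = (v l (Suc k) - v l (Suc (k + r))) / ?d * A + (v l (Suc (k + r)) - v l (Suc (Suc (k + r)))) / ?d * A"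
    by (simp add: diff_divide_distrib algebra_simps)
  have nn1: "0 \<le> (v l (Suc k) - v l (Suc (k + r))) / ?d * A"
    using d A v_antimono[of "Suc k" "Suc (k + r)" l] by (intro mult_nonneg_nonneg divide_nonneg_pos) auto
  have nn2: "0 \<le> (v l (Suc (k + r)) - v l (Suc (Suc (k + r)))) / ?d * A"
    using d A v_Suc_less[of l "Suc (k + r)"] by (intro mult_nonneg_nonneg divide_nonneg_pos) auto
  consider "?c \<le> a" | "a < ?c" "b \<le> ?c" | "a < ?c" "?c < b" by linarith
  then show ?case
  proof cases
    case 1
    then show ?thesis using Suc.IH[of a] Suc.prems nn2 unfolding split by linarith
  next
    case 2
    then show ?thesis using T_piece[OF H, of "k + r" a b n] Suc.prems nn1 unfolding split by simp
  next
    case 3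
    have a0: "0 < a" using Suc.prems(4) sg_pos[of "Suc l"] by linarith
    have "T 0 a b n \<le> T 0 a ?c n + T 0 ?c b n" using 3 by (intro T_split) auto
    moreover have "T 0 a ?c n \<le> (v l (Suc (k + r)) - v l (Suc (Suc (k + r)))) / ?d * A"
      using T_piece[OF H, of "k + r" a ?c n] Suc.prems 3 by simp
    moreover have "T 0 ?c b n \<le> (v l (Suc k) - v l (Suc (k + r))) / ?d * A"
      using Suc.IH[of ?c] Suc.prems 3 V_antimono[of a ?c] a0 by linarith
    ultimately show ?thesis unfolding split by linarith
  qed
qed

text \<open>At s the upper-indexed branch moves by \<open>2 s u(s)\<close> because the correction
  doubles there. Two steps of the other branch move at least as far, since its displacement
  increases with the point.\<close>

lemma g_overlap:
  "g (Suc (Suc l)) (sg (Suc l)) \<le> g (Suc l) (g (Suc l) (sg (Suc l)))"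
proof -
  let ?s = "sg (Suc l)"
  have less: "?s < g (Suc l) ?s" by (rule g_gt[OF sg_pos])
  have "?s * u l ?s \<le> g (Suc l) ?s * u l (g (Suc l) ?s)"
    using less sg_pos[of "Suc l"] u_pos[of ?s l] by (intro mult_mono u_mono) auto
  moreover have "g (Suc (Suc l)) ?s = ?s + 2 * (?s * u l ?s)"
    unfolding g.simps(2) u_sg by (simp add: algebra_simps)
  moreover have "g (Suc l) ?s = ?s + ?s * u l ?s"
    "g (Suc l) (g (Suc l) ?s) = g (Suc l) ?s + g (Suc l) ?s * u l (g (Suc l) ?s)"
    by (simp_all add: algebra_simps)
  ultimately show ?thesis by linarith
qed

text \<open>By \<open>g_overlap\<close> the target interval above s spans at most two steps of the
  level-l dynamics, so it meets at most three consecutive fundamental domains of level l. Their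
  lengths are comparable to that of the domain near s, smaller than the first one by
  \<open>8 exp (- c1)\<close>; three of them give 24.\<close>

lemma H_Suc: assumes H: "H m l A" shows "H m (Suc l) (24 * exp (- c1) * A)"
  unfolding H_def
proof (intro allI impI, elim conjE)
  fix a b n
  let ?s = "sg (Suc l)"
  assume a: "?s \<le> a" "a \<le> b" "b \<le> g (Suc (Suc l)) ?s" "V a + real m \<le> real n"
  obtain K where K: "v l (Suc K) \<le> ?s" "?s \<le> v l K"
    using bracket[of l ?s] sg_Suc_less[of l] by auto
  have s4: "?s \<le> sg l / 4" by (rule sg_Suc_le)
  have v1: "sg l \<le> 2 * v l 1" using v_le2[of l 0] by (simp add: v_0)
  have v12: "v l 1 \<le> 2 * v l 2" using v_le2[of l 1] by (simp add: numeral_2_eq_2)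
  have v23: "v l 3 < v l 2" using v_Suc_less[of l 2] by (simp add: numeral_3_eq_3 numeral_2_eq_2)
  \<comment> \<open>Two indices are kept in reserve because b may be two steps above s. The case K <
    2 can only occur when s equals \<open>v l 2\<close>, and then j = 0 serves.\<close>
  have "\<exists>j. v l (Suc (Suc (Suc j))) \<le> ?s \<and> ?s \<le> v l (Suc (Suc j))"
  proof (cases "K < 2")
    case True
    then have "v l 2 \<le> v l (Suc K)" by (intro v_antimono) auto
    then have "v l 3 \<le> ?s" "?s \<le> v l 2" using K s4 v1 v12 v23 by linarith+
    then show ?thesis by (intro exI[of _ 0]) (simp add: numeral_3_eq_3 numeral_2_eq_2)
  next
    case False
    then have "K = Suc (Suc (K - 2))" by simp
    then show ?thesis using K by metis
  qed
  then obtain j where j: "v l (Suc (Suc (Suc j))) \<le> ?s" "?s \<le> v l (Suc (Suc j))" by blast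
  let ?d = "sg l - v l 1"
  have gmono: "g (Suc l) x \<le> g (Suc l) y" if "0 < x" "x \<le> y" for x y
    using g_strict_mono[of x y "Suc l"] that by (cases "x = y") auto
  have gpos: "0 < g (Suc l) ?s" using g_gt[of ?s l] sg_pos[of "Suc l"] by linarith
  have "g (Suc l) ?s \<le> v l (Suc j)" using gmono[OF sg_pos j(2)] unfolding g_v .
  then have "g (Suc l) (g (Suc l) ?s) \<le> v l j" using gmono[OF gpos] g_v by metis
  then have b: "b \<le> v l j" using a(3) g_overlap[of l] by linarith
  have "v l (j + 3) \<le> a" using j(1) a(1) by (simp add: numeral_3_eq_3)
  then have T: "T 0 a b n \<le> (v l (Suc j) - v l (Suc (j + 3))) / ?d * A"
    using T_pieces[OF H _ a(2) b a(1) a(4)] by blast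
  have "(v l (Suc j) - v l (Suc (j + 3))) / ?d \<le> 24 * exp (- c1)"
  proof -
    let ?z = "v l (Suc (Suc j))"
    have "v l (Suc j) - v l (Suc (j + 3)) \<le> 3 * (v l (Suc j) - ?z)"
      using v_diff_antimono[of "Suc j" "Suc (Suc j)" l] v_diff_antimono[of "Suc j" "Suc (Suc (Suc j))" l]
      by (simp add: numeral_3_eq_3)
    also have "\<dots> = 3 * (?z * u l ?z)" unfolding v_diff ..
    also have "\<dots> \<le> 3 * ((8 * exp (- c1) * v l 1) * u l (v l 1))"
    proof -
      \<comment> \<open>The 8 has three sources: 2 from the position inside one domain,
        \<open>2 exp (- c1)\<close> from the ratio of the levels, and 2 from \<open>sg l\<close> to
        \<open>v l 1\<close>.\<close>
      have "?z \<le> 2 * ?s" using v_le2[of l "Suc (Suc j)"] j(1) by linarith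
      also have "\<dots> \<le> 4 * exp (- c1) * sg l" using sg_ratio[of l] by linarith
      also have "\<dots> \<le> 4 * exp (- c1) * (2 * v l 1)" using v1 by (intro mult_left_mono) auto
      finally have "?z \<le> 8 * exp (- c1) * v l 1" by simp
      then show ?thesis
        using v_antimono[of 1 "Suc (Suc j)" l]
        by (intro mult_left_mono mult_mono u_mono less_imp_le[OF v_pos] less_imp_le[OF u_pos]
            mult_nonneg_nonneg v_pos) auto
    qed
    also have "\<dots> = 24 * exp (- c1) * ?d"
      using v_diff[of l 0] by (simp add: v_0)
    finally show ?thesis using v_1_less[of l] by (simp add: divide_le_eq)
  qed
  then have "(v l (Suc j) - v l (Suc (j + 3))) / ?d * A \<le> 24 * exp (- c1) * A"
    by (intro mult_right_mono H_nonneg[OF H])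
  then show "T 0 a b n \<le> 24 * exp (- c1) * A" using T by linarith
qed

lemma H_level: assumes "H m 0 t" shows "H m l ((24 * exp (- c1)) ^ l * t)"
proof (induction l)
  case (Suc l)
  then show ?case using H_Suc[OF Suc] by (simp add: ac_simps)
qed (use assms in simp)

text \<open>The telescoped lengths sum to at most \<open>v l 1\<close>; divided by the first domain
  this is \<open>1 / u l (v l 1)\<close>, of order \<open>(sg l)^(-\<alpha>)\<close>.\<close>

lemma T_level:
  assumes H: "H m l A" and "sg (Suc l) \<le> a" "a \<le> b" "b \<le> sg l" "V a + real m \<le> real n"
  shows "T 0 a b n \<le> 4 * sg l powr (- \<alpha>) * A"
proof -
  obtain r where r: "v l (Suc r) \<le> a" using bracket[of l a] assms by auto
  let ?d = "sg l - v l 1"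
  have "T 0 a b n \<le> (v l (Suc 0) - v l (Suc (0 + Suc r))) / ?d * A"
    using r assms by (intro T_pieces[OF H]) (auto simp: v_0)
  also have "\<dots> \<le> 4 * sg l powr (- \<alpha>) * A"
  proof (intro mult_right_mono H_nonneg[OF H])
    have v1: "sg l / 2 \<le> v l 1" using v_le2[of l 0] by (simp add: v_0)
    have d: "?d = v l 1 * u l (v l 1)" using v_diff[of l 0] by (simp add: v_0)
    have "sg l powr \<alpha> / 2 \<le> sg l powr \<alpha> / 2 powr \<alpha>"
      using \<alpha>_less1 \<alpha>_pos powr_mono[of \<alpha> 1 2] by (intro divide_left_mono) auto
    also have "\<dots> = (sg l / 2) powr \<alpha>" using sg_pos[of l] by (simp add: powr_divide)
    also have "\<dots> \<le> v l 1 powr \<alpha>" using v1 sg_pos[of l] \<alpha>_pos by (intro powr_mono2) auto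
    also have "\<dots> \<le> 2 * u l (v l 1)"
    proof -
      have "sg (Suc l) \<le> v l 1" using sg_Suc_le[of l] v1 sg_pos[of l] by linarith
      from u_lower[OF this] show ?thesis by simp
    qed
    finally have u: "sg l powr \<alpha> / 4 \<le> u l (v l 1)" by simp
    have up: "0 < sg l powr \<alpha> / 4" using sg_pos[of l] by simp
    have "(v l (Suc 0) - v l (Suc (0 + Suc r))) / ?d \<le> v l 1 / ?d"
      using v_pos[of l "Suc (Suc r)"] v_1_less[of l] by (intro divide_right_mono) auto
    also have "\<dots> = 1 / u l (v l 1)" unfolding d using v_pos[of l 1] by simp
    also have "\<dots> \<le> 1 / (sg l powr \<alpha> / 4)"
      by (intro divide_left_mono mult_pos_pos less_le_trans[OF up u] u up) auto
    also have "\<dots> = 4 * sg l powr (- \<alpha>)" using sg_pos[of l] by (simp add: powr_minus field_simps)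
    finally show "(v l (Suc 0) - v l (Suc (0 + Suc r))) / ?d \<le> 4 * sg l powr (- \<alpha>)" .
  qed
  finally show ?thesis .
qed

section \<open>Summation over the levels below the top one\<close>

text \<open>The ratio of consecutive level contributions: \<open>24 exp (- c1)\<close> for going one
  level down, times \<open>exp (\<alpha> c1)\<close> for the sum over the domains of that
  level.\<close>

definition q :: real where "q = 24 * exp (- (1 - \<alpha>) * c1)"

lemma q_bounds: "0 < q" "q \<le> 1/100" using c1_large(3) by (auto simp: q_def)

lemma level_factor: "sg (Suc l) powr (- \<alpha>) * (24 * exp (- c1)) ^ Suc l = q ^ Suc l"
proof -
  have "sg (Suc l) powr (- \<alpha>) = exp (\<alpha> * c1) ^ Suc l"
    unfolding exp_of_nat_mult[symmetric] by (simp add: sg_def powr_def algebra_simps)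
  then have "sg (Suc l) powr (- \<alpha>) * (24 * exp (- c1)) ^ Suc l = (exp (\<alpha> * c1) * (24 * exp (- c1))) ^ Suc l"
    by (simp only: power_mult_distrib)
  also have "exp (\<alpha> * c1) * (24 * exp (- c1)) = q"
    by (simp add: q_def algebra_simps flip: exp_add)
  finally show ?thesis .
qed

text \<open>Level l contributes at most \<open>4 q^l t\<close>. The bound is a majorant of the
  partial sum over levels 1 to N that telescopes; the induction closes because \<open>8 q\<close> is
  below 4.\<close>

lemma T_low_aux:
  assumes H: "H m 0 t" and "sg (Suc N) \<le> a" "a \<le> b" "b \<le> sg 1" "V a + real m \<le> real n"
  shows "T 0 a b n \<le> (8 * q - 8 * q ^ Suc N) * t"
  using assms(2-)
proof (induction N arbitrary: a)
  case 0
  then show ?case by (simp add: T_empty)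
next
  case (Suc N)
  have t: "0 \<le> t" by (rule H_nonneg[OF H])
  have a0: "0 < a" using Suc.prems(1) sg_pos[of "Suc (Suc N)"] by linarith
  let ?c = "sg (Suc N)"
  have lev: "T 0 a b' n \<le> 4 * q ^ Suc N * t" if "a \<le> b'" "b' \<le> ?c" for b'
    using T_level[OF H_level[OF H], of "Suc N" a b' n] Suc.prems that
    unfolding level_factor[symmetric] by (simp only: mult.assoc)
  have "0 < q ^ Suc N" using q_bounds by simp
  then have q1: "q * q ^ Suc N \<le> 1/100 * q ^ Suc N" using q_bounds by (intro mult_right_mono) auto
  have "q ^ Suc N \<le> q ^ 1" using q_bounds by (intro power_decreasing) auto
  then have q2: "0 \<le> (8 * q - 8 * q ^ Suc N) * t" using t by simp
  have q3: "(8 * q - 8 * q ^ Suc N) * t + 4 * q ^ Suc N * t \<le> (8 * q - 8 * q ^ Suc (Suc N)) * t"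
  proof -
    have "(8 * q - 8 * q ^ Suc N + 4 * q ^ Suc N) * t \<le> (8 * q - 8 * q ^ Suc (Suc N)) * t"
      using q1 \<open>0 < q ^ Suc N\<close> by (intro mult_right_mono t) (simp only: power_Suc[of q "Suc N"])
    then show ?thesis by (simp only: distrib_right)
  qed
  have q4: "0 \<le> 4 * q ^ Suc N * t" using t q_bounds by simp
  consider "?c \<le> a" | "a < ?c" "b \<le> ?c" | "a < ?c" "?c < b" by linarith
  then show ?case
  proof cases
    case 1
    then show ?thesis using Suc.IH[of a] Suc.prems q3 q4 by linarith
  next
    case 2
    then show ?thesis using lev[of b] Suc.prems q3 q2 by linarith
  next
    case 3
    have "T 0 a b n \<le> T 0 a ?c n + T 0 ?c b n" using 3 by (intro T_split) auto
    moreover have "T 0 a ?c n \<le> 4 * q ^ Suc N * t" using lev[of ?c] 3 by simp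
    moreover have "T 0 ?c b n \<le> (8 * q - 8 * q ^ Suc N) * t"
      using Suc.IH[of ?c] Suc.prems 3 V_antimono[of a ?c] a0 by linarith
    ultimately show ?thesis using q3 by linarith
  qed
qed

lemma sg_tendsto_0: assumes "0 < x" shows "\<exists>N. sg (Suc N) \<le> x"
proof -
  obtain N where N: "(1/2) ^ N < x" using real_arch_pow_inv[of x "1/2"] assms by auto
  have "sg l \<le> (1/2) ^ l" for l
  proof (induction l)
    case (Suc l)
    then show ?case using sg_Suc_le[of l] sg_pos[of l] by simp
  qed (simp add: sg_def)
  then have "sg N \<le> (1/2) ^ N" .
  then show ?thesis using N sg_Suc_less[of N] by (intro exI[of _ N]) linarith
qed

lemma T_low:
  assumes H: "H m 0 t" and "0 < a" "a \<le> b" "b \<le> sg 1" "V a + real m \<le> real n"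
  shows "T 0 a b n \<le> t / 10"
proof -
  have t: "0 \<le> t" by (rule H_nonneg[OF H])
  obtain N where "sg (Suc N) \<le> a" using sg_tendsto_0 assms by blast
  then have "T 0 a b n \<le> (8 * q - 8 * q ^ Suc N) * t" using T_low_aux[OF H] assms by blast
  also have "\<dots> \<le> 1/10 * t"
  proof (intro mult_right_mono t)
    have "0 < q ^ Suc N" using q_bounds by simp
    then show "8 * q - 8 * q ^ Suc N \<le> 1/10" using q_bounds by linarith
  qed
  finally show ?thesis by simp
qed

section \<open>The top level and one passage through the left half\<close>

text \<open>The last step of the climb starts at or above \<open>v 0 1\<close>, hence at or above
  1/4, where the correction is at least \<open>2^(-\<gamma>)\<close>, so at least 1/2. This step
  alone expands by more than 5/4, and the earlier ones do not contract.\<close>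

lemma dpsi_level0: assumes "1/2 \<le> x" shows "dpsi (rep 0 (Suc k)) x \<le> 4/5"
proof -
  have eq: "rep 0 (Suc k) = rep 0 k @ [Suc 0]" by (simp add: replicate_append_same)
  have c: "v 0 1 \<le> chi (Suc 0) x"
    using assms chi_mono[of "1/2" x "Suc 0"] by (simp add: v_def sg_def)
  have v1: "1/4 \<le> v 0 1" using v_le2[of 0 0] by (simp add: v_0 sg_def)
  have "2 powr \<gamma> \<le> (2::real)" using \<gamma>_bounds powr_mono[of \<gamma> 1 2] by simp
  moreover have "u 0 (1/4) * 2 powr \<gamma> = 1"
    using powr_mult[of 2 2 \<gamma>] by (simp add: u_def powr_divide)
  ultimately have "1 \<le> u 0 (1/4) * 2"
    using u_pos[of "1/4" 0] mult_left_mono[of "2 powr \<gamma>" 2 "u 0 (1/4)"] by simp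
  also have "\<dots> \<le> u 0 (chi (Suc 0) x) * 2" using c v1 by (intro mult_right_mono u_mono) auto
  finally have u: "1/2 \<le> u 0 (chi (Suc 0) x)" by simp
  then have "1 * (1/2) \<le> (1 + \<gamma>) * u 0 (chi (Suc 0) x)"
    using \<gamma>_bounds by (intro mult_mono) auto
  then have "dchi (Suc 0) x \<le> 1 / (5/4)"
    unfolding dchi_def by (intro divide_left_mono mult_pos_pos) auto
  then have "dpsi (rep 0 k) (chi (Suc 0) x) * dchi (Suc 0) x \<le> 1 * (1 / (5/4))"
    using assms by (intro mult_mono dpsi_le1 chi less_imp_le[OF dchi_pos(1)]) auto
  then show ?thesis unfolding eq by (simp add: dpsi_append)
qed

text \<open>For level 0 the target interval is \<open>Y\<close> itself, because
  \<open>g (Suc 0)\<close> sends 1/2 to 1. A complete domain is therefore carried onto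
  \<open>Y\<close>, where the empty word covers everything; only incomplete domains cost
  something.\<close>

lemma T_level0_piece:
  assumes H: "H m 0 t" and "v 0 (Suc k) \<le> a" "a \<le> b" "b \<le> v 0 k" "sg 1 \<le> a" "V a + real m \<le> real n"
  shows "T 0 a b n \<le> 4/5 * t" "a = v 0 (Suc k) \<Longrightarrow> b = v 0 k \<Longrightarrow> T 0 a b n = 0"
proof -
  have "sg (Suc 0) \<le> a" using assms(5) by simp
  then obtain a' b' where c: "psi (rep 0 (Suc k)) a' = a" "psi (rep 0 (Suc k)) b' = b"
    "sg 0 \<le> a'" "a' \<le> b'" "b' \<le> g (Suc 0) (sg 0)" "V a' + real (Suc k) \<le> V a"
    "\<And>x. x \<in> {a'<..b'} \<Longrightarrow> fol (rep 0 (Suc k)) x"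
    using climb[OF assms(2-4)] by blast
  have a': "0 < a'" "1/2 \<le> a'" using c(3) by (simp_all add: sg_def)
  have kn: "real (Suc k) \<le> real n" using c(6) assms(6) V_nonneg[of a'] by linarith
  then have kn': "Suc k \<le> n" by simp
  have "T 0 (psi (rep 0 (Suc k)) a') (psi (rep 0 (Suc k)) b') n \<le> 4/5 * T 0 a' b' (n - Suc k)"
    using kn' by (intro T_pull a' c dpsi_level0) auto
  then have pull: "T 0 a b n \<le> 4/5 * T 0 a' b' (n - Suc k)" unfolding c(1,2) .
  have "V a' + real m \<le> real (n - Suc k)"
    using c(6) assms(6) kn' by (simp add: of_nat_diff)
  then have "T 0 a' b' (n - Suc k) \<le> t"
    using H c unfolding H_def by blast
  then show "T 0 a b n \<le> 4/5 * t" using pull by linarith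
  assume eq: "a = v 0 (Suc k)" "b = v 0 k"
  have "psi (rep 0 (Suc k)) a' = psi (rep 0 (Suc k)) (sg 0)" using c(1) eq by (simp only: v_def)
  then have a'': "a' = sg 0" using psi_inj[OF a'(1) sg_pos] by blast
  have gs: "0 < g (Suc 0) (sg 0)" using g_gt[OF sg_pos, of 0 0] sg_pos[of 0] by linarith
  have "psi (rep 0 (Suc k)) b' = psi (rep 0 (Suc k)) (g (Suc 0) (sg 0))"
    using c(2) eq psi_rep_g[OF sg_pos, where l = 0 and k = k] by (simp only: v_def)
  then have "b' = g (Suc 0) (sg 0)" using psi_inj[OF _ gs] a' c(4) by (meson less_le_trans)
  then have "a' = 1/2" "b' = 1" using a'' g_half by (simp_all add: sg_def)
  then have "T 0 a' b' (n - Suc k) = 0" by (simp only: T_Y)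
  then show "T 0 a b n = 0" using pull T_nonneg[of 0 a b n] by simp
qed

lemma T_level0_full:
  assumes H: "H m 0 t" and "sg 1 \<le> v 0 (k + r)" "V (v 0 (k + r)) + real m \<le> real n"
  shows "T 0 (v 0 (k + r)) (v 0 k) n = 0"
  using assms(2-)
proof (induction r)
  case (Suc r)
  let ?c = "v 0 (k + r)"
  have less: "v 0 (k + Suc r) < ?c" using v_Suc_less[of 0 "k + r"] by simp
  have "V ?c \<le> V (v 0 (k + Suc r))" using less by (intro V_antimono v_pos) auto
  then have "T 0 ?c (v 0 k) n = 0" using Suc less by linarith
  moreover have "T 0 (v 0 (k + Suc r)) ?c n = 0"
    using Suc.prems less by (intro T_level0_piece(2)[OF H]) auto
  moreover have "T 0 (v 0 (k + Suc r)) (v 0 k) n \<le> T 0 (v 0 (k + Suc r)) ?c n + T 0 ?c (v 0 k) n"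
    using less v_antimono[of k "k + r" 0] by (intro T_split) auto
  ultimately show ?case using T_nonneg[of 0 "v 0 (k + Suc r)" "v 0 k" n] by linarith
qed (simp add: T_empty)

text \<open>The right end is a domain boundary, so only the domain containing \<open>a\<close> is
  incomplete.\<close>

lemma T_level0_one:
  assumes H: "H m 0 t" and "a \<le> v 0 j" "sg 1 \<le> a" "V a + real m \<le> real n"
  shows "T 0 a (v 0 j) n \<le> 4/5 * t"
proof -
  have t: "0 \<le> t" by (rule H_nonneg[OF H])
  obtain K where K: "v 0 (Suc K) \<le> a" "a \<le> v 0 K"
    using bracket[of 0 a] assms v_le_sg[of 0 j] by auto
  show ?thesis
  proof (cases "K < j")
    case True
    then have "v 0 j \<le> v 0 (Suc K)" by (intro v_antimono) auto
    then show ?thesis using K assms t by (simp add: T_empty)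
  next
    case False
    then obtain r where r: "K = j + r" using le_Suc_ex not_less by blast
    have a0: "0 < a" using assms(3) sg_pos[of 1] by linarith
    have "T 0 a (v 0 j) n \<le> T 0 a (v 0 K) n + T 0 (v 0 K) (v 0 j) n"
      using K r v_antimono[of j K 0] by (intro T_split) auto
    moreover have "T 0 a (v 0 K) n \<le> 4/5 * t" using K assms by (intro T_level0_piece(1)[OF H]) auto
    moreover have "T 0 (v 0 K) (v 0 j) n = 0"
      unfolding r using K assms V_antimono[OF a0 K(2)] r by (intro T_level0_full[OF H]) auto
    ultimately show ?thesis by linarith
  qed
qed

lemma T_level0_two:
  assumes H: "H m 0 t" and "a \<le> b" "b \<le> 1/2" "sg 1 \<le> a" "V a + real m \<le> real n"
  shows "T 0 a b n \<le> 8/5 * t"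
proof -
  have t: "0 \<le> t" by (rule H_nonneg[OF H])
  have a0: "0 < a" using assms(4) sg_pos[of 1] by linarith
  obtain L where L: "v 0 (Suc L) \<le> b" "b \<le> v 0 L"
    using bracket[of 0 b] assms by (auto simp: sg_def)
  show ?thesis
  proof (cases "v 0 (Suc L) \<le> a")
    case True
    have "T 0 a b n \<le> 4/5 * t" using True L assms by (intro T_level0_piece(1)[OF H]) auto
    then show ?thesis using t by simp
  next
    case False
    let ?c = "v 0 (Suc L)"
    have "T 0 a b n \<le> T 0 a ?c n + T 0 ?c b n" using False L by (intro T_split) auto
    moreover have "T 0 a ?c n \<le> 4/5 * t" using False assms by (intro T_level0_one[OF H]) auto
    moreover have "T 0 ?c b n \<le> 4/5 * t"
      using False L assms V_antimono[OF a0, of ?c] by (intro T_level0_piece(1)[OF H]) auto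
    ultimately show ?thesis by linarith
  qed
qed

text \<open>Everything below \<open>sg 1\<close> costs 1/10, and each incomplete top-level domain
  costs 4/5. There are at most two, and only one if the right end is 1/2, which is the boundary
  \<open>v 0 0\<close>.\<close>

lemma T_below_half:
  assumes H: "H m 0 t" and "0 < a" "a \<le> b" "b \<le> 1/2" "V a + real m \<le> real n"
  shows "T 0 a b n \<le> 17/10 * t" "b = 1/2 \<Longrightarrow> T 0 a b n \<le> 9/10 * t"
proof -
  have t: "0 \<le> t" by (rule H_nonneg[OF H])
  have s1: "sg 1 < 1/2" using sg_Suc_less[of 0] by (simp add: sg_def)
  have key: "T 0 a b n \<le> t / 10 + X"
    if X: "0 \<le> X" "\<And>c. sg 1 \<le> c \<Longrightarrow> c \<le> b \<Longrightarrow> V c + real m \<le> real n \<Longrightarrow> T 0 c b n \<le> X" for X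
  proof -
    consider "sg 1 \<le> a" | "b \<le> sg 1" | "a < sg 1" "sg 1 < b" by linarith
    then show ?thesis
    proof cases
      case 1
      then show ?thesis using X(2)[of a] assms t by simp
    next
      case 2
      then show ?thesis using T_low[OF H, of a b n] assms X(1) by simp
    next
      case 3
      have "T 0 a b n \<le> T 0 a (sg 1) n + T 0 (sg 1) b n" using 3 by (intro T_split) auto
      moreover have "T 0 a (sg 1) n \<le> t / 10" using 3 assms by (intro T_low[OF H]) auto
      moreover have "T 0 (sg 1) b n \<le> X" using 3 assms V_antimono[of a "sg 1"] by (intro X(2)) auto
      ultimately show ?thesis by linarith
    qed
  qed
  have "T 0 a b n \<le> t / 10 + 8/5 * t"
    using t assms by (intro key T_level0_two[OF H]) auto
  then show "T 0 a b n \<le> 17/10 * t" by simp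
  assume b: "b = 1/2"
  have "T 0 a b n \<le> t / 10 + 4/5 * t"
  proof (intro key)
    fix c assume "sg 1 \<le> c" "c \<le> b" "V c + real m \<le> real n"
    then have "T 0 c (v 0 0) n \<le> 4/5 * t"
      using b by (intro T_level0_one[OF H]) (auto simp: v_0 sg_def)
    then show "T 0 c b n \<le> 4/5 * t" unfolding b by (simp add: v_0 sg_def)
  qed (use t in simp)
  then show "T 0 a b n \<le> 9/10 * t" by simp
qed

section \<open>The renewal inequality and the polynomial tail\<close>

text \<open>The first step has slope 2. Points it sends below \<open>xs\<close> are given up, at
  cost \<open>xs / 2\<close>; from above \<open>xs\<close> the climb leaves m steps to spare. The
  worst image straddles 1/2 and costs 9/10 on the left and 1 on the right, which the slope halves to
  19/20.\<close>

lemma T_step: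
  assumes t: "\<And>a b. 1/2 \<le> a \<Longrightarrow> a \<le> b \<Longrightarrow> b \<le> 1 \<Longrightarrow> T 1 a b m \<le> t"
    and xs: "0 < xs" "V xs + real m \<le> real n" and ab: "1/2 \<le> a" "a \<le> b" "b \<le> 1"
  shows "T 1 a b (Suc n) \<le> xs / 2 + 19/20 * t"
proof -
  have mn: "m \<le> n" using xs V_nonneg[of xs] by linarith
  \<comment> \<open>The hypothesis bounds genuine returns, but after the first step the empty word
    is allowed as well, which only shrinks the uncovered set.\<close>
  have T0: "T 0 c d n' \<le> t" if "1/2 \<le> c" "c \<le> d" "d \<le> 1" "m \<le> n'" for c d n'
    using T_antimono[of m n' 0 1 c d] t[of c d] that by linarith
  have H: "H m 0 t"
    unfolding H_def
  proof (intro allI impI, elim conjE)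
    fix a b n assume *: "sg 0 \<le> a" "a \<le> b" "b \<le> g (Suc 0) (sg 0)" "V a + real m \<le> real n"
    then have "m \<le> n" using V_nonneg[of a] by linarith
    then show "T 0 a b n \<le> t" using * g_half by (intro T0) (auto simp: sg_def)
  qed
  have t0: "0 \<le> t" by (rule H_nonneg[OF H])
  have main: "T 0 c d n \<le> 19/10 * t" if "xs \<le> c" "c \<le> d" "d \<le> 1" for c d
  proof -
    have c: "0 < c" "V c + real m \<le> real n" using that xs V_antimono[OF xs(1) that(1)] by auto
    consider "1/2 \<le> c" | "d \<le> 1/2" | "c < 1/2" "1/2 < d" by linarith
    then show ?thesis
    proof cases
      case 1
      then show ?thesis using T0[of c d n] that t0 mn by simp
    next
      case 2
      then show ?thesis using T_below_half(1)[OF H c(1) that(2) _ c(2)] t0 by simp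
    next
      case 3
      have "T 0 c d n \<le> T 0 c (1/2) n + T 0 (1/2) d n" using 3 by (intro T_split) auto
      moreover have "T 0 c (1/2) n \<le> 9/10 * t" using 3 c by (intro T_below_half(2)[OF H]) auto
      moreover have "T 0 (1/2) d n \<le> t" using 3 that mn by (intro T0) auto
      ultimately show ?thesis by linarith
    qed
  qed
  \<comment> \<open>The point \<open>(1 + xs) / 2\<close> is the preimage of \<open>xs\<close> in
    \<open>Y\<close>.\<close>
  define a1 where "a1 = max a ((1 + xs) / 2)"
  show ?thesis
  proof (cases "b \<le> a1")
    case True
    have "b - a \<le> xs / 2 \<or> a = b" using True ab by (auto simp: a1_def max_def field_simps split: if_splits)
    then show ?thesis using T_le[OF ab(2), of 1 "Suc n"] xs t0 by (auto simp: T_empty)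
  next
    case False
    have a1: "psi [0] (2 * a1 - 1) = a1" "psi [0] (2 * b - 1) = b" "xs \<le> 2 * a1 - 1"
    proof -
      have "(1 + xs) / 2 \<le> a1" "a1 < b" using False by (simp_all add: a1_def not_le del: max_less_iff_conj)
      then show "xs \<le> 2 * a1 - 1" "psi [0] (2 * a1 - 1) = a1" "psi [0] (2 * b - 1) = b"
        using xs by (auto simp: chi_0)
    qed
    have fol: "fol [0] x" if "x \<in> {2 * a1 - 1<..2 * b - 1}" for x
      using that a1 xs ab by (auto simp: chi_0)
    have "dpsi [0] (2 * a1 - 1) \<le> 1/2" by (simp add: dchi_def)
    then have "T 1 (psi [0] (2 * a1 - 1)) (psi [0] (2 * b - 1)) (Suc n) \<le> 1/2 * T 0 (2 * a1 - 1) (2 * b - 1) n"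
      using a1 xs False fol by (intro T_pull) auto
    then have "T 1 a1 b (Suc n) \<le> 1/2 * T 0 (2 * a1 - 1) (2 * b - 1) n" unfolding a1(1,2) .
    moreover have "T 0 (2 * a1 - 1) (2 * b - 1) n \<le> 19/10 * t"
      using a1(3) False ab by (intro main) linarith+
    moreover have "T 1 a b (Suc n) \<le> T 1 a a1 (Suc n) + T 1 a1 b (Suc n)"
      using False by (intro T_split) (simp_all add: a1_def del: max.bounded_iff)
    moreover have "T 1 a a1 (Suc n) \<le> xs / 2"
      using T_le[of a a1 1 "Suc n"] ab xs by (auto simp: a1_def max_def field_simps split: if_splits)
    ultimately show ?thesis by linarith
  qed
qed

lemma T_tail:
  "\<exists>C>0. \<forall>n\<ge>1. \<forall>a b. 1/2 \<le> a \<longrightarrow> a \<le> b \<longrightarrow> b \<le> 1 \<longrightarrow> T 1 a b n \<le> C * real n powr (- 1 / \<alpha>)"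
proof -
  \<comment> \<open>Replacing n by \<beta> n multiplies the tail by 39/38, and 19/20 times 39/38 is
    39/40, so the recursion still contracts.\<close>
  define \<beta> where "\<beta> = (38/39::real) powr \<alpha>"
  have \<beta>: "0 < \<beta>" "\<beta> < 1" using \<alpha>_pos powr_less_mono2[of \<alpha> "38/39" 1] by (auto simp: \<beta>_def)
  \<comment> \<open>The n steps split into \<beta> n for the induction, \<delta> n for the climb,
    and a further \<delta> n \<ge> 2 that absorbs the rounding of \<open>m\<close> and the first
    step.\<close>
  define \<delta> where "\<delta> = (1 - \<beta>) / 2"
  have \<delta>: "0 < \<delta>" "\<beta> = 1 - 2 * \<delta>" using \<beta> by (simp_all add: \<delta>_def field_simps)
  define K where "K = 8 / \<alpha>"
  have K: "0 < K" using \<alpha>_pos by (simp add: K_def)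
  \<comment> \<open>The first summand makes the discarded \<open>xs / 2\<close> fit into the
    remaining 1/40; the second settles the n below \<open>2 / \<delta>\<close>.\<close>
  define C where "C = 20 * (K / \<delta>) powr (1 / \<alpha>) + (2 / \<delta>) powr (1 / \<alpha>)"
  have C: "0 < C" "20 * (K / \<delta>) powr (1 / \<alpha>) \<le> C" "(2 / \<delta>) powr (1 / \<alpha>) \<le> C"
    using K \<delta> by (auto simp: C_def intro!: add_pos_pos)
  have "T 1 a b n \<le> C * real n powr (- 1 / \<alpha>)"
    if "1 \<le> n" "1/2 \<le> a" "a \<le> b" "b \<le> 1" for n a b
    using that
  proof (induction n arbitrary: a b rule: less_induct)
    case (less n)
    have n0: "0 < real n" using less.prems by simp
    show ?case
    proof (cases "\<delta> * real n < 2")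
      case True
      have "T 1 a b n \<le> b - a" by (rule T_le) (use less.prems in auto)
      also have "\<dots> \<le> 1" using less.prems by simp
      also have "1 = (2 / \<delta>) powr (1 / \<alpha>) * (2 / \<delta>) powr (- 1 / \<alpha>)"
        using \<delta> by (simp flip: powr_add)
      also have "\<dots> \<le> C * real n powr (- 1 / \<alpha>)"
        using C True \<delta> n0 \<alpha>_pos by (intro mult_mono powr_mono2') (auto simp: field_simps)
      finally show ?thesis .
    next
      case False
      define m where "m = nat \<lceil>\<beta> * real n\<rceil>"
      have m: "\<beta> * real n \<le> real m" "real m \<le> \<beta> * real n + 1"
        using \<beta> n0 by (auto simp: m_def)
      have m1: "1 \<le> m" using m(1) \<beta> n0 mult_pos_pos[of \<beta> "real n"] by linarith
      define xs where "xs = (K / (\<delta> * real n)) powr (1 / \<alpha>)"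
      have xs: "0 < xs" using K \<delta> n0 by (auto simp: xs_def)
      have "xs powr (- \<alpha>) = (\<delta> * real n) / K"
        using \<alpha>_pos K \<delta> n0 by (simp add: xs_def powr_powr powr_minus)
      then have V: "V xs = \<delta> * real n" using K by (simp add: V_def K_def[symmetric])
      have n1: "n = Suc (n - 1)" using less.prems by simp
      have le: "V xs + real m \<le> real (n - 1)"
        using False m(2) V \<delta>(2) less.prems by (simp add: algebra_simps of_nat_diff)
      have mn: "m < n" using le V_nonneg[of xs] less.prems by linarith
      have "T 1 a b (Suc (n - 1)) \<le> xs / 2 + 19/20 * (C * real m powr (- 1 / \<alpha>))"
        using less.IH[OF mn m1] xs le less.prems by (intro T_step) auto
      also have "xs = (K / \<delta>) powr (1 / \<alpha>) * real n powr (- 1 / \<alpha>)"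
        using K \<delta> n0 by (simp add: xs_def powr_mult powr_divide powr_minus field_simps)
      also have "real m powr (- 1 / \<alpha>) \<le> (\<beta> * real n) powr (- 1 / \<alpha>)"
        using m \<beta> n0 \<alpha>_pos by (intro powr_mono2') auto
      also have "\<dots> = 39/38 * real n powr (- 1 / \<alpha>)"
      proof -
        have "\<beta> powr (- 1 / \<alpha>) = (38/39) powr (-1)" using \<alpha>_pos by (simp add: \<beta>_def powr_powr)
        then show ?thesis using \<beta> n0 by (simp add: powr_mult powr_minus)
      qed
      finally have "T 1 a b n \<le> (K / \<delta>) powr (1 / \<alpha>) * real n powr (- 1 / \<alpha>) / 2
          + 19/20 * (C * (39/38 * real n powr (- 1 / \<alpha>)))"
        using C(1) n1 by simp
      also have "\<dots> \<le> C * real n powr (- 1 / \<alpha>)"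
      proof -
        have "20 * (K / \<delta>) powr (1 / \<alpha>) * real n powr (- 1 / \<alpha>) \<le> C * real n powr (- 1 / \<alpha>)"
          using C by (intro mult_right_mono) auto
        then show ?thesis by simp
      qed
      finally show ?thesis .
    qed
  qed
  then show ?thesis using C(1) by blast
qed

section \<open>The partition and the return time\<close>

text \<open>The first time at which a point lies in a full return cylinder. Only nonempty words
  compete, so the value 0 is free to mark points without a return.\<close>

definition phi :: "real \<Rightarrow> nat" where
  "phi x = (if \<exists>w. w \<noteq> [] \<and> adm w \<and> x \<in> cyl w \<inter> Y
            then LEAST n. \<exists>w. w \<noteq> [] \<and> adm w \<and> x \<in> cyl w \<and> n = length w else 0)"

definition W :: "nat list set" where
  "W = {w. w \<noteq> [] \<and> adm w \<and> cyl w \<subseteq> Y \<and> (\<forall>x\<in>cyl w. phi x = length w)}"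

definition Q :: "real set set" where "Q = cyl ` W"

definition F :: "real \<Rightarrow> real" where "F y = (f ^^ phi y) y"

lemma Y_eq_D: "Y = D 0" by simp

text \<open>A nonempty admissible cylinder lies in the domain of its first letter, and
  \<open>Y\<close> is exactly the domain of letter 0.\<close>

lemma cyl_subset_Y: assumes "adm w" "x \<in> cyl w" "x \<in> Y" shows "cyl w \<subseteq> Y"
proof (cases w)
  case (Cons k w')
  have D: "psi w z \<in> D k" if "z \<in> Y" for z using assms(1) that by (auto simp: adm_def Cons)
  then have "x \<in> D k" using assms(2) by (auto simp: cyl_def)
  then have "k = 0" using D_disjoint assms(3) unfolding Y_eq_D by blast
  then show ?thesis using D unfolding cyl_def Y_eq_D by blast
qed (simp add: cyl_Nil)

text \<open>Uniqueness of itineraries makes \<open>t\<close> a prefix of \<open>w\<close>. The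
  remaining word is admissible and its cylinder meets \<open>Y\<close>, hence lies in
  \<open>Y\<close>; applying \<open>psi t\<close> gives the inclusion.\<close>

lemma cyl_nested:
  assumes "adm t" "adm w" "length t \<le> length w" "x \<in> cyl t" "x \<in> cyl w" shows "cyl w \<subseteq> cyl t"
proof -
  define w1 w2 where "w1 = take (length t) w" and "w2 = drop (length t) w"
  have w: "w = w1 @ w2" "length w1 = length t" using assms(3) by (auto simp: w1_def w2_def)
  obtain y z where y: "y \<in> Y" "x = psi t y" and z: "z \<in> Y" "x = psi w z"
    using assms(4,5) by (auto simp: cyl_def)
  have fol: "fol w2 s" "fol w1 (psi w2 s)" if "s \<in> Y" for s
    using assms(2) that by (auto simp: adm_def w fol_append)
  have "t = w1 \<and> y = psi w2 z"
    using y z fol w assms(1) by (intro fol_unique) (auto simp: adm_def psi_append intro: psi_pos)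
  moreover have "adm w2" using fol by (simp add: adm_def)
  ultimately have "cyl w2 \<subseteq> Y" "t = w1"
    using cyl_subset_Y[of w2 y] y z by (auto simp: cyl_def)
  then show ?thesis unfolding w(1) cyl_append unfolding cyl_def[of t] by auto
qed

lemma phi_le: assumes "w \<noteq> []" "adm w" "x \<in> cyl w" "x \<in> Y" shows "1 \<le> phi x" "phi x \<le> length w"
proof -
  let ?P = "\<lambda>n. \<exists>w. w \<noteq> [] \<and> adm w \<and> x \<in> cyl w \<and> n = length w"
  have phi: "phi x = (LEAST n. ?P n)" using assms unfolding phi_def by auto
  have "?P (phi x)" unfolding phi by (rule LeastI[of ?P "length w"]) (use assms in blast)
  then show "1 \<le> phi x" by (auto simp: Suc_le_eq)
  show "phi x \<le> length w" unfolding phi by (rule Least_le) (use assms in blast)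
qed

text \<open>A shortest word at x works on its whole cylinder: a shorter word at another of its
  points would, by nesting, have a cylinder containing x as well.\<close>

lemma phi_word: assumes "phi x \<noteq> 0" obtains w where "w \<in> W" "x \<in> cyl w"
proof -
  let ?P = "\<lambda>n. \<exists>w. w \<noteq> [] \<and> adm w \<and> x \<in> cyl w \<and> n = length w"
  obtain w where w: "w \<noteq> []" "adm w" "x \<in> cyl w" "x \<in> Y"
    using assms by (auto simp: phi_def split: if_splits)
  have phi: "phi x = (LEAST n. ?P n)" using w unfolding phi_def by auto
  have "?P (phi x)" unfolding phi by (rule LeastI[of ?P "length w"]) (use w in blast)
  then obtain t where t: "t \<noteq> []" "adm t" "x \<in> cyl t" "phi x = length t" by blast
  have tY: "cyl t \<subseteq> Y" using cyl_subset_Y t w by blast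
  have "phi y = length t" if y: "y \<in> cyl t" for y
  proof (rule ccontr)
    assume ne: "phi y \<noteq> length t"
    have yY: "y \<in> Y" using y tY by blast
    let ?R = "\<lambda>n. \<exists>w. w \<noteq> [] \<and> adm w \<and> y \<in> cyl w \<and> n = length w"
    have phiy: "phi y = (LEAST n. ?R n)" using t y yY unfolding phi_def by auto
    have "?R (phi y)" unfolding phiy by (rule LeastI[of ?R "length t"]) (use t y in blast)
    then obtain s where s: "s \<noteq> []" "adm s" "y \<in> cyl s" "phi y = length s" by blast
    have less: "length s < length t" using phi_le(2)[OF t(1,2) y yY] ne s(4) by linarith
    then have "cyl t \<subseteq> cyl s" by (intro cyl_nested[OF s(2) t(2) _ s(3) y]) (rule less_imp_le)
    then have "phi x \<le> length s" using phi_le(2)[OF s(1,2)] t(3) w(4) by blast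
    then show False using less t(4) by simp
  qed
  then have "t \<in> W" using t tY by (simp add: W_def)
  then show ?thesis using that t(3) by blast
qed

lemma W_D: assumes "w \<in> W" shows "w \<noteq> []" "adm w" "cyl w \<subseteq> Y" "x \<in> cyl w \<Longrightarrow> phi x = length w"
  using assms by (auto simp: W_def)

lemma W_unique: assumes "w \<in> W" "t \<in> W" "x \<in> cyl w" "x \<in> cyl t" shows "w = t"
proof -
  obtain y z where "y \<in> Y" "x = psi w y" "z \<in> Y" "x = psi t z" using assms by (auto simp: cyl_def)
  moreover have "length w = length t" using assms W_D(4) by metis
  ultimately show ?thesis
    using fol_unique[of w t y z] assms(1,2)[THEN W_D(2)] by (auto simp: adm_def)
qed

lemma W_hd: assumes "w \<in> W" obtains w' where "w = 0 # w'"
proof -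
  obtain k w' where w: "w = k # w'" using W_D(1)[OF assms] by (cases w) auto
  have "psi w 1 \<in> cyl w" by (simp add: cyl_def)
  then have "psi w 1 \<in> D 0" using W_D(3)[OF assms] unfolding Y_eq_D by blast
  moreover have "psi w 1 \<in> D k" using W_D(2)[OF assms] by (simp add: adm_def w)
  ultimately have "k = 0" using D_disjoint by blast
  then show ?thesis using that w by blast
qed

lemma psi_in_Y: "w \<in> W \<Longrightarrow> x \<in> Y \<Longrightarrow> psi w x \<in> Y"
  using W_D(3)[of w] unfolding cyl_def by blast

text \<open>The end point 1/2, outside \<open>Y\<close>, is included because the densities will live
  on the compact interval.\<close>

lemma psi_W_in_Icc: assumes "w \<in> W" "x \<in> {1/2..1}" shows "psi w x \<in> {1/2..1}"
proof -
  obtain w' where w': "w = 0 # w'" using W_hd[OF assms(1)] .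
  have "1/2 \<le> psi w x" using assms(2) psi_pos[of x w'] by (simp add: w' chi_0)
  moreover have "psi w x \<le> psi w 1" using assms(2) by (intro psi_mono) auto
  moreover have "psi w 1 \<le> 1" using psi_in_Y[OF assms(1), of 1] by simp
  ultimately show ?thesis by simp
qed

lemma F_psi: "w \<in> W \<Longrightarrow> x \<in> Y \<Longrightarrow> F (psi w x) = x"
proof -
  assume w: "w \<in> W" and x: "x \<in> Y"
  have "phi (psi w x) = length w" using w x by (intro W_D(4)) (auto simp: cyl_def)
  then show ?thesis using W_D(2)[OF w] x by (simp add: F_def fol_funpow adm_def)
qed

lemma psi_lipschitz: assumes "0 < x" "0 < y" shows "\<bar>psi w x - psi w y\<bar> \<le> \<bar>x - y\<bar>"
proof -
  have *: "psi w b - psi w a \<le> b - a" if ab: "0 < a" "a < b" for a b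
  proof -
    have "\<exists>z>a. z < b \<and> psi w b - psi w a = (b - a) * dpsi w z"
      using ab by (intro MVT2 psi_deriv) auto
    then obtain z where "a < z" "z < b" "psi w b - psi w a = (b - a) * dpsi w z" by blast
    then show ?thesis using dpsi_le1[of z w] ab mult_left_mono[of "dpsi w z" 1 "b - a"] by simp
  qed
  show ?thesis
  proof (cases x y rule: linorder_cases)
    case less
    then show ?thesis using *[of x y] psi_mono[of x y w] assms by simp
  next
    case greater
    then show ?thesis using *[of y x] psi_mono[of y x w] assms by simp
  qed simp
qed

text \<open>The outermost letter is 0, with slope 1/2, and the other inverse branches do not
  expand.\<close>

lemma psi_contraction:
  assumes "w \<in> W" "0 < x" "0 < y" shows "\<bar>psi w x - psi w y\<bar> \<le> \<bar>x - y\<bar> / 2"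
proof -
  obtain w' where w': "w = 0 # w'" using W_hd[OF assms(1)] .
  have "psi w x - psi w y = (psi w' x - psi w' y) / 2"
    using psi_pos[OF assms(2), of w'] psi_pos[OF assms(3), of w'] by (simp add: w' chi_0 field_simps)
  then have "\<bar>psi w x - psi w y\<bar> = \<bar>psi w' x - psi w' y\<bar> / 2"
    by (simp only: abs_divide abs_numeral)
  also have "\<dots> \<le> \<bar>x - y\<bar> / 2"
    by (intro divide_right_mono psi_lipschitz assms) simp
  finally show ?thesis .
qed

lemma F_cyl: assumes "w \<in> W" "y \<in> cyl w" shows "F y \<in> Y" "psi w (F y) = y"
  using assms F_psi by (auto simp: cyl_def)

lemma F_Icc: "x \<in> {1/2..1} \<Longrightarrow> F x \<in> {1/2..1}"
proof (cases "phi x = 0")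
  case False
  then obtain w where "w \<in> W" "x \<in> cyl w" using phi_word by blast
  then have "F x \<in> Y" by (rule F_cyl(1))
  then show ?thesis by simp
qed (simp add: F_def)

lemma phi_nonzero_iff: "phi x \<noteq> 0 \<longleftrightarrow> x \<in> \<Union>Q"
proof
  assume "phi x \<noteq> 0"
  then show "x \<in> \<Union>Q" using phi_word unfolding Q_def by blast
next
  assume "x \<in> \<Union>Q"
  then obtain w where "w \<in> W" "x \<in> cyl w" by (auto simp: Q_def)
  then show "phi x \<noteq> 0" using W_D(1,4) by fastforce
qed

lemma countable_W: "countable W" by (rule countable_subset[of _ UNIV]) auto

lemma countable_Q: "countable Q" unfolding Q_def by (intro countable_image countable_W)

lemma Q_borel: "a \<in> Q \<Longrightarrow> a \<in> sets borel" by (auto simp: Q_def)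

lemma Union_Q_borel [measurable]: "\<Union>Q \<in> sets borel"
  using countable_Q Q_borel by (intro sets.countable_Union) auto

lemma disjoint_Q: "disjoint Q"
  unfolding disjoint_def Q_def using W_unique by blast

lemma phi_measurable [measurable]: "phi \<in> measurable borel (count_space UNIV)"
proof (rule measurable_count_space_eq2_countable[THEN iffD2])
  show "phi \<in> space borel \<rightarrow> UNIV \<and> (\<forall>n\<in>UNIV. phi -` {n} \<inter> space borel \<in> sets borel)"
  proof (intro conjI ballI)
    fix n :: nat
    have "phi -` {n} = (if n = 0 then - \<Union>Q else \<Union>(cyl ` {w \<in> W. length w = n}))"
    proof (cases "n = 0")
      case True
      then have "phi -` {n} = {x. \<not> phi x \<noteq> 0}" by auto
      also have "\<dots> = - \<Union>Q" unfolding phi_nonzero_iff by blast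
      finally show ?thesis using True by simp
    next
      case False
      have "phi x = n \<longleftrightarrow> (\<exists>w\<in>W. length w = n \<and> x \<in> cyl w)" for x
        using phi_word[of x] W_D(4)[of _ x] False by metis
      then show ?thesis using False by auto
    qed
    moreover have "\<Union>(cyl ` {w \<in> W. length w = n}) \<in> sets borel"
      using countable_W by (intro sets.countable_UN') (auto intro: countable_subset)
    moreover have "- \<Union>Q \<in> sets borel" using Union_Q_borel by (rule borel_comp)
    ultimately show "phi -` {n} \<inter> space borel \<in> sets borel" by simp
  qed auto
qed

lemma f_measurable [measurable]: "f \<in> borel_measurable borel"
  unfolding fM1_def M1_def frac_sym_def frac_def by measurable

lemma f_funpow_measurable [measurable]: "(f ^^ n) \<in> borel_measurable borel"
  by (induction n) (auto intro: measurable_comp[OF _ f_measurable])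

lemma F_measurable [measurable]: "F \<in> borel_measurable borel"
  unfolding F_def by (rule measurable_compose_countable[OF f_funpow_measurable phi_measurable])

lemma tail_subset: "{y. n < phi y} \<union> (Y - \<Union>Q) \<subseteq> bad 1 (1/2) 1 n \<union> {y. n < phi y \<and> y \<notin> Y}"
proof -
  have "y \<in> bad 1 (1/2) 1 n" if y: "y \<in> Y" "n < phi y \<or> phi y = 0" for y
  proof (rule ccontr)
    assume "y \<notin> bad 1 (1/2) 1 n"
    then obtain w where "1 \<le> length w" "length w \<le> n" "adm w" "y \<in> cyl w" using y by (auto simp: bad_def)
    then show False using phi_le[of w y] y by fastforce
  qed
  moreover have "phi y = 0" if "y \<notin> \<Union>Q" for y using that phi_nonzero_iff by blast
  ultimately show ?thesis by blast
qed

lemma phi_tail_subset: "{y. n < phi y} \<subseteq> bad 1 (1/2) 1 n"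
proof -
  have "y \<in> Y" if "n < phi y" for y
  proof -
    have "y \<in> \<Union>Q" using that phi_nonzero_iff by fastforce
    then show ?thesis using W_D(3) unfolding Q_def by blast
  qed
  then show ?thesis using tail_subset[of n] by blast
qed

lemma uncovered_subset: "Y - \<Union>Q \<subseteq> bad 1 (1/2) 1 n"
  using tail_subset[of n] by blast

text \<open>Points that never return lie in the uncovered set of every time n, so the tail estimate
  also shows that almost every point returns.\<close>

lemma uncovered_null: "Y - \<Union>Q \<in> null_sets lborel"
proof -
  let ?N = "Y - \<Union>Q"
  have N: "?N \<in> fmeasurable lborel"
    using uncovered_subset[of 0] by (intro fmeasurableI2[OF bad_fm[of 1 "1/2" 1 0]]) auto
  obtain C where C: "\<forall>n\<ge>1. T 1 (1/2) 1 n \<le> C * real n powr (- 1 / \<alpha>)" "0 < C"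
  proof -
    obtain C where C: "0 < C"
      "\<forall>n\<ge>1. \<forall>a b. 1/2 \<le> a \<longrightarrow> a \<le> b \<longrightarrow> b \<le> 1 \<longrightarrow> T 1 a b n \<le> C * real n powr (- 1 / \<alpha>)"
      using T_tail by blast
    have "T 1 (1/2) 1 n \<le> C * real n powr (- 1 / \<alpha>)" if "1 \<le> n" for n
      using C(2)[rule_format, OF that, of "1/2" 1] by simp
    then show ?thesis using that C(1) by blast
  qed
  have le: "measure lborel ?N \<le> C * real n powr (- 1 / \<alpha>)" if "1 \<le> n" for n
  proof -
    have "measure lborel ?N \<le> T 1 (1/2) 1 n"
      unfolding T_def using N by (intro measure_mono_fmeasurable uncovered_subset bad_fm) auto
    then show ?thesis using C(1) that by fastforce
  qed
  have "(\<lambda>n. C * real n powr (- 1 / \<alpha>)) \<longlonglongrightarrow> C * 0"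
    using \<alpha>_pos by (intro tendsto_mult tendsto_const tendsto_neg_powr filterlim_real_sequentially) auto
  then have "measure lborel ?N \<le> C * 0"
    using le by (intro LIMSEQ_le_const[of _ _ "measure lborel ?N"]) auto
  then have "measure lborel ?N = 0" using measure_nonneg[of lborel ?N] by simp
  then show ?thesis
    using N emeasure_eq_ennreal_measure[of lborel ?N] by (auto simp: null_sets_def fmeasurable_def)
qed

section \<open>Separation times and the cylinders of iterates of the induced map\<close>

lemma sep_contraction:
  assumes "z \<in> Y" "z' \<in> Y" "\<And>i. i < m \<Longrightarrow> same_elem Q ((F ^^ i) z) ((F ^^ i) z')"
  shows "\<bar>z - z'\<bar> \<le> (1/2) ^ m"
  using assms
proof (induction m arbitrary: z z')
  case (Suc m)
  obtain w where w: "w \<in> W" "z \<in> cyl w" "z' \<in> cyl w"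
    using Suc.prems(3)[of 0] by (auto simp: same_elem_def Q_def)
  have "\<bar>F z - F z'\<bar> \<le> (1/2) ^ m"
    using F_cyl(1)[OF w(1)] w Suc.prems(3)[of "Suc _"] by (intro Suc.IH) (auto simp: funpow_swap1)
  moreover have "\<bar>z - z'\<bar> \<le> \<bar>F z - F z'\<bar> / 2"
    using psi_contraction[OF w(1), of "F z" "F z'"] F_cyl[OF w(1)] w by fastforce
  ultimately show ?case by simp
qed auto

lemma theta_sep_bound:
  assumes "z \<in> Y" "z' \<in> Y" shows "\<bar>z - z'\<bar> \<le> theta_sep (1/2) Q F z z'"
proof (cases "\<exists>m. \<not> same_elem Q ((F ^^ m) z) ((F ^^ m) z')")
  case True
  then show ?thesis
    unfolding theta_sep_def using assms not_less_Least by (auto intro!: sep_contraction)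
next
  \<comment> \<open>Points that never separate coincide, which matches the default value 0.\<close>
  case False
  then have le: "\<bar>z - z'\<bar> \<le> (1/2) ^ m" for m using sep_contraction[OF assms, of m] by simp
  have "(\<lambda>m. (1/2::real) ^ m) \<longlonglongrightarrow> 0" by (intro LIMSEQ_power_zero) auto
  then have "\<bar>z - z'\<bar> \<le> 0" using le by (intro LIMSEQ_le_const) auto
  then show ?thesis using False by (simp add: theta_sep_def)
qed

text \<open>Iterating the induced map concatenates return words. The claims share one induction
  because admissibility of the longer word needs the inner cylinder to lie in \<open>Y\<close>,
  which comes from the first claim.\<close>

lemma cylinder:
  assumes "set ws \<subseteq> W"
  shows "Y \<inter> {x. \<forall>i<length ws. (F ^^ i) x \<in> cyl (ws ! i)} = cyl (concat ws)" "adm (concat ws)"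
    "x \<in> Y \<Longrightarrow> (F ^^ length ws) (psi (concat ws) x) = x"
    "x \<in> {1/2..1} \<Longrightarrow> psi (concat ws) x \<in> {1/2..1}"
  using assms
proof (induction ws arbitrary: x)
  case Nil
  { case 1 then show ?case by (simp add: cyl_Nil) }
  { case 2 then show ?case by (simp add: adm_def) }
  { case 3 then show ?case by simp }
  { case 4 then show ?case by simp }
next
  case (Cons w ws)
  {
    case 1
    then have w: "w \<in> W" and ws: "set ws \<subseteq> W" by auto
    have "x \<in> Y \<inter> {x. \<forall>i<length (w # ws). (F ^^ i) x \<in> cyl ((w # ws) ! i)} \<longleftrightarrow> x \<in> cyl (concat (w # ws))"
      (is "?l \<longleftrightarrow> ?r") for x
    proof -
      have "?l \<longleftrightarrow> x \<in> cyl w \<and> (\<forall>i<length ws. (F ^^ i) (F x) \<in> cyl (ws ! i))"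
        using W_D(3)[OF w] by (auto simp: less_Suc_eq_0_disj funpow_swap1)
      also have "\<dots> \<longleftrightarrow> (\<exists>z. x = psi w z \<and> z \<in> cyl (concat ws))"
      proof -
        have "x \<in> cyl w \<longleftrightarrow> (\<exists>z\<in>Y. x = psi w z)" by (auto simp: cyl_def)
        then show ?thesis unfolding Cons.IH(1)[OF ws, symmetric] using F_psi[OF w] by auto
      qed
      also have "\<dots> \<longleftrightarrow> ?r" by (auto simp: cyl_append)
      finally show ?thesis .
    qed
    then show ?case by blast
  }
  {
    case 2
    then have w: "w \<in> W" and ws: "set ws \<subseteq> W" by auto
    have "psi (concat ws) x \<in> Y" if "x \<in> Y" for x
      using Cons.IH(1)[OF ws] that by (auto simp: cyl_def)
    then show ?case
      using Cons.IH(2)[OF ws] W_D(2)[OF w] by (simp add: adm_def fol_append)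
  }
  {
    case 3
    then have w: "w \<in> W" and ws: "set ws \<subseteq> W" by auto
    have "psi (concat ws) x \<in> Y"
      using Cons.IH(1)[OF ws] 3(1) by (auto simp: cyl_def)
    then have "F (psi (concat (w # ws)) x) = psi (concat ws) x"
      using F_psi[OF w] by (simp add: psi_append)
    then show ?case using Cons.IH(3)[OF 3(1) ws] by (simp add: funpow_swap1)
  }
  {
    case 4
    then show ?case using Cons.IH(4)[OF 4(1)] psi_W_in_Icc by (simp add: psi_append)
  }
qed

end

section \<open>The invariant density\<close>

lemma cesaro_shift:
  fixes s :: "nat \<Rightarrow> real"
  assumes "\<And>k. 0 \<le> s k" "\<And>k. s k \<le> B"
  shows "\<bar>(\<Sum>k<Suc N. s (Suc k)) / real (Suc N) - (\<Sum>k<Suc N. s k) / real (Suc N)\<bar> \<le> B / real (Suc N)"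
proof -
  have "(\<Sum>k<Suc N. s (Suc k)) - (\<Sum>k<Suc N. s k) = s (Suc N) - s 0"
    by (subst sum_subtractf[symmetric]) (rule sum_lessThan_telescope)
  moreover have "\<bar>s (Suc N) - s 0\<bar> \<le> B" using assms[of 0] assms[of "Suc N"] by linarith
  ultimately have "\<bar>(\<Sum>k<Suc N. s (Suc k)) - (\<Sum>k<Suc N. s k)\<bar> \<le> B" by simp
  then have "\<bar>(\<Sum>k<Suc N. s (Suc k)) - (\<Sum>k<Suc N. s k)\<bar> / real (Suc N) \<le> B / real (Suc N)"
    by (intro divide_right_mono) auto
  then show ?thesis by (simp only: diff_divide_distrib[symmetric] abs_divide abs_of_nat)
qed

context lsv begin

section \<open>The transfer operator and its invariant cone\<close>

abbreviation I :: "real set" where "I \<equiv> {1/2..1}"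
abbreviation M :: "real measure" where "M \<equiv> restrict_space lborel I"

lemma nn_integral_M:
  assumes [measurable]: "h \<in> borel_measurable borel"
  shows "(\<integral>\<^sup>+x. h x \<partial>M) = (\<integral>\<^sup>+x. h x * indicator Y x \<partial>lborel)"
proof -
  have "(\<integral>\<^sup>+x. h x \<partial>M) = (\<integral>\<^sup>+x. h x * indicator I x \<partial>lborel)"
    by (rule nn_integral_restrict_space) simp
  also have "\<dots> = (\<integral>\<^sup>+x. h x * indicator Y x \<partial>lborel)"
    using AE_lborel_singleton[of "1/2"]
    by (intro nn_integral_cong_AE, eventually_elim) (auto split: split_indicator)
  finally show ?thesis .
qed

text \<open>Continuity of \<open>psi\<close> is known on the positive axis; cutting off outside
  \<open>I\<close> gives a Borel function on the line.\<close>

definition psiR :: "nat list \<Rightarrow> real \<Rightarrow> real" where "psiR w x = (if x \<in> I then psi w x else 0)"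
definition dpsiR :: "nat list \<Rightarrow> real \<Rightarrow> real" where "dpsiR w x = (if x \<in> I then dpsi w x else 0)"

lemma psiR_measurable [measurable]: "psiR w \<in> borel_measurable borel"
  unfolding psiR_def
  by (intro borel_measurable_continuous_on_if continuous_at_imp_continuous_on ballI
      DERIV_isCont[OF psi_deriv] continuous_on_const) auto

lemma dpsiR_measurable [measurable]: "dpsiR w \<in> borel_measurable borel"
  unfolding dpsiR_def
  by (intro borel_measurable_continuous_on_if continuous_at_imp_continuous_on ballI isCont_dpsi
      continuous_on_const) auto

lemma nn_integral_cyl:
  assumes [measurable]: "h \<in> borel_measurable borel"
  shows "(\<integral>\<^sup>+x. h x * indicator (cyl w) x \<partial>lborel) = (\<integral>\<^sup>+x. h (psiR w x) * ennreal (dpsiR w x) \<partial>M)"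
proof -
  have "(\<integral>\<^sup>+x. h x * indicator (cyl w) x \<partial>lborel)
      = (\<integral>\<^sup>+x. h (psi w x) * ennreal (dpsi w x) * indicator Y x \<partial>lborel)"
    unfolding cyl_eq by (intro nn_integral_psi) auto
  also have "\<dots> = (\<integral>\<^sup>+x. h (psiR w x) * ennreal (dpsiR w x) * indicator Y x \<partial>lborel)"
    by (intro nn_integral_cong) (auto simp: psiR_def dpsiR_def split: split_indicator)
  also have "\<dots> = (\<integral>\<^sup>+x. h (psiR w x) * ennreal (dpsiR w x) \<partial>M)"
    by (rule nn_integral_M[symmetric]) measurable
  finally show ?thesis .
qed

definition word :: "nat \<Rightarrow> nat list" where "word = from_nat_into UNIV"

lemma word_bij: "bij word"
  unfolding word_def by (intro bij_betw_from_nat_into) (auto simp: infinite_UNIV_listI)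

text \<open>The transfer operator of \<open>F\<close> for Lebesgue measure, as a series over all
  words with zero terms outside \<open>W\<close>.\<close>

definition P :: "(real \<Rightarrow> ennreal) \<Rightarrow> real \<Rightarrow> ennreal" where
  "P h x = (\<Sum>n. if word n \<in> W then h (psiR (word n) x) * ennreal (dpsiR (word n) x) else 0)"

lemma P_measurable [measurable]:
  assumes [measurable]: "h \<in> borel_measurable borel" shows "P h \<in> borel_measurable borel"
  unfolding P_def by measurable

text \<open>The cylinders of \<open>W\<close> partition \<open>Y\<close> up to a null set; on each
  of them the change of variables by \<open>psi w\<close> cancels \<open>F\<close>.\<close>

lemma transfer:
  assumes h[measurable]: "h \<in> borel_measurable borel" and B[measurable]: "B \<in> sets borel"
  shows "(\<integral>\<^sup>+x. h x * indicator B (F x) \<partial>M) = (\<integral>\<^sup>+x. P h x * indicator B x \<partial>M)"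
proof -
  let ?t = "\<lambda>n x. if word n \<in> W then h x * indicator B (F x) * indicator (cyl (word n)) x else (0::ennreal)"
  have "(\<integral>\<^sup>+x. h x * indicator B (F x) \<partial>M) = (\<integral>\<^sup>+x. h x * indicator B (F x) * indicator Y x \<partial>lborel)"
    by (rule nn_integral_M) measurable
  also have "\<dots> = (\<integral>\<^sup>+x. (\<Sum>n. ?t n x) \<partial>lborel)"
  proof (intro nn_integral_cong_AE)
    have "AE x in lborel. x \<notin> Y - \<Union>Q" by (rule AE_not_in[OF uncovered_null])
    then show "AE x in lborel. h x * indicator B (F x) * indicator Y x = (\<Sum>n. ?t n x)"
    proof eventually_elim
      case (elim x)
      show ?case
      proof (cases "x \<in> \<Union>Q")
        case True
        then obtain w where w: "w \<in> W" "x \<in> cyl w" by (auto simp: Q_def)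
        then obtain n where n: "word n = w" using word_bij by (metis bij_pointE)
        have "?t k x = 0" if "k \<noteq> n" for k
        proof -
          have "word k \<noteq> w" using that n word_bij by (metis bij_pointE)
          then have "x \<notin> cyl (word k)" if "word k \<in> W" using W_unique[OF w(1) that w(2)] by blast
          then show ?thesis by simp
        qed
        then have "(\<Sum>n. ?t n x) = (\<Sum>k\<in>{n}. ?t k x)" by (intro suminf_finite) auto
        moreover have "x \<in> Y" using W_D(3)[OF w(1)] w(2) by blast
        ultimately show ?thesis using n w by simp
      next
        case False
        have "?t n x = 0" for n
        proof -
          have "word n \<in> W \<Longrightarrow> x \<notin> cyl (word n)" using False unfolding Q_def by blast
          then show ?thesis by simp
        qed
        then have "(\<lambda>n. ?t n x) = (\<lambda>_. 0)" by (intro ext)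
        moreover have "x \<notin> Y" using elim False by blast
        then have "indicator Y x = (0::ennreal)" by (rule indicator_simps(2))
        ultimately show ?thesis by (simp only: suminf_zero mult_zero_right)
      qed
    qed
  qed
  also have "\<dots> = (\<Sum>n. \<integral>\<^sup>+x. ?t n x \<partial>lborel)"
    by (rule nn_integral_suminf) measurable
  also have "\<dots> = (\<Sum>n. \<integral>\<^sup>+x. (if word n \<in> W then h (psiR (word n) x) * ennreal (dpsiR (word n) x) else 0) * indicator B x \<partial>M)"
  proof (intro arg_cong[of _ _ suminf] ext)
    fix n
    show "(\<integral>\<^sup>+x. ?t n x \<partial>lborel) = (\<integral>\<^sup>+x. (if word n \<in> W then h (psiR (word n) x) * ennreal (dpsiR (word n) x) else 0) * indicator B x \<partial>M)"
    proof (cases "word n \<in> W")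
      case True
      let ?w = "word n"
      have "(\<integral>\<^sup>+x. ?t n x \<partial>lborel) = (\<integral>\<^sup>+x. (h x * indicator B (F x)) * indicator (cyl ?w) x \<partial>lborel)"
        using True by simp
      also have "\<dots> = (\<integral>\<^sup>+x. h (psiR ?w x) * indicator B (F (psiR ?w x)) * ennreal (dpsiR ?w x) \<partial>M)"
        by (rule nn_integral_cyl) measurable
      also have "\<dots> = (\<integral>\<^sup>+x. (h (psiR ?w x) * indicator B (F (psiR ?w x)) * ennreal (dpsiR ?w x)) * indicator Y x \<partial>lborel)"
        by (rule nn_integral_M) measurable
      also have "\<dots> = (\<integral>\<^sup>+x. (h (psiR ?w x) * ennreal (dpsiR ?w x) * indicator B x) * indicator Y x \<partial>lborel)"
      proof (intro nn_integral_cong)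
        fix x
        have "F (psiR ?w x) = x" if "x \<in> Y" using F_psi[OF True that] that by (simp add: psiR_def)
        then show "(h (psiR ?w x) * indicator B (F (psiR ?w x)) * ennreal (dpsiR ?w x)) * indicator Y x
          = (h (psiR ?w x) * ennreal (dpsiR ?w x) * indicator B x) * indicator Y x"
          by (cases "x \<in> Y") (simp_all add: ac_simps)
      qed
      also have "\<dots> = (\<integral>\<^sup>+x. h (psiR ?w x) * ennreal (dpsiR ?w x) * indicator B x \<partial>M)"
        by (rule nn_integral_M[symmetric]) measurable
      finally show ?thesis using True by simp
    qed simp
  qed
  also have "\<dots> = (\<integral>\<^sup>+x. (\<Sum>n. (if word n \<in> W then h (psiR (word n) x) * ennreal (dpsiR (word n) x) else 0) * indicator B x) \<partial>M)"
  proof (rule nn_integral_suminf[symmetric])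
    fix n
    have "(\<lambda>x. (if word n \<in> W then h (psiR (word n) x) * ennreal (dpsiR (word n) x) else 0) * indicator B x)
        \<in> borel_measurable borel" by measurable
    then show "(\<lambda>x. (if word n \<in> W then h (psiR (word n) x) * ennreal (dpsiR (word n) x) else 0) * indicator B x)
        \<in> borel_measurable M" by (intro measurable_restrict_space1) simp
  qed
  also have "\<dots> = (\<integral>\<^sup>+x. P h x * indicator B x \<partial>M)"
    by (simp add: P_def ennreal_suminf_multc)
  finally show ?thesis .
qed

text \<open>The two conditions mirror those on inverse branches, so \<open>P\<close> preserves them.
  Together they bound the ratio of two values on \<open>I\<close> by \<open>(y/x)^2\<close>, at most
  4.\<close>

definition cone :: "(real \<Rightarrow> ennreal) \<Rightarrow> bool" where
  "cone h \<longleftrightarrow> (\<forall>x\<in>I. \<forall>y\<in>I. x \<le> y \<longrightarrow> h y \<le> h x \<and> ennreal (x\<^sup>2) * h x \<le> ennreal (y\<^sup>2) * h y)"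

lemma cone_branch:
  assumes "cone h" "w \<in> W" "x \<in> I" "y \<in> I" "x \<le> y"
  shows "h (psi w y) * ennreal (dpsi w y) \<le> h (psi w x) * ennreal (dpsi w x)"
    "ennreal (x\<^sup>2) * (h (psi w x) * ennreal (dpsi w x)) \<le> ennreal (y\<^sup>2) * (h (psi w y) * ennreal (dpsi w y))"
proof -
  have I: "psi w x \<in> I" "psi w y \<in> I" "psi w x \<le> psi w y" "0 < x" "0 < y"
    using psi_W_in_Icc[OF assms(2)] psi_mono[of x y w] assms by auto
  have pos: "0 < psi w x" "0 < psi w y" using I by auto
  have h: "h (psi w y) \<le> h (psi w x)"
    "ennreal ((psi w x)\<^sup>2) * h (psi w x) \<le> ennreal ((psi w y)\<^sup>2) * h (psi w y)"
    using assms(1) I unfolding cone_def by blast+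
  show "h (psi w y) * ennreal (dpsi w y) \<le> h (psi w x) * ennreal (dpsi w x)"
    using h(1) dpsi_antimono[OF I(4) assms(5), of w] by (intro mult_mono ennreal_leI) auto
  \<comment> \<open>Splitting off the quotient of \<open>dpsi_quot_mono\<close> leaves the second
    cone condition for \<open>h\<close> at the point \<open>psi w z\<close>.\<close>
  have eq: "ennreal (z\<^sup>2) * (h (psi w z) * ennreal (dpsi w z))
      = (ennreal ((psi w z)\<^sup>2) * h (psi w z)) * ennreal (z\<^sup>2 * dpsi w z / (psi w z)\<^sup>2)" if z: "0 < z" for z
  proof -
    have p: "0 < psi w z" "0 < dpsi w z" using psi_pos dpsi_pos z by auto
    have "ennreal ((psi w z)\<^sup>2) * ennreal (z\<^sup>2 * dpsi w z / (psi w z)\<^sup>2) = ennreal (z\<^sup>2) * ennreal (dpsi w z)"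
      using p by (simp flip: ennreal_mult)
    then show ?thesis by (simp only: ac_simps)
  qed
  show "ennreal (x\<^sup>2) * (h (psi w x) * ennreal (dpsi w x)) \<le> ennreal (y\<^sup>2) * (h (psi w y) * ennreal (dpsi w y))"
    unfolding eq[OF I(4)] eq[OF I(5)]
    by (rule mult_mono[OF h(2) ennreal_leI[OF dpsi_quot_mono[OF I(4) assms(5)]]]) auto
qed

lemma cone_P: assumes "cone h" shows "cone (P h)"
  unfolding cone_def
proof (intro ballI impI conjI)
  fix x y assume xy: "x \<in> I" "y \<in> I" "x \<le> y"
  note b = cone_branch[OF assms _ xy]
  show "P h y \<le> P h x"
    unfolding P_def using b(1) xy by (intro suminf_le summableI) (auto simp: psiR_def dpsiR_def)
  show "ennreal (x\<^sup>2) * P h x \<le> ennreal (y\<^sup>2) * P h y"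
    unfolding P_def ennreal_suminf_cmult[symmetric]
    using b(2) xy by (intro suminf_le summableI) (auto simp: psiR_def dpsiR_def)
qed

text \<open>Normalised Lebesgue measure on \<open>Y\<close> has density \<open>2\<close>.\<close>
definition hn :: "nat \<Rightarrow> real \<Rightarrow> ennreal" where "hn n = (P ^^ n) (\<lambda>_. 2)"

lemma hn_Suc: "hn (Suc n) = P (hn n)" by (simp add: hn_def)

lemma hn_measurable [measurable]: "hn n \<in> borel_measurable borel"
  by (induction n) (simp_all add: hn_Suc P_measurable, simp add: hn_def)

lemma cone_hn: "cone (hn n)"
proof (induction n)
  case 0
  then show ?case
    by (auto simp: cone_def hn_def intro!: mult_right_mono ennreal_leI power_mono)
qed (simp add: hn_Suc cone_P)

lemma hn_step: "B \<in> sets borel \<Longrightarrow> (\<integral>\<^sup>+x. hn n x * indicator B (F x) \<partial>M) = (\<integral>\<^sup>+x. hn (Suc n) x * indicator B x \<partial>M)"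
  unfolding hn_Suc by (rule transfer) auto

lemma emeasure_M_space: "emeasure M I = ennreal (1/2)"
proof -
  have "emeasure M I = emeasure lborel I" by (subst emeasure_restrict_space) auto
  also have "\<dots> = ennreal (1 - 1/2)" by (rule emeasure_lborel_Icc) simp
  finally show ?thesis by simp
qed

lemma ennreal_half: "ennreal (1/2) * 2 = 1" "2 * ennreal (1/2) = 1"
  using ennreal_mult[of "1/2" 2] by (simp_all add: mult.commute)

lemma hn_integral: "(\<integral>\<^sup>+x. hn n x \<partial>M) = 1"
proof (induction n)
  case 0
  have "(\<integral>\<^sup>+x. hn 0 x \<partial>M) = 2 * emeasure M (space M)" by (simp add: hn_def)
  also have "\<dots> = 1"
    using emeasure_M_space ennreal_half by (simp add: space_restrict_space del: ennreal_half)
  finally show ?case .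
next
  case (Suc n)
  then show ?case using hn_step[of UNIV n] by simp
qed

lemma hn_harnack: assumes "x \<in> I" "y \<in> I" shows "hn n x \<le> 4 * hn n y"
proof (cases "x \<le> y")
  case True
  then have "ennreal (x\<^sup>2) * hn n x \<le> ennreal (y\<^sup>2) * hn n y"
    using cone_hn assms unfolding cone_def by blast
  moreover have "ennreal (1/4) * hn n x \<le> ennreal (x\<^sup>2) * hn n x"
    using assms power_mono[of "1/2" x 2] by (intro mult_right_mono ennreal_leI) (auto simp: power2_eq_square)
  moreover have "ennreal (y\<^sup>2) * hn n y \<le> ennreal 1 * hn n y"
    using assms power_mono[of y 1 2] by (intro mult_right_mono ennreal_leI) auto
  ultimately have "ennreal (1/4) * hn n x \<le> hn n y" by simp
  then have "4 * (ennreal (1/4) * hn n x) \<le> 4 * hn n y" by (rule mult_left_mono) simp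
  moreover have "4 * (ennreal (1/4) * hn n x) = ennreal (4 * (1/4)) * hn n x"
    by (subst ennreal_mult) (auto simp: mult.assoc)
  ultimately show ?thesis by simp
next
  case False
  then have "1 * hn n x \<le> 4 * hn n y"
    using cone_hn assms unfolding cone_def by (intro mult_mono) auto
  then show ?thesis by simp
qed

text \<open>The mean over \<open>I\<close>, of length 1/2, is 2, and the Harnack inequality allows a
  factor 4 either way.\<close>

lemma hn_bounds: assumes "x \<in> I" shows "hn n x \<le> 8" "1 \<le> 2 * hn n x"
proof -
  have c: "(\<integral>\<^sup>+y. c \<partial>M) = c * ennreal (1/2)" for c
    by (simp add: space_restrict_space emeasure_M_space del: ennreal_half)
  have "(\<integral>\<^sup>+y. hn n x \<partial>M) \<le> (\<integral>\<^sup>+y. 4 * hn n y \<partial>M)"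
    using assms by (intro nn_integral_mono hn_harnack) (auto simp: space_restrict_space)
  also have "\<dots> = 4"
    using hn_integral by (subst nn_integral_cmult) (auto intro: measurable_restrict_space1)
  finally have "hn n x * ennreal (1/2) * 2 \<le> 4 * 2" unfolding c by (rule mult_right_mono) simp
  then show "hn n x \<le> 8" unfolding mult.assoc ennreal_half by simp
  have "(1::ennreal) \<le> (\<integral>\<^sup>+y. 4 * hn n x \<partial>M)"
    unfolding hn_integral[of n, symmetric]
    using assms by (intro nn_integral_mono hn_harnack) (auto simp: space_restrict_space)
  also have "\<dots> = 2 * hn n x * (2 * ennreal (1/2))" unfolding c by (simp add: mult.assoc mult.left_commute)
  finally show "1 \<le> 2 * hn n x" unfolding ennreal_half by simp
qed

text \<open>The value 1 outside \<open>I\<close> lies between 1/2 and 8, so the bounds hold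
  everywhere.\<close>

definition r :: "nat \<Rightarrow> real \<Rightarrow> real" where "r n x = (if x \<in> I then enn2real (hn n x) else 1)"

lemma r_eq: "x \<in> I \<Longrightarrow> r n x = enn2real (hn n x)" "x \<notin> I \<Longrightarrow> r n x = 1"
  unfolding r_def by (rule if_P, assumption, rule if_not_P, assumption)

lemma hn_r: assumes "x \<in> I" shows "hn n x = ennreal (r n x)"
proof -
  have "hn n x < top" using hn_bounds(1)[OF assms, of n] by (rule le_less_trans) simp
  then show ?thesis unfolding r_eq(1)[OF assms] by simp
qed

definition rcone :: "(real \<Rightarrow> real) \<Rightarrow> bool" where
  "rcone h \<longleftrightarrow> (\<forall>x\<in>I. \<forall>y\<in>I. x \<le> y \<longrightarrow> h y \<le> h x \<and> x\<^sup>2 * h x \<le> y\<^sup>2 * h y)"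

lemma r_props:
  "r n \<in> borel_measurable borel" "rcone (r n)" "1/2 \<le> r n x" "r n x \<le> 8"
proof -
  show "r n \<in> borel_measurable borel" unfolding r_def by measurable
  show "1/2 \<le> r n x"
  proof (cases "x \<in> I")
    case True
    have "0 \<le> r n x" by (simp add: r_def)
    then have "ennreal 1 \<le> ennreal (2 * r n x)"
      using hn_bounds(2)[OF True, of n] hn_r[OF True, of n] by (simp add: ennreal_mult)
    then show ?thesis using \<open>0 \<le> r n x\<close> by (subst (asm) ennreal_le_iff) auto
  next
    case False
    then have "r n x = 1" by (rule r_eq(2))
    then show ?thesis by simp
  qed
  show "r n x \<le> 8"
  proof (cases "x \<in> I")
    case True
    have "ennreal (r n x) \<le> ennreal 8" using hn_bounds(1)[OF True, of n] hn_r[OF True, of n] by simp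
    then show ?thesis by (subst (asm) ennreal_le_iff) auto
  next
    case False
    then have "r n x = 1" by (rule r_eq(2))
    then show ?thesis by simp
  qed
  have nn: "0 \<le> r n x" for x by (simp add: r_def)
  show "rcone (r n)"
    unfolding rcone_def
  proof (intro ballI impI)
    fix x y assume xy: "x \<in> I" "y \<in> I" "x \<le> y"
    have "hn n y \<le> hn n x \<and> ennreal (x\<^sup>2) * hn n x \<le> ennreal (y\<^sup>2) * hn n y"
      using cone_hn xy unfolding cone_def by blast
    then show "r n y \<le> r n x \<and> x\<^sup>2 * r n x \<le> y\<^sup>2 * r n y"
      using nn xy by (simp add: hn_r ennreal_mult[symmetric])
  qed
qed

lemma square_ratio_bound: fixes x y :: real assumes "1/2 \<le> x" "x \<le> y" "y \<le> 1" shows "(y / x)\<^sup>2 - 1 \<le> 8 * (y - x)"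
proof -
  have x2: "1/4 \<le> x\<^sup>2" using power_mono[of "1/2" x 2] assms by (simp add: power2_eq_square)
  have "(y / x)\<^sup>2 - 1 = (y - x) * (y + x) / x\<^sup>2"
    using assms by (simp add: power2_eq_square field_simps)
  also have "\<dots> \<le> (y - x) * 2 / (1/4)"
    using assms x2 by (intro frac_le mult_left_mono mult_nonneg_nonneg) auto
  finally show ?thesis by simp
qed

lemma rcone_ratio: assumes "rcone h" "x \<in> I" "y \<in> I" "x \<le> y" shows "h x \<le> (y / x)\<^sup>2 * h y"
proof -
  have "x\<^sup>2 * h x \<le> y\<^sup>2 * h y" "0 < x\<^sup>2" using assms unfolding rcone_def by auto
  then show ?thesis by (simp add: power_divide field_simps)
qed

text \<open>The cone bounds relative growth by \<open>(b/a)^2 - 1\<close>, at most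
  \<open>8 (b - a)\<close>, and the values are at most 8. This supplies the equicontinuity for the
  limit.\<close>

lemma rcone_lipschitz:
  assumes "rcone h" "\<And>x. x \<in> I \<Longrightarrow> 0 \<le> h x \<and> h x \<le> 8" "x \<in> I" "y \<in> I"
  shows "\<bar>h x - h y\<bar> \<le> 64 * \<bar>x - y\<bar>"
proof -
  have *: "\<bar>h a - h b\<bar> \<le> 64 * \<bar>a - b\<bar>" if ab: "a \<in> I" "b \<in> I" "a \<le> b" for a b
  proof -
    have "h a - h b \<le> ((b / a)\<^sup>2 - 1) * h b"
      using rcone_ratio[OF assms(1) ab] by (simp add: algebra_simps)
    also have "\<dots> \<le> (8 * (b - a)) * 8"
      using square_ratio_bound[of a b] assms(2)[OF ab(2)] ab by (intro mult_mono) auto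
    finally show ?thesis using assms(1) ab by (simp add: rcone_def)
  qed
  show ?thesis using *[of x y] *[of y x] assms(3,4) by (cases "x \<le> y") (auto simp: abs_minus_commute)
qed

section \<open>Cesaro means and their limit\<close>

definition av :: "nat \<Rightarrow> real \<Rightarrow> real" where "av N x = (\<Sum>k<Suc N. r k x) / real (Suc N)"

lemma av_props:
  "av N \<in> borel_measurable borel" "rcone (av N)" "1/2 \<le> av N x" "av N x \<le> 8"
proof -
  show "av N \<in> borel_measurable borel"
    unfolding av_def using r_props(1) by measurable
  have "(\<Sum>k<Suc N. 1/2) \<le> (\<Sum>k<Suc N. r k x)" by (intro sum_mono r_props)
  then show "1/2 \<le> av N x" by (simp add: av_def field_simps del: sum.lessThan_Suc)
  have "(\<Sum>k<Suc N. r k x) \<le> (\<Sum>k<Suc N. 8)" by (intro sum_mono r_props)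
  then show "av N x \<le> 8" by (simp add: av_def field_simps del: sum.lessThan_Suc)
  show "rcone (av N)"
    unfolding rcone_def av_def times_divide_eq_right sum_distrib_left
    using r_props(2) by (auto simp: rcone_def simp del: sum.lessThan_Suc intro!: divide_right_mono sum_mono)
qed

lemma finite_measure_M: "finite_measure M"
  by (rule finite_measureI) (simp add: space_restrict_space emeasure_M_space)

definition J :: "(real \<Rightarrow> real) \<Rightarrow> real set \<Rightarrow> real" where
  "J h B = (\<integral>x. indicator B x * h x \<partial>M)"

lemma J_integrable:
  fixes h :: "real \<Rightarrow> real"
  assumes "h \<in> borel_measurable borel" "\<And>x. \<bar>h x\<bar> \<le> 8" "B \<in> sets borel"
  shows "integrable M (\<lambda>x. indicator B x * h x)"
proof (rule finite_measure.integrable_const_bound[OF finite_measure_M, where B = 8])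
  show "AE x in M. norm (indicator B x * h x) \<le> 8"
    using assms(2) by (auto split: split_indicator)
  have "(\<lambda>x. indicator B x * h x) \<in> borel_measurable borel" using assms by measurable
  then show "(\<lambda>x. indicator B x * h x) \<in> borel_measurable M" by (intro measurable_restrict_space1) simp
qed

lemma J_nn:
  assumes "h \<in> borel_measurable borel" "\<And>x. 0 \<le> h x" "\<And>x. h x \<le> 8" "B \<in> sets borel"
  shows "(\<integral>\<^sup>+x. ennreal (h x) * indicator B x \<partial>M) = ennreal (J h B)"
proof -
  have "(\<integral>\<^sup>+x. ennreal (h x) * indicator B x \<partial>M) = (\<integral>\<^sup>+x. ennreal (indicator B x * h x) \<partial>M)"
    by (intro nn_integral_cong) (auto split: split_indicator)
  also have "\<dots> = ennreal (J h B)"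
    unfolding J_def using assms by (intro nn_integral_eq_integral J_integrable) (auto simp: abs_le_iff intro: order_trans[of _ 0])
  finally show ?thesis .
qed

lemma J_r_nn: assumes "B \<in> sets borel" shows "(\<integral>\<^sup>+x. hn n x * indicator B x \<partial>M) = ennreal (J (r n) B)"
proof -
  have "(\<integral>\<^sup>+x. hn n x * indicator B x \<partial>M) = (\<integral>\<^sup>+x. ennreal (r n x) * indicator B x \<partial>M)"
    by (intro nn_integral_cong) (auto simp: space_restrict_space hn_r)
  also have "\<dots> = ennreal (J (r n) B)"
    using assms r_props order_trans[OF _ r_props(3), of 0 n] by (intro J_nn) auto
  finally show ?thesis .
qed

lemma J_nonneg: "(\<And>x. 0 \<le> h x) \<Longrightarrow> 0 \<le> J h B"
  unfolding J_def by (intro integral_nonneg_AE) auto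

lemma r_nonneg: "0 \<le> r n x" using r_props(3)[of n x] by linarith

lemma J_step: assumes "B \<in> sets borel" shows "J (r n) (F -` B) = J (r (Suc n)) B"
proof -
  have FB: "F -` B \<in> sets borel" using measurable_sets[OF F_measurable assms] by simp
  have "ennreal (J (r n) (F -` B)) = (\<integral>\<^sup>+x. hn n x * indicator (F -` B) x \<partial>M)"
    by (rule J_r_nn[OF FB, symmetric])
  also have "\<dots> = (\<integral>\<^sup>+x. hn n x * indicator B (F x) \<partial>M)"
    by (intro nn_integral_cong) (auto split: split_indicator)
  also have "\<dots> = ennreal (J (r (Suc n)) B)" unfolding hn_step[OF assms] by (rule J_r_nn[OF assms])
  finally show ?thesis using J_nonneg r_nonneg by (simp add: ennreal_inj)
qed

lemma J_r_UNIV: "J (r n) UNIV = 1"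
proof -
  have "ennreal (J (r n) UNIV) = 1" using J_r_nn[of UNIV n] hn_integral[of n] by simp
  then show ?thesis by (simp add: ennreal_eq_1)
qed

lemma J_r_le1: assumes "B \<in> sets borel" shows "J (r n) B \<le> 1"
proof -
  have "J (r n) B \<le> J (r n) UNIV"
    unfolding J_def using r_props r_nonneg assms
    by (intro integral_mono J_integrable) (auto split: split_indicator)
  then show ?thesis by (simp add: J_r_UNIV)
qed

lemma J_av: assumes "B \<in> sets borel" shows "J (av N) B = (\<Sum>k<Suc N. J (r k) B) / real (Suc N)"
proof -
  have "J (av N) B = (\<integral>x. (\<Sum>k<Suc N. indicator B x * r k x) / real (Suc N) \<partial>M)"
    unfolding J_def av_def by (simp only: times_divide_eq_right sum_distrib_left)
  also have "\<dots> = (\<Sum>k<Suc N. J (r k) B) / real (Suc N)"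
    unfolding J_def integral_divide_zero
    by (subst Bochner_Integration.integral_sum)
      (use r_props r_nonneg assms in \<open>auto intro!: J_integrable\<close>)
  finally show ?thesis .
qed

text \<open>Arzela-Ascoli gives a uniformly convergent subsequence of the means. Invariance passes
  to the limit separately for each Borel set by dominated convergence, which copes with the
  discontinuities of \<open>F\<close>.\<close>

lemma invariant_density:
  obtains h :: "real \<Rightarrow> real" where "h \<in> borel_measurable borel" "rcone h"
    "\<And>x. 1/2 \<le> h x" "\<And>x. h x \<le> 8" "J h UNIV = 1"
    "\<forall>B\<in>sets borel. J h (F -` B) = J h B"
proof -
  have lip: "\<bar>av N x - av N y\<bar> \<le> 64 * \<bar>x - y\<bar>" if "x \<in> I" "y \<in> I" for N x y
    using av_props order_trans[OF _ av_props(3), of 0 N] that by (intro rcone_lipschitz) auto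
  obtain g k where g: "continuous_on I g" "strict_mono (k :: nat \<Rightarrow> nat)"
    "\<And>e. 0 < e \<Longrightarrow> \<exists>N. \<forall>n x. n \<ge> N \<and> x \<in> I \<longrightarrow> norm (av (k n) x - g x) < e"
  proof (rule Arzela_Ascoli[of I av 8])
    show "norm (av n x) \<le> 8" for n x using av_props(3,4)[of n x] by simp
    show "\<exists>d>0. \<forall>n y. y \<in> I \<and> norm (x - y) < d \<longrightarrow> norm (av n x - av n y) < e"
      if "x \<in> I" "0 < e" for x e
    proof (intro exI[of _ "e / 64"] conjI allI impI)
      fix n y assume y: "y \<in> I \<and> norm (x - y) < e / 64"
      then have "\<bar>av n x - av n y\<bar> \<le> 64 * \<bar>x - y\<bar>" using that by (intro lip) auto
      then show "norm (av n x - av n y) < e" using y by simp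
    qed (use that in simp)
  qed auto
  have lim: "(\<lambda>n. av (k n) x) \<longlonglongrightarrow> g x" if "x \<in> I" for x
    unfolding LIMSEQ_iff using g(3) that by meson
  define h where "h x = (if x \<in> I then g x else 1)" for x
  have hm: "h \<in> borel_measurable borel"
    unfolding h_def using g(1) by (intro borel_measurable_continuous_on_if continuous_on_const) auto
  have hI: "h x = g x" if "x \<in> I" for x using that by (simp add: h_def)
  have lo: "1/2 \<le> h x" for x
  proof (cases "x \<in> I")
    case True
    then show ?thesis unfolding hI[OF True] using av_props(3) by (intro LIMSEQ_le_const[OF lim]) auto
  next
    case False
    then have "h x = 1" unfolding h_def by (rule if_not_P)
    then show ?thesis by simp
  qed
  have hi: "h x \<le> 8" for x
  proof (cases "x \<in> I")
    case True
    then show ?thesis unfolding hI[OF True] using av_props(4) by (intro LIMSEQ_le_const2[OF lim]) auto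
  next
    case False
    then have "h x = 1" unfolding h_def by (rule if_not_P)
    then show ?thesis by simp
  qed
  have cone: "rcone h"
    unfolding rcone_def
  proof (intro ballI impI conjI)
    fix x y assume xy: "x \<in> I" "y \<in> I" "x \<le> y"
    show "h y \<le> h x" unfolding hI[OF xy(1)] hI[OF xy(2)]
      using av_props(2) xy by (intro LIMSEQ_le[OF lim lim]) (auto simp: rcone_def)
    have t: "(\<lambda>n. x\<^sup>2 * av (k n) x) \<longlonglongrightarrow> x\<^sup>2 * g x" "(\<lambda>n. y\<^sup>2 * av (k n) y) \<longlonglongrightarrow> y\<^sup>2 * g y"
      by (intro tendsto_mult tendsto_const lim xy)+
    have "x\<^sup>2 * av N x \<le> y\<^sup>2 * av N y" for N
      using av_props(2)[of N] xy unfolding rcone_def by blast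
    then show "x\<^sup>2 * h x \<le> y\<^sup>2 * h y" unfolding hI[OF xy(1)] hI[OF xy(2)]
      by (intro LIMSEQ_le[OF t]) blast
  qed
  have JJ: "(\<lambda>n. J (av (k n)) B) \<longlonglongrightarrow> J h B" if B: "B \<in> sets borel" for B
    unfolding J_def
  proof (rule integral_dominated_convergence[where w = "\<lambda>_. 8"])
    have "(\<lambda>x. indicator B x * h x) \<in> borel_measurable borel"
      "(\<lambda>x. indicator B x * av (k n) x) \<in> borel_measurable borel" for n
      using hm av_props(1) B by measurable
    then show "(\<lambda>x. indicator B x * h x) \<in> borel_measurable M"
      "(\<lambda>x. indicator B x * av (k n) x) \<in> borel_measurable M" for n
      by (auto intro!: measurable_restrict_space1)
    show "integrable M (\<lambda>_. 8 :: real)" by (rule finite_measure.integrable_const[OF finite_measure_M])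
    show "AE x in M. (\<lambda>n. indicator B x * av (k n) x) \<longlonglongrightarrow> indicator B x * h x"
      by (rule AE_I2) (auto simp: space_restrict_space hI intro!: tendsto_intros lim)
    show "AE x in M. norm (indicator B x * av (k n) x) \<le> 8" for n
    proof (rule AE_I2)
      fix x
      have "\<bar>av (k n) x\<bar> \<le> 8" using av_props(3,4)[where N = "k n" and x = x] by linarith
      then show "norm (indicator B x * av (k n) x) \<le> 8" by (auto split: split_indicator)
    qed
  qed
  have tot: "J h UNIV = 1"
  proof -
    have "J (av N) UNIV = 1" for N by (simp add: J_av J_r_UNIV del: sum.lessThan_Suc)
    then show ?thesis using JJ[of UNIV] by (simp add: LIMSEQ_const_iff)
  qed
  have inv: "\<forall>B\<in>sets borel. J h (F -` B) = J h B"
  proof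
    fix B :: "real set" assume B: "B \<in> sets borel"
    have FB: "F -` B \<in> sets borel" using measurable_sets[OF F_measurable B] by simp
    \<comment> \<open>Pulling back by \<open>F\<close> shifts the index by one, so only the two end
      terms of the mean differ, both in the unit interval.\<close>
    have le: "norm (J (av N) (F -` B) - J (av N) B) \<le> 1 / real (Suc N)" for N
      unfolding J_av[OF B] J_av[OF FB] J_step[OF B] real_norm_def
      by (intro cesaro_shift J_nonneg r_nonneg J_r_le1 B)
    have "(\<lambda>N. 1 / real (Suc N)) \<longlonglongrightarrow> 0" using LIMSEQ_inverse_real_of_nat by (simp add: inverse_eq_divide)
    then have "(\<lambda>N. J (av N) (F -` B) - J (av N) B) \<longlonglongrightarrow> 0"
      by (rule Lim_null_comparison[rotated]) (intro always_eventually allI le)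
    then have "(\<lambda>n. J (av (k n)) (F -` B) - J (av (k n)) B) \<longlonglongrightarrow> 0"
      using LIMSEQ_subseq_LIMSEQ[OF _ g(2), of "\<lambda>N. J (av N) (F -` B) - J (av N) B"] by (simp add: o_def)
    moreover have "(\<lambda>n. J (av (k n)) (F -` B) - J (av (k n)) B) \<longlonglongrightarrow> J h (F -` B) - J h B"
      by (intro tendsto_diff JJ B FB)
    ultimately show "J h (F -` B) = J h B" using LIMSEQ_unique by fastforce
  qed
  show ?thesis using that[OF hm cone lo hi tot inv] .
qed

section \<open>The Gibbs--Markov property\<close>

lemma cyl_concat_unique:
  assumes "set ws \<subseteq> W" "set us \<subseteq> W" "length ws = length us"
    "y \<in> cyl (concat ws)" "y \<in> cyl (concat us)"
  shows "ws = us"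
proof (rule nth_equalityI[OF assms(3)])
  fix i assume i: "i < length ws"
  have "(F ^^ i) y \<in> cyl (ws ! i)" "(F ^^ i) y \<in> cyl (us ! i)"
    using assms(4,5) i assms(3) unfolding cylinder(1)[OF assms(1), symmetric] cylinder(1)[OF assms(2), symmetric]
    by auto
  moreover have "ws ! i \<in> W" "us ! i \<in> W" using assms i by auto
  ultimately show "ws ! i = us ! i" by (intro W_unique[of _ _ "(F ^^ i) y"])
qed

lemma refined_partition_cyl:
  assumes "a \<in> refined_partition Q F n" "1 \<le> n"
  obtains ws where "set ws \<subseteq> W" "length ws = n" "a = cyl (concat ws)"
proof -
  obtain as where as: "a = (\<Inter>i\<in>{..<n}. (F ^^ i) -` as i)" "\<forall>i<n. as i \<in> Q"
    using assms(1) by (auto simp: refined_partition_def)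
  have "\<forall>i. \<exists>w. i < n \<longrightarrow> w \<in> W \<and> as i = cyl w" using as(2) by (auto simp: Q_def)
  then obtain w where w: "\<And>i. i < n \<Longrightarrow> w i \<in> W \<and> as i = cyl (w i)" by metis
  define ws where "ws = map w [0..<n]"
  have ws: "set ws \<subseteq> W" "length ws = n" using w by (auto simp: ws_def)
  \<comment> \<open>The factor with index 0 is present because n \<ge> 1; it confines the
    intersection to \<open>Y\<close>.\<close>
  have "0 \<in> {..<n}" using assms(2) by simp
  then have "a \<subseteq> (F ^^ 0) -` as 0" unfolding as(1) by (rule INF_lower)
  then have "a \<subseteq> as 0" by simp
  also have "\<dots> \<subseteq> Y" using w[of 0] assms(2) W_D(3) by auto
  finally have "a = Y \<inter> {x. \<forall>i<length ws. (F ^^ i) x \<in> cyl (ws ! i)}"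
    using as(1) w by (auto simp: ws_def)
  then have "a = cyl (concat ws)" unfolding cylinder(1)[OF ws(1)] .
  then show ?thesis using that ws by blast
qed

lemma F_image: assumes "w \<in> W" shows "F ` cyl w = Y"
  using F_psi[OF assms] unfolding cyl_def image_image by simp

lemma F_inj: assumes "w \<in> W" shows "inj_on F (cyl w)"
  using F_cyl(2)[OF assms] by (metis inj_onI)

lemma rcone_le4: assumes "rcone s" "\<And>x. x \<in> I \<Longrightarrow> 0 \<le> s x" "x \<in> I" "y \<in> I" shows "s x \<le> 4 * s y"
proof (cases "x \<le> y")
  case True
  have "y / x \<le> 2" using assms by (simp add: field_simps)
  then have "(y / x)\<^sup>2 \<le> 2\<^sup>2" using assms by (intro power_mono) auto
  then have "(y / x)\<^sup>2 * s y \<le> 4 * s y" using assms by (intro mult_right_mono) auto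
  then show ?thesis using rcone_ratio[OF assms(1,3,4) True] by linarith
next
  case False
  then have "s x \<le> s y" using assms unfolding rcone_def by auto
  then show ?thesis using assms(2)[OF assms(4)] by linarith
qed

lemma rcone_branch:
  assumes "rcone s" "\<And>x. 0 \<le> s x" "\<And>x. x \<in> I \<Longrightarrow> psi w x \<in> I"
  shows "rcone (\<lambda>x. s (psi w x) * dpsi w x)"
  unfolding rcone_def
proof (intro ballI impI conjI)
  fix x y assume xy: "x \<in> I" "y \<in> I" "x \<le> y"
  have I: "psi w x \<in> I" "psi w y \<in> I" "psi w x \<le> psi w y" "0 < x" "0 < y"
    using assms(3) psi_mono[of x y w] xy by auto
  have s: "s (psi w y) \<le> s (psi w x)" "(psi w x)\<^sup>2 * s (psi w x) \<le> (psi w y)\<^sup>2 * s (psi w y)"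
    using assms(1) I unfolding rcone_def by blast+
  show "s (psi w y) * dpsi w y \<le> s (psi w x) * dpsi w x"
    using s(1) dpsi_antimono[OF I(4) xy(3), of w] assms(2) dpsi_pos[OF I(5), of w] by (intro mult_mono) auto
  have eq: "z\<^sup>2 * (s (psi w z) * dpsi w z) = ((psi w z)\<^sup>2 * s (psi w z)) * (z\<^sup>2 * dpsi w z / (psi w z)\<^sup>2)"
    if "0 < z" for z
    using psi_pos[OF that, of w] by simp
  show "x\<^sup>2 * (s (psi w x) * dpsi w x) \<le> y\<^sup>2 * (s (psi w y) * dpsi w y)"
    unfolding eq[OF I(4)] eq[OF I(5)]
    using assms(2) dpsi_pos[OF I(4), of w]
    by (intro mult_mono[OF s(2) dpsi_quot_mono[OF I(4) xy(3)]]) auto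
qed

text \<open>For x \<le> y each quotient is at most \<open>(y/x)^2\<close> times the other: the ratio
  bound is used for one function and plain monotonicity for the other. With the bound K the
  difference is at most \<open>((y/x)^2 - 1) K\<close>.\<close>

lemma rcone_quotient:
  assumes s: "rcone s" "\<And>x. x \<in> I \<Longrightarrow> 0 \<le> s x" and t: "rcone t" "\<And>x. x \<in> I \<Longrightarrow> 0 < t x"
    and K: "\<And>x. x \<in> I \<Longrightarrow> s x / t x \<le> K" and xy: "x \<in> I" "y \<in> I"
  shows "\<bar>s x / t x - s y / t y\<bar> \<le> 8 * K * \<bar>x - y\<bar>"
proof -
  have *: "\<bar>s x / t x - s y / t y\<bar> \<le> 8 * K * \<bar>x - y\<bar>" if xy: "x \<in> I" "y \<in> I" "x \<le> y" for x y
  proof -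
    let ?R = "(y / x)\<^sup>2"
    have tp: "0 < t x" "0 < t y" and sp: "0 \<le> s x" "0 \<le> s y" using s t xy by auto
    have K0: "0 \<le> K" using K[OF xy(1)] tp sp divide_nonneg_pos[of "s x" "t x"] by linarith
    have R: "0 \<le> ?R - 1" using xy by (auto simp: field_simps)
    have b: "?R - 1 \<le> 8 * (y - x)" using xy by (intro square_ratio_bound) auto
    have mono: "s y \<le> s x" "t y \<le> t x" using s(1) t(1) xy unfolding rcone_def by auto
    have 1: "s x / t x \<le> ?R * (s y / t y)"
    proof -
      have "s x / t x \<le> (?R * s y) / t y"
        using rcone_ratio[OF s(1) xy] mono tp sp by (intro frac_le) auto
      then show ?thesis by simp
    qed
    have 2: "s y / t y \<le> ?R * (s x / t x)"
    proof -
      have "s y * t x \<le> s x * (?R * t y)"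
        using rcone_ratio[OF t(1) xy] mono tp sp by (intro mult_mono) auto
      then have "s y * t x \<le> (?R * s x) * t y" by (simp only: ac_simps)
      then have "s y / t y \<le> (?R * s x) / t x" using tp by (intro frac_le_frac) auto
      then show ?thesis by simp
    qed
    have "(?R - 1) * (s z / t z) \<le> 8 * (y - x) * K" if "z \<in> I" for z
      using b K[OF that] K0 s(2)[OF that] t(2)[OF that] xy by (intro mult_mono) auto
    from this[OF xy(1)] this[OF xy(2)] 1 2 show ?thesis
      using xy by (simp add: algebra_simps abs_if)
  qed
  show ?thesis using *[of x y] *[of y x] xy by (cases "x \<le> y") (auto simp: abs_minus_commute)
qed

section \<open>The invariant measure and its Jacobians\<close>

context
  fixes h :: "real \<Rightarrow> real"
  assumes h_meas[measurable]: "h \<in> borel_measurable borel" and h_cone: "rcone h"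
    and h_lo: "\<And>x. 1/2 \<le> h x" and h_hi: "\<And>x. h x \<le> 8" and h_total: "J h UNIV = 1"
    and h_inv: "\<forall>B\<in>sets borel. J h (F -` B) = J h B"
begin

definition mu :: "real measure" where "mu = density M (\<lambda>x. ennreal (h x))"

lemma h_pos: "0 < h x" using h_lo[of x] by linarith

lemma hM_meas [measurable]: "(\<lambda>x. ennreal (h x)) \<in> borel_measurable M"
  by (intro measurable_restrict_space1) simp

lemma sets_mu: "sets mu = sets M" by (simp add: mu_def)

lemma space_mu: "space mu = I" by (simp add: mu_def space_restrict_space)

lemma sets_mu_iff: "B \<in> sets mu \<longleftrightarrow> B \<in> sets borel \<and> B \<subseteq> I"
  unfolding sets_mu by (subst sets_restrict_space_iff) auto

lemma emeasure_mu: assumes "B \<in> sets borel" shows "emeasure mu (B \<inter> I) = ennreal (J h B)"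
proof -
  have "B \<inter> I \<in> sets M" using assms sets_mu_iff[of "B \<inter> I"] by (simp add: sets_mu)
  then have "emeasure mu (B \<inter> I) = (\<integral>\<^sup>+x. ennreal (h x) * indicator (B \<inter> I) x \<partial>M)"
    unfolding mu_def by (intro emeasure_density) auto
  also have "\<dots> = (\<integral>\<^sup>+x. ennreal (h x) * indicator B x \<partial>M)"
    by (intro nn_integral_cong) (auto simp: space_restrict_space split: split_indicator)
  also have "\<dots> = ennreal (J h B)" using assms h_hi less_imp_le[OF h_pos] by (intro J_nn) auto
  finally show ?thesis .
qed

lemma prob_mu: "prob_space mu"
proof (rule prob_spaceI)
  show "emeasure mu (space mu) = 1" using emeasure_mu[of UNIV] by (simp add: space_mu h_total)
qed

lemma F_meas_mu: "F \<in> measurable mu mu"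
proof -
  have "F \<in> measurable M M"
    by (intro measurable_restrict_space2 measurable_restrict_space1)
      (use F_Icc F_measurable in \<open>auto simp: space_restrict_space\<close>)
  then show ?thesis by (simp cong: measurable_cong_sets add: sets_mu)
qed

lemma invariant_mu: "distr mu mu F = mu"
proof (rule measure_eqI)
  fix B assume "B \<in> sets (distr mu mu F)"
  then have B: "B \<in> sets mu" "B \<in> sets borel" "B \<subseteq> I" using sets_mu_iff by auto
  have FB: "F -` B \<in> sets borel" using measurable_sets[OF F_measurable B(2)] by simp
  have "emeasure (distr mu mu F) B = emeasure mu (F -` B \<inter> I)"
    using emeasure_distr[OF F_meas_mu B(1)] by (simp add: space_mu)
  also have "\<dots> = emeasure mu (B \<inter> I)" by (simp only: emeasure_mu FB B h_inv)
  finally show "emeasure (distr mu mu F) B = emeasure mu B" using B by (simp add: Int_absorb2)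
qed simp

lemma abs_cont_mu: "absolutely_continuous M mu"
  unfolding mu_def by (rule absolutely_continuousI_density) simp

lemma null_mu: assumes "A \<in> null_sets lborel" "A \<subseteq> I" shows "A \<in> null_sets mu"
proof -
  have "A \<in> null_sets M"
    using assms by (subst null_sets_restrict_space) auto
  then show ?thesis using abs_cont_mu by (auto simp: absolutely_continuous_def)
qed

lemma null_diff_Y: "I - Y \<in> null_sets mu"
proof (rule null_mu)
  have "I - Y = {1/2}" by auto
  moreover have "{1/2::real} \<in> null_sets lborel" by (intro null_setsI) auto
  ultimately show "I - Y \<in> null_sets lborel" by (simp only:)
qed auto

lemma null_uncovered: "space mu - \<Union>Q \<in> null_sets mu"
proof -
  have "space mu - \<Union>Q = (I - Y) \<union> (Y - \<Union>Q)"
    using W_D(3) unfolding space_mu Q_def by fastforce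
  moreover have "Y - \<Union>Q \<in> null_sets mu" by (rule null_mu[OF uncovered_null]) auto
  ultimately show ?thesis using null_sets.Un[OF null_diff_Y] by (simp only:)
qed

text \<open>The exponential of the potential, read at the image point z instead of at
  \<open>psi w z\<close>: the density with respect to \<open>mu\<close> of \<open>mu\<close> pulled
  back by the inverse branch.\<close>

definition jac :: "nat list \<Rightarrow> real \<Rightarrow> real" where "jac w z = h (psi w z) * dpsi w z / h z"

text \<open>S and k stand for the image of B under the iterate and for the exponential of the
  potential there; this keeps the integration apart from the inverse of the iterate.\<close>

lemma nn_integral_jac:
  assumes w: "\<And>z. z \<in> I \<Longrightarrow> psi w z \<in> I" and B: "B \<in> sets borel" "B \<subseteq> cyl w" "B \<subseteq> I"
    and S: "\<And>z. z \<in> Y \<Longrightarrow> z \<in> S \<longleftrightarrow> psi w z \<in> B" and pw: "\<And>z. z \<in> S \<Longrightarrow> z \<in> Y \<and> k z = jac w z"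
  shows "(\<integral>\<^sup>+z. indicator S z * ennreal (k z) \<partial>mu) = emeasure mu B"
proof -
  note [measurable] = B(1)
  let ?G = "\<lambda>z. indicator Y z * (indicator B (psiR w z) * ennreal (h (psiR w z) * dpsiR w z / h z))"
  have G: "?G \<in> borel_measurable borel" by measurable
  have "(\<integral>\<^sup>+z. indicator S z * ennreal (k z) \<partial>mu) = (\<integral>\<^sup>+z. ?G z \<partial>mu)"
  proof (intro nn_integral_cong)
    fix z
    show "indicator S z * ennreal (k z) = ?G z"
    proof (cases "z \<in> Y")
      case True
      then have "psiR w z = psi w z" "dpsiR w z = dpsi w z" by (auto simp: psiR_def dpsiR_def)
      then show ?thesis using S[OF True] pw[of z] True by (auto simp: jac_def split: split_indicator)
    next
      case False
      then have "z \<notin> S" using pw by blast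
      then show ?thesis using False by (simp add: indicator_def)
    qed
  qed
  also have "\<dots> = (\<integral>\<^sup>+z. ennreal (h z) * ?G z \<partial>M)"
    unfolding mu_def using G by (intro nn_integral_density measurable_restrict_space1) auto
  also have "\<dots> = (\<integral>\<^sup>+z. ennreal (h z) * ?G z * indicator Y z \<partial>lborel)"
    by (rule nn_integral_M) measurable
  also have "\<dots> = (\<integral>\<^sup>+z. (ennreal (h (psiR w z)) * indicator B (psiR w z)) * ennreal (dpsiR w z) * indicator Y z \<partial>lborel)"
  proof (intro nn_integral_cong)
    fix z
    show "ennreal (h z) * ?G z * indicator Y z = (ennreal (h (psiR w z)) * indicator B (psiR w z)) * ennreal (dpsiR w z) * indicator Y z"
    proof (cases "z \<in> Y")
      case True
      have d: "0 \<le> dpsiR w z" using True dpsi_pos[of z w] by (simp add: dpsiR_def)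
      have "ennreal (h z) * ennreal (h (psiR w z) * dpsiR w z / h z) = ennreal (h (psiR w z)) * ennreal (dpsiR w z)"
        using d less_imp_le[OF h_pos] h_pos[of z] by (simp flip: ennreal_mult)
      then show ?thesis using True by (cases "psiR w z \<in> B") (simp_all del: greaterThanAtMost_iff)
    next
      case False
      then have "indicator Y z = (0::ennreal)" by (rule indicator_simps(2))
      then show ?thesis by (simp only: mult_zero_right mult_zero_left)
    qed
  qed
  also have "\<dots> = (\<integral>\<^sup>+z. (ennreal (h (psiR w z)) * indicator B (psiR w z)) * ennreal (dpsiR w z) \<partial>M)"
    by (rule nn_integral_M[symmetric]) measurable
  also have "\<dots> = (\<integral>\<^sup>+x. (ennreal (h x) * indicator B x) * indicator (cyl w) x \<partial>lborel)"
    by (rule nn_integral_cyl[symmetric]) measurable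
  also have "\<dots> = (\<integral>\<^sup>+x. (ennreal (h x) * indicator B x) * indicator I x \<partial>lborel)"
    using B(2,3) by (intro nn_integral_cong) (auto split: split_indicator)
  also have "\<dots> = (\<integral>\<^sup>+x. ennreal (h x) * indicator B x \<partial>M)"
    by (rule nn_integral_restrict_space[symmetric]) simp
  also have "\<dots> = emeasure mu B"
    unfolding mu_def using B sets_mu_iff[of B] by (intro emeasure_density[symmetric]) (auto simp: sets_mu)
  finally show ?thesis .
qed

text \<open>Integrating the Harnack bound for the numerator over \<open>I\<close>, of length 1/2,
  gives at most 8 times the mass of the cylinder; dividing by \<open>h\<close>, at least 1/2, gives
  16.\<close>

lemma jac_bound:
  assumes ws: "set ws \<subseteq> W" and cI: "cyl (concat ws) \<subseteq> I" and z: "z \<in> I"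
  shows "jac (concat ws) z \<le> 16 * measure mu (cyl (concat ws))"
proof -
  let ?w = "concat ws"
  define s where "s z = h (psi ?w z) * dpsi ?w z" for z
  have wI: "psi ?w x \<in> I" if "x \<in> I" for x using cylinder(4)[OF ws that] .
  have s_cone: "rcone s" unfolding s_def using h_cone less_imp_le[OF h_pos] wI by (intro rcone_branch) auto
  have s0: "0 \<le> s x" if "x \<in> I" for x
    using that less_imp_le[OF h_pos] dpsi_pos[of x ?w] by (auto simp: s_def intro!: mult_nonneg_nonneg less_imp_le)
  have "ennreal (s z) * ennreal (1/2) = (\<integral>\<^sup>+x. ennreal (s z) \<partial>M)"
    by (simp add: space_restrict_space emeasure_M_space)
  also have "\<dots> \<le> (\<integral>\<^sup>+x. 4 * (ennreal (h (psiR ?w x)) * ennreal (dpsiR ?w x)) \<partial>M)"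
  proof (intro nn_integral_mono)
    fix x assume "x \<in> space M"
    then have x: "x \<in> I" by (simp add: space_restrict_space)
    have "ennreal (s z) \<le> ennreal (4 * s x)" by (intro ennreal_leI rcone_le4 s_cone s0 x z)
    also have "\<dots> = 4 * (ennreal (h (psiR ?w x)) * ennreal (dpsiR ?w x))"
      using s0[OF x] x less_imp_le[OF h_pos] dpsi_pos[of x ?w]
      by (simp add: s_def psiR_def dpsiR_def ennreal_mult less_imp_le)
    finally show "ennreal (s z) \<le> 4 * (ennreal (h (psiR ?w x)) * ennreal (dpsiR ?w x))" .
  qed
  also have "\<dots> = 4 * (\<integral>\<^sup>+x. ennreal (h (psiR ?w x)) * ennreal (dpsiR ?w x) \<partial>M)"
  proof (rule nn_integral_cmult)
    have "(\<lambda>x. ennreal (h (psiR ?w x)) * ennreal (dpsiR ?w x)) \<in> borel_measurable borel" by measurable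
    then show "(\<lambda>x. ennreal (h (psiR ?w x)) * ennreal (dpsiR ?w x)) \<in> borel_measurable M"
      by (intro measurable_restrict_space1) simp
  qed
  also have "(\<integral>\<^sup>+x. ennreal (h (psiR ?w x)) * ennreal (dpsiR ?w x) \<partial>M)
      = (\<integral>\<^sup>+x. ennreal (h x) * indicator (cyl ?w) x \<partial>lborel)"
    by (rule nn_integral_cyl[symmetric]) measurable
  also have "\<dots> = (\<integral>\<^sup>+x. ennreal (h x) * indicator (cyl ?w) x * indicator I x \<partial>lborel)"
    using cI by (intro nn_integral_cong) (auto split: split_indicator)
  also have "\<dots> = (\<integral>\<^sup>+x. ennreal (h x) * indicator (cyl ?w) x \<partial>M)"
    by (rule nn_integral_restrict_space[symmetric]) simp
  also have "\<dots> = emeasure mu (cyl ?w)"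
    unfolding mu_def using cI sets_mu_iff[of "cyl ?w"] by (intro emeasure_density[symmetric]) (auto simp: sets_mu)
  also have "\<dots> = ennreal (measure mu (cyl ?w))"
    by (rule finite_measure.emeasure_eq_measure[OF prob_space.finite_measure[OF prob_mu]])
  also have "4 * ennreal (measure mu (cyl ?w)) = ennreal (4 * measure mu (cyl ?w))"
    by (simp add: ennreal_mult)
  finally have "ennreal (s z * (1/2)) \<le> ennreal (4 * measure mu (cyl ?w))"
    using s0[OF z] by (subst ennreal_mult) auto
  then have "s z * (1/2) \<le> 4 * measure mu (cyl ?w)"
    by (subst (asm) ennreal_le_iff) auto
  then have s8: "s z \<le> 8 * measure mu (cyl ?w)" by simp
  have "jac ?w z = s z / h z" by (simp add: jac_def s_def)
  also have "\<dots> \<le> (8 * measure mu (cyl ?w)) / (1/2)"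
    using s8 s0[OF z] h_lo[of z] by (intro frac_le) auto
  finally show ?thesis by simp
qed

text \<open>The chosen list of words is unique by \<open>cyl_concat_unique\<close>, so the choice
  merely names the n-cylinder of y.\<close>

definition pot :: "nat \<Rightarrow> real \<Rightarrow> real" where
  "pot n y = ln (jac (concat (SOME ws. set ws \<subseteq> W \<and> length ws = n \<and> y \<in> cyl (concat ws))) ((F ^^ n) y))"

lemma exp_pot:
  assumes ws: "set ws \<subseteq> W" "length ws = n" and y: "y \<in> cyl (concat ws)"
  shows "exp (pot n y) = jac (concat ws) ((F ^^ n) y)"
proof -
  let ?P = "\<lambda>ws. set ws \<subseteq> W \<and> length ws = n \<and> y \<in> cyl (concat ws)"
  have "?P (Eps ?P)" by (rule someI[of ?P ws]) (use assms in auto)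
  then have "Eps ?P = ws" using ws y by (intro cyl_concat_unique[of _ _ y]) auto
  moreover have "(F ^^ n) y \<in> Y"
    using y cylinder(3)[OF ws(1)] ws(2) by (auto simp: cyl_def)
  then have "0 < jac (concat ws) ((F ^^ n) y)"
    using h_pos dpsi_pos[of "(F ^^ n) y" "concat ws"] by (auto simp: jac_def)
  ultimately show ?thesis by (simp add: pot_def)
qed

lemma gibbs_markov_mu: "gibbs_markov mu Q F"
  unfolding gibbs_markov_def
proof (intro conjI)
  show "prob_space mu" by (rule prob_mu)
  show "F \<in> measurable mu mu" by (rule F_meas_mu)
  show "distr mu mu F = mu" by (rule invariant_mu)
  show "countable Q" by (rule countable_Q)
  show "Q \<subseteq> sets mu"
  proof
    fix a assume "a \<in> Q"
    then obtain w where w: "w \<in> W" "a = cyl w" by (auto simp: Q_def)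
    then have "a \<subseteq> Y" using W_D(3) by blast
    also have "Y \<subseteq> I" by auto
    finally show "a \<in> sets mu" using w by (simp add: sets_mu_iff)
  qed
  show "disjoint Q" by (rule disjoint_Q)
  show "space mu - \<Union>Q \<in> null_sets mu" by (rule null_uncovered)
  show "\<forall>a\<in>Q. inj_on F a \<and> F ` a \<subseteq> space mu \<and> space mu - F ` a \<in> null_sets mu"
    using F_inj F_image null_diff_Y by (auto simp: Q_def space_mu)
  show "\<exists>\<theta> C1 p. 0 < \<theta> \<and> \<theta> < 1 \<and> 0 < C1 \<and>
        (\<forall>n\<ge>1. \<forall>a\<in>refined_partition Q F n.
           (\<forall>B\<in>sets mu. B \<subseteq> a \<longrightarrow>
              emeasure mu B =
                (\<integral>\<^sup>+ z. indicator ((F ^^ n) ` B) z *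
                         ennreal (exp (p n (inv_into a (F ^^ n) z))) \<partial>mu)) \<and>
           (\<forall>y\<in>a. exp (p n y) \<le> C1 * measure mu a) \<and>
           (\<forall>y\<in>a. \<forall>y'\<in>a. \<bar>exp (p n y) - exp (p n y')\<bar>
                 \<le> C1 * measure mu a * theta_sep \<theta> Q F ((F ^^ n) y) ((F ^^ n) y')))"
  \<comment> \<open>The rate 1/2 is the contraction of return branches; 128 is the 8 of
    \<open>rcone_quotient\<close> times the 16 of \<open>jac_bound\<close>.\<close>
  proof (rule exI[of _ "1/2"], rule exI[of _ 128], rule exI[of _ pot], intro conjI allI impI ballI)
    fix n :: nat and a assume n: "1 \<le> n" and a: "a \<in> refined_partition Q F n"
    obtain ws where ws: "set ws \<subseteq> W" "length ws = n" "a = cyl (concat ws)"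
      using refined_partition_cyl[OF a n] .
    let ?w = "concat ws"
    have aY: "a \<subseteq> Y" using cylinder(1)[OF ws(1)] ws(3) by auto
    then have aI: "cyl ?w \<subseteq> I" using ws(3) by auto
    have wI: "psi ?w x \<in> I" if "x \<in> I" for x using cylinder(4)[OF ws(1) that] .
    have Fn: "(F ^^ n) (psi ?w x) = x" if "x \<in> Y" for x using cylinder(3)[OF ws(1) that] ws(2) by simp
    have a_eq: "(F ^^ n) y \<in> Y \<and> psi ?w ((F ^^ n) y) = y" if "y \<in> a" for y
      using that Fn ws(3) by (auto simp: cyl_def)
    have jac_le: "jac ?w z \<le> 16 * measure mu a" if "z \<in> I" for z
      using jac_bound[OF ws(1) aI that] ws(3) by simp
    {
      fix B assume B: "B \<in> sets mu" "B \<subseteq> a"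
      show "emeasure mu B = (\<integral>\<^sup>+ z. indicator ((F ^^ n) ` B) z * ennreal (exp (pot n (inv_into a (F ^^ n) z))) \<partial>mu)"
      proof (rule nn_integral_jac[where w = ?w, symmetric])
        show "B \<in> sets borel" "B \<subseteq> I" using B sets_mu_iff by auto
        show "B \<subseteq> cyl ?w" using B ws by simp
        show "psi ?w z \<in> I" if "z \<in> I" for z using wI[OF that] .
        show "z \<in> (F ^^ n) ` B \<longleftrightarrow> psi ?w z \<in> B" if "z \<in> Y" for z
        proof
          assume "z \<in> (F ^^ n) ` B"
          then obtain y where "y \<in> B" "z = (F ^^ n) y" by blast
          then show "psi ?w z \<in> B" using a_eq[of y] B(2) by auto
        next
          assume "psi ?w z \<in> B"
          then show "z \<in> (F ^^ n) ` B" using Fn[OF that] by force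
        qed
        fix z assume "z \<in> (F ^^ n) ` B"
        then obtain y where y: "y \<in> B" "z = (F ^^ n) y" by blast
        have ya: "y \<in> a" using y B by blast
        have "inj_on (F ^^ n) a" using a_eq by (metis inj_onI)
        then have "inv_into a (F ^^ n) z = y" using ya y(2) by (simp add: inv_into_f_f)
        then show "z \<in> Y \<and> exp (pot n (inv_into a (F ^^ n) z)) = jac ?w z"
          using exp_pot[OF ws(1,2), of y] ya ws(3) a_eq[OF ya] y(2) by simp
      qed
    }
    have e: "exp (pot n y) = jac ?w ((F ^^ n) y)" if "y \<in> a" for y
      using exp_pot[OF ws(1,2)] that ws(3) by simp
    {
      fix y assume y: "y \<in> a"
      have "jac ?w ((F ^^ n) y) \<le> 16 * measure mu a" using a_eq[OF y] by (intro jac_le) auto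
      also have "\<dots> \<le> 128 * measure mu a" by simp
      finally show "exp (pot n y) \<le> 128 * measure mu a" unfolding e[OF y] .
    }
    {
      fix y y' assume y: "y \<in> a" and y': "y' \<in> a"
      let ?z = "(F ^^ n) y" and ?z' = "(F ^^ n) y'"
      have z: "?z \<in> Y" "?z' \<in> Y" "?z \<in> I" "?z' \<in> I" using a_eq[OF y] a_eq[OF y'] by auto
      have "\<bar>jac ?w ?z - jac ?w ?z'\<bar> \<le> 8 * (16 * measure mu a) * \<bar>?z - ?z'\<bar>"
        unfolding jac_def
      proof (rule rcone_quotient)
        show "rcone (\<lambda>z. h (psi ?w z) * dpsi ?w z)"
          using h_cone less_imp_le[OF h_pos] wI by (intro rcone_branch) auto
        show "rcone h" by (rule h_cone)
        show "0 \<le> h (psi ?w x) * dpsi ?w x" if "x \<in> I" for x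
          using that less_imp_le[OF h_pos] dpsi_pos[of x ?w] by (intro mult_nonneg_nonneg) auto
        show "h (psi ?w x) * dpsi ?w x / h x \<le> 16 * measure mu a" if "x \<in> I" for x
          using jac_le[OF that] by (simp add: jac_def)
      qed (use z h_pos in auto)
      also have "\<dots> \<le> 128 * measure mu a * theta_sep (1/2) Q F ?z ?z'"
        using theta_sep_bound[OF z(1,2)] by (simp add: mult_left_mono)
      finally show "\<bar>exp (pot n y) - exp (pot n y')\<bar> \<le> 128 * measure mu a * theta_sep (1/2) Q F ?z ?z'"
        unfolding e[OF y] e[OF y'] .
    }
  qed auto
qed

lemma tail_mu: "measure mu {y\<in>I. n < phi y} \<le> 8 * T 1 (1/2) 1 n"
proof -
  let ?S = "{y. n < phi y}"
  have S: "?S \<in> sets borel" by measurable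
  have fin: "emeasure lborel (bad 1 (1/2) 1 n) = ennreal (T 1 (1/2) 1 n)"
    unfolding T_def by (intro emeasure_eq_ennreal_measure) (use bad_fm[of 1 "1/2" 1 n] in \<open>auto simp: fmeasurable_def\<close>)
  have "?S \<inter> I \<in> sets M" using S sets_mu_iff[of "?S \<inter> I"] by (simp add: sets_mu)
  then have "emeasure mu (?S \<inter> I) = (\<integral>\<^sup>+x. ennreal (h x) * indicator (?S \<inter> I) x \<partial>M)"
    unfolding mu_def by (intro emeasure_density) auto
  also have "\<dots> = (\<integral>\<^sup>+x. ennreal (h x) * indicator (?S \<inter> I) x * indicator I x \<partial>lborel)"
    by (rule nn_integral_restrict_space) simp
  also have "\<dots> \<le> (\<integral>\<^sup>+x. 8 * indicator (bad 1 (1/2) 1 n) x \<partial>lborel)"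
  proof (intro nn_integral_mono)
    fix x
    have "ennreal (h x) \<le> 8" using ennreal_leI[OF h_hi[of x]] by simp
    then show "ennreal (h x) * indicator (?S \<inter> I) x * indicator I x \<le> 8 * indicator (bad 1 (1/2) 1 n) x"
      using phi_tail_subset[of n] by (auto split: split_indicator)
  qed
  also have "\<dots> = ennreal (8 * T 1 (1/2) 1 n)"
    by (simp add: nn_integral_cmult fin[simplified] ennreal_mult T_nonneg)
  finally have "measure mu (?S \<inter> I) \<le> 8 * T 1 (1/2) 1 n"
    unfolding measure_def by (intro enn2real_leI) (auto simp: T_nonneg)
  moreover have "{y\<in>I. n < phi y} = ?S \<inter> I" by auto
  ultimately show ?thesis by simp
qed

lemma phi_meas_mu: "phi \<in> measurable mu (count_space UNIV)"
proof -
  have "phi \<in> measurable M (count_space UNIV)" by (intro measurable_restrict_space1) simp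
  then show ?thesis using measurable_cong_sets[OF sets_mu refl] by blast
qed

lemma branches_mu:
  assumes "a \<in> Q" "y \<in> a"
  shows "1 \<le> phi y" "\<And>y'. y' \<in> a \<Longrightarrow> phi y' = phi y" "inj_on (f ^^ phi y) a"
    "(f ^^ phi y) ` a \<subseteq> I" "I - (f ^^ phi y) ` a \<in> null_sets mu"
proof -
  obtain w where w: "w \<in> W" "a = cyl w" using assms by (auto simp: Q_def)
  have phi: "phi y' = length w" if "y' \<in> a" for y' using W_D(4)[OF w(1)] that w(2) by blast
  show "1 \<le> phi y" using phi[OF assms(2)] W_D(1)[OF w(1)] by (simp add: Suc_le_eq)
  show "phi y' = phi y" if "y' \<in> a" for y' using phi that assms by simp
  have eq: "(f ^^ phi y) y' = F y'" if "y' \<in> a" for y' using phi that assms by (simp add: F_def)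
  show "inj_on (f ^^ phi y) a" using F_inj[OF w(1)] eq unfolding w(2)[symmetric] by (simp cong: inj_on_cong)
  have im: "(f ^^ phi y) ` a = Y" using F_image[OF w(1)] eq unfolding w(2)[symmetric] by (simp cong: image_cong)
  show "(f ^^ phi y) ` a \<subseteq> I" unfolding im by auto
  show "I - (f ^^ phi y) ` a \<in> null_sets mu" unfolding im by (rule null_diff_Y)
qed

end

lemma inducing_scheme:
  "\<exists>(Q :: real set set) (mu :: real measure) (phi :: real \<Rightarrow> nat) C.
     sets mu = sets (restrict_space lborel {1/2..1}) \<and>
     prob_space mu \<and>
     absolutely_continuous (restrict_space lborel {1/2..1}) mu \<and>
     countable Q \<and>
     (\<forall>a\<in>Q. a \<noteq> {} \<and> a \<subseteq> {1/2..1} \<and> is_interval a) \<and>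
     phi \<in> measurable mu (count_space UNIV) \<and>
     (\<forall>a\<in>Q. \<forall>y\<in>a. 1 \<le> phi y \<and> (\<forall>y'\<in>a. phi y' = phi y) \<and>
        inj_on (f ^^ phi y) a \<and>
        (f ^^ phi y) ` a \<subseteq> {1/2..1} \<and>
        {1/2..1} - (f ^^ phi y) ` a \<in> null_sets mu) \<and>
     gibbs_markov mu Q (\<lambda>y. (f ^^ phi y) y) \<and>
     0 < C \<and>
     (\<forall>n::nat\<ge>1. measure mu {y\<in>{1/2..1}. n < phi y} \<le> C * real n powr (- 1 / \<alpha>))"
proof -
  obtain h where h: "h \<in> borel_measurable borel" "rcone h"
    "\<And>x. 1/2 \<le> h x" "\<And>x. h x \<le> 8" "J h UNIV = 1"
    "\<forall>B\<in>sets borel. J h (F -` B) = J h B"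
    by (rule invariant_density) (rule that, assumption+)
  obtain C where C: "0 < C"
    "\<forall>n\<ge>1. \<forall>a b. 1/2 \<le> a \<longrightarrow> a \<le> b \<longrightarrow> b \<le> 1 \<longrightarrow> T 1 a b n \<le> C * real n powr (- 1 / \<alpha>)"
    using T_tail by blast
  have Q: "a \<noteq> {} \<and> a \<subseteq> I \<and> is_interval a" if a: "a \<in> Q" for a
  proof -
    obtain w where w: "w \<in> W" "a = cyl w" using a by (auto simp: Q_def)
    have "cyl w \<subseteq> I" using W_D(3)[OF w(1)] by fastforce
    moreover have "cyl w \<noteq> {}" by (simp add: cyl_def)
    moreover have "is_interval (cyl w)" unfolding cyl_eq by (rule is_interval_oc)
    ultimately show ?thesis using w by simp
  qed
  have tail: "measure (mu h) {y\<in>I. n < phi y} \<le> (8 * C) * real n powr (- 1 / \<alpha>)" if "1 \<le> n" for n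
    using tail_mu[OF h, of n] C(2)[rule_format, OF that, of "1/2" 1] by simp
  show ?thesis
  proof (intro exI[of _ Q] exI[of _ "mu h"] exI[of _ phi] exI[of _ "8 * C"] conjI)
    show "gibbs_markov (mu h) Q (\<lambda>y. (f ^^ phi y) y)"
      using gibbs_markov_mu[OF h] unfolding F_def[abs_def] .
    show "\<forall>a\<in>Q. \<forall>y\<in>a. 1 \<le> phi y \<and> (\<forall>y'\<in>a. phi y' = phi y) \<and> inj_on (f ^^ phi y) a \<and>
        (f ^^ phi y) ` a \<subseteq> I \<and> I - (f ^^ phi y) ` a \<in> null_sets (mu h)"
      using branches_mu[OF h] by blast
    show "sets (mu h) = sets M" by (rule sets_mu[OF h])
    show "prob_space (mu h)" by (rule prob_mu[OF h])
    show "absolutely_continuous M (mu h)" by (rule abs_cont_mu[OF h])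
    show "countable Q" by (rule countable_Q)
    show "\<forall>a\<in>Q. a \<noteq> {} \<and> a \<subseteq> I \<and> is_interval a" using Q by blast
    show "phi \<in> measurable (mu h) (count_space UNIV)" by (rule phi_meas_mu[OF h])
    show "0 < 8 * C" using C(1) by simp
    show "\<forall>n\<ge>1. measure (mu h) {y\<in>I. n < phi y} \<le> (8 * C) * real n powr (- 1 / \<alpha>)"
      using tail by blast
  qed
qed

end

lemma lsv_eventually:
  assumes "0 < \<alpha>" "\<alpha> < (1::real)" shows "\<exists>c0>0. \<forall>c1\<ge>c0. lsv \<alpha> c1"
proof -
  \<comment> \<open>One positive summand per largeness assumption of the locale, so the sum
    dominates each of them; 2400 is 24 times 100.\<close>
  define c0 where "c0 = ln 2 / (1 - \<alpha>) + ln 8 + ln 2 / \<alpha> + ln 2400 / (1 - \<alpha>)"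
  have pos: "0 < ln 2 / (1 - \<alpha>)" "0 < ln (8::real)" "0 < ln 2 / \<alpha>" "0 < ln 2400 / (1 - \<alpha>)"
    using assms by auto
  have "lsv \<alpha> c1" if "c0 \<le> c1" for c1
  proof
    have c: "ln 2 / (1 - \<alpha>) \<le> c1" "ln 8 \<le> c1" "ln 2 / \<alpha> \<le> c1" "ln 2400 / (1 - \<alpha>) \<le> c1"
      using that pos unfolding c0_def by linarith+
    show c1: "0 < c1" using c pos by linarith
    show "0 < \<alpha>" "\<alpha> < 1" by fact+
    have "ln 2 \<le> c1 * (1 - \<alpha>)" using c(1) assms by (simp add: field_simps)
    then have "ln 2 / c1 \<le> 1 - \<alpha>" using c1 by (simp add: divide_le_eq mult.commute)
    then show "\<alpha> + ln 2 / c1 \<le> 1" by simp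
    have e: "k * exp (- x) \<le> 1" if "0 < k" "ln k \<le> x" for k x :: real
    proof -
      have "k = exp (ln k)" using that by simp
      also have "\<dots> \<le> exp x" using that(2) by (simp only: exp_le_cancel_iff)
      finally show ?thesis by (simp add: exp_minus field_simps)
    qed
    show "8 * exp (- c1) \<le> 1" by (intro e c) simp
    have "ln 2 \<le> \<alpha> * c1" using c(3) assms by (simp add: field_simps)
    then show "2 * exp (- \<alpha> * c1) \<le> 1" using e[of 2 "\<alpha> * c1"] by simp
    have "ln 2400 \<le> (1 - \<alpha>) * c1" using c(4) assms by (simp add: field_simps)
    then show "24 * exp (- (1 - \<alpha>) * c1) \<le> 1/100" using e[of 2400 "(1 - \<alpha>) * c1"] by (simp add: algebra_simps)
  qed
  moreover have "0 < c0" using pos unfolding c0_def by linarith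
  ultimately show ?thesis by blast
qed

theorem theorem1p2:
  fixes \<alpha> :: real
  assumes "0 < \<alpha>" and "\<alpha> < 1"
  shows "\<exists>c0>0. \<forall>c1\<ge>c0. \<exists>(Q :: real set set) (mu :: real measure) (phi :: real \<Rightarrow> nat) C.
     sets mu = sets (restrict_space lborel {1/2..1}) \<and>
     prob_space mu \<and>
     absolutely_continuous (restrict_space lborel {1/2..1}) mu \<and>
     countable Q \<and>
     (\<forall>a\<in>Q. a \<noteq> {} \<and> a \<subseteq> {1/2..1} \<and> is_interval a) \<and>
     phi \<in> measurable mu (count_space UNIV) \<and>
     (\<forall>a\<in>Q. \<forall>y\<in>a. 1 \<le> phi y \<and> (\<forall>y'\<in>a. phi y' = phi y) \<and>
        inj_on (fM1 \<alpha> c1 ^^ phi y) a \<and>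
        (fM1 \<alpha> c1 ^^ phi y) ` a \<subseteq> {1/2..1} \<and>
        {1/2..1} - (fM1 \<alpha> c1 ^^ phi y) ` a \<in> null_sets mu) \<and>
     gibbs_markov mu Q (\<lambda>y. (fM1 \<alpha> c1 ^^ phi y) y) \<and>
     0 < C \<and>
     (\<forall>n::nat\<ge>1. measure mu {y\<in>{1/2..1}. n < phi y} \<le> C * real n powr (- 1 / \<alpha>))"
proof -
  obtain c0 where c0: "0 < c0" "\<And>c1. c0 \<le> c1 \<Longrightarrow> lsv \<alpha> c1" using lsv_eventually[OF assms] by blast
  show ?thesis using c0(1) lsv.inducing_scheme[OF c0(2)] by blast
qed

end
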